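(* Assume that there exists a constant $0<\varepsilon_0<1$ such that $0<\varepsilon_0\le\varepsilon\le 1$. If $$\frac{\sigma_s}{\beta+\sigma_s}<\varepsilon_0,$$ then the radiative integral system $$\begin{pmatrix} I-K_1 & -K_2\\ -K_4 & I-K_3\end{pmatrix}\begin{pmatrix} q\\ G\end{pmatrix}=\begin{pmatrix} f_1\\ f_2\end{pmatrix}$$ has a unique solution $(q,G)\in L^p(S)\times L^p(V)$.
   Context: Setting: $V\subset\mathbb{R}^3$ is a bounded domain with piecewise smooth boundary $S$. The constants $\sigma_a,\sigma_s\ge 0$ (absorption and scattering coefficients) satisfy $\beta:=\sigma_a+\sigma_s>0$ (extinction coefficient), and $\varepsilon$ (emissivity of the boundary) is a constant. For $\mathbf{x}\in S$ at which $S$ is smooth, $\mathbf{n}_{\mathbf{x}}$ is the outward unit normal. For points $\mathbf{p}\neq\mathbf{r}$ of $\overline V$, put $\cos\phi_p=\frac{(\mathbf{p}-\mathbf{r})\cdot\mathbf{n}_{\mathbf{p}}}{|\mathbf{p}-\mathbf{r}|}$ when $\mathbf{p}\in S$ and $\cos\phi_r=\frac{(\mathbf{r}-\mathbf{p})\cdot\mathbf{n}_{\mathbf{r}}}{|\mathbf{p}-\mathbf{r}|}$ when $\mathbf{r}\in S$. The visibility function is $\chi(\mathbf{p},\mathbf{r})=1$ if $\mathbf{r}$ can be seen by $\mathbf{p}$, i.e. there is no opaque material between them: the open segment between $\mathbf{p}$ and $\mathbf{r}$ lies in $V$ (so does not meet $S$); otherwise $\chi(\mathbf{p},\mathbf{r})=0$.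 Operators ($q$ a function on $S$, $G$ a function on $V$; $K_1q$ and $K_2G$ are functions of $\mathbf{p}\in S$, $K_3G$ and $K_4q$ are functions of $\mathbf{p}\in V$): $$(K_1q)(\mathbf{p})=\frac{1-\varepsilon}{\pi}\int_S e^{-\beta|\mathbf{p}-\mathbf{r}|}\frac{\cos\phi_p\cos\phi_r}{|\mathbf{p}-\mathbf{r}|^2}\chi(\mathbf{p},\mathbf{r})q(\mathbf{r})\,dS(\mathbf{r}),$$ $$(K_2G)(\mathbf{p})=\frac{\varepsilon\sigma_s}{4\pi}\int_V e^{-\beta|\mathbf{p}-\mathbf{r}|}\frac{\cos\phi_p}{|\mathbf{p}-\mathbf{r}|^2}\chi(\mathbf{p},\mathbf{r})G(\mathbf{r})\,dV(\mathbf{r}),$$ $$(K_3G)(\mathbf{p})=\frac{\sigma_s}{4\pi}\int_V e^{-\beta|\mathbf{p}-\mathbf{r}|}\frac{1}{|\mathbf{p}-\mathbf{r}|^2}\chi(\mathbf{p},\mathbf{r})G(\mathbf{r})\,dV(\mathbf{r}),$$ $$(K_4q)(\mathbf{p})=\frac{1-\varepsilon}{\varepsilon\pi}\int_S e^{-\beta|\mathbf{p}-\mathbf{r}|}\frac{\cos\phi_r}{|\mathbf{p}-\mathbf{r}|^2}\chi(\mathbf{p},\mathbf{r})q(\mathbf{r})\,dS(\mathbf{r}),$$ and $I$ is the identity operator. Data: the temperature $T$ on $\overline V$ is known, $E_b=\sigma T^4$ and $I_b=\sigma T^4/\pi$ with $\sigma>0$ the Stefan–Boltzmann constant, and $$f_1(\mathbf{p})=\varepsilon\int_S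 E_b(\mathbf{r})e^{-\beta|\mathbf{p}-\mathbf{r}|}\frac{\cos\phi_p\cos\phi_r}{\pi|\mathbf{p}-\mathbf{r}|^2}\chi(\mathbf{p},\mathbf{r})\,dS(\mathbf{r})-\varepsilon E_b(\mathbf{p})+\varepsilon\sigma_a\int_V I_b(\mathbf{r})e^{-\beta|\mathbf{p}-\mathbf{r}|}\frac{\cos\phi_p}{|\mathbf{p}-\mathbf{r}|^2}\chi(\mathbf{p},\mathbf{r})\,dV(\mathbf{r}),\quad \mathbf{p}\in S,$$ $$f_2(\mathbf{p})=\int_S E_b(\mathbf{r})e^{-\beta|\mathbf{p}-\mathbf{r}|}\frac{\cos\phi_r}{\pi|\mathbf{p}-\mathbf{r}|^2}\chi(\mathbf{p},\mathbf{r})\,dS(\mathbf{r})+\sigma_a\int_V I_b(\mathbf{r})e^{-\beta|\mathbf{p}-\mathbf{r}|}\frac{1}{|\mathbf{p}-\mathbf{r}|^2}\chi(\mathbf{p},\mathbf{r})\,dV(\mathbf{r}),\quad \mathbf{p}\in V.$$ Here $p\in[1,\infty]$ is any fixed exponent (not to be confused with the point $\mathbf{p}$), and $T$ is such that $f_1\in L^p(S)$ and $f_2\in L^p(V)$. *)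

theory Defs
  imports "HOL-Analysis.Analysis"
begin

section \<open>Domains with piecewise smooth boundary\<close>

text \<open>
  \<open>S = frontier V\<close> is smooth at \<open>x\<close> if near \<open>x\<close> the set \<open>V\<close> is the sublevel set \<open>{g < 0}\<close>
  of a \<open>C\<^sup>1\<close> function \<open>g\<close> without critical points; the outward unit normal is then the
  normalised gradient of \<open>g\<close>. In particular \<open>V\<close> lies on one side of \<open>S\<close> near such a point.
\<close>

definition is_outward_unit_normal :: "(real^3) set \<Rightarrow> real^3 \<Rightarrow> real^3 \<Rightarrow> bool" where
  "is_outward_unit_normal V x n \<longleftrightarrow>
     x \<in> frontier V \<and>
     (\<exists>W (g :: real^3 \<Rightarrow> real) (g' :: real^3 \<Rightarrow> real^3).
        open W \<and> x \<in> W \<and>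
        (\<forall>y\<in>W. (g has_derivative (\<lambda>h. g' y \<bullet> h)) (at y) \<and> g' y \<noteq> 0) \<and>
        continuous_on W g' \<and>
        V \<inter> W = {y \<in> W. g y < 0} \<and>
        frontier V \<inter> W = {y \<in> W. g y = 0} \<and>
        n = g' x /\<^sub>R norm (g' x))"

definition smooth_boundary_points :: "(real^3) set \<Rightarrow> (real^3) set" where
  "smooth_boundary_points V = {x. \<exists>n. is_outward_unit_normal V x n}"

definition outward_normal :: "(real^3) set \<Rightarrow> real^3 \<Rightarrow> real^3" where
  "outward_normal V x = (THE n. is_outward_unit_normal V x n)"

lemma is_outward_unit_normal_unique:
  assumes "is_outward_unit_normal V x n" and "is_outward_unit_normal V x m"
  shows "n = m"
proof -
  obtain W1 and g1 :: "real^3 \<Rightarrow> real" and d1 where 1: "open W1" "x \<in> W1"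
      "\<forall>y\<in>W1. (g1 has_derivative (\<lambda>h. d1 y \<bullet> h)) (at y) \<and> d1 y \<noteq> 0"
      "V \<inter> W1 = {y \<in> W1. g1 y < 0}" "frontier V \<inter> W1 = {y \<in> W1. g1 y = 0}"
      "n = d1 x /\<^sub>R norm (d1 x)"
    using assms(1) unfolding is_outward_unit_normal_def by blast
  obtain W2 and g2 :: "real^3 \<Rightarrow> real" and d2 where 2: "open W2" "x \<in> W2"
      "\<forall>y\<in>W2. (g2 has_derivative (\<lambda>h. d2 y \<bullet> h)) (at y) \<and> d2 y \<noteq> 0"
      "V \<inter> W2 = {y \<in> W2. g2 y < 0}" "frontier V \<inter> W2 = {y \<in> W2. g2 y = 0}"
      "m = d2 x /\<^sub>R norm (d2 x)"
    using assms(2) unfolding is_outward_unit_normal_def by blast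
  have x: "x \<in> frontier V" using assms(1) by (simp add: is_outward_unit_normal_def)
  have g0: "g1 x = 0" "g2 x = 0" using x 1(2,5) 2(2,5) by blast+
  have d0: "d1 x \<noteq> 0" "d2 x \<noteq> 0" using 1(2,3) 2(2,3) by blast+
  have nm: "norm n = 1" "norm m = 1" using d0 1(6) 2(6) by simp_all
  have dn: "d1 x = norm (d1 x) *\<^sub>R n" "d2 x = norm (d2 x) *\<^sub>R m"
    using d0 1(6) 2(6) by simp_all
  show "n = m"
  proof (rule ccontr)
    assume ne: "n \<noteq> m"
    define h where "h = m - n"
    have "(n - m) \<bullet> (n - m) > 0" using ne by simp
    then have lt: "n \<bullet> m < 1"
      using nm by (simp add: inner_diff inner_commute norm_eq_1)
    have nh: "n \<bullet> h < 0" "m \<bullet> h > 0"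
      using lt nm by (auto simp: h_def inner_diff inner_commute norm_eq_1)
    define l where "l = (\<lambda>t::real. x + t *\<^sub>R h)"
    have l: "(l has_derivative (\<lambda>t. t *\<^sub>R h)) (at 0)"
      unfolding l_def by (auto intro!: derivative_eq_intros)
    have l0: "l 0 = x" by (simp add: l_def)
    have D1: "((g1 \<circ> l) has_derivative (\<lambda>t. d1 x \<bullet> (t *\<^sub>R h))) (at 0)"
      using diff_chain_at[OF l, of g1 "\<lambda>k. d1 x \<bullet> k"] 1(2,3) l0 by (simp add: o_def)
    have D2: "((g2 \<circ> l) has_derivative (\<lambda>t. d2 x \<bullet> (t *\<^sub>R h))) (at 0)"
      using diff_chain_at[OF l, of g2 "\<lambda>k. d2 x \<bullet> k"] 2(2,3) l0 by (simp add: o_def)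
    have R1: "DERIV (g1 \<circ> l) 0 :> d1 x \<bullet> h"
      using D1 by (simp add: has_field_derivative_def mult.commute[of _ "d1 x \<bullet> h"] mult_commute_abs)
    have R2: "DERIV (g2 \<circ> l) 0 :> d2 x \<bullet> h"
      using D2 by (simp add: has_field_derivative_def mult.commute[of _ "d2 x \<bullet> h"] mult_commute_abs)
    have s1: "d1 x \<bullet> h < 0"
      using nh(1) d0(1) dn(1) by (metis inner_scaleR_left mult_pos_neg zero_less_norm_iff)
    have s2: "d2 x \<bullet> h > 0"
      using nh(2) d0(2) dn(2) by (metis inner_scaleR_left mult_pos_pos zero_less_norm_iff)
    obtain e1 where e1: "e1 > 0" "\<And>t. 0 < t \<Longrightarrow> t < e1 \<Longrightarrow> (g1 \<circ> l) (0 + t) < (g1 \<circ> l) 0"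
      using DERIV_neg_dec_right[OF R1 s1] by auto
    obtain e2 where e2: "e2 > 0" "\<And>t. 0 < t \<Longrightarrow> t < e2 \<Longrightarrow> (g2 \<circ> l) 0 < (g2 \<circ> l) (0 + t)"
      using DERIV_pos_inc_right[OF R2 s2] by auto
    have "continuous_on UNIV l" unfolding l_def by (intro continuous_intros)
    then have "open (l -` (W1 \<inter> W2))" by (rule open_vimage[OF open_Int[OF 1(1) 2(1)]])
    moreover have "0 \<in> l -` (W1 \<inter> W2)" using l0 1(2) 2(2) by simp
    ultimately have "\<exists>e>0. \<forall>t. dist t 0 < e \<longrightarrow> t \<in> l -` (W1 \<inter> W2)"
      unfolding open_dist by (rule bspec)
    then obtain e3 where e3: "e3 > 0" "\<And>t. dist t 0 < e3 \<Longrightarrow> l t \<in> W1 \<inter> W2" by blast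
    define t where "t = min e1 (min e2 e3) / 2"
    have t: "0 < t" "t < e1" "t < e2" "t < e3" using e1(1) e2(1) e3(1) by (auto simp: t_def)
    have "l t \<in> W1" "l t \<in> W2" using e3(2)[of t] t by auto
    moreover have "g1 (l t) < 0" "g2 (l t) > 0"
      using e1(2)[of t] e2(2)[of t] t l0 g0 by auto
    ultimately show False using 1(4) 2(4) by force
  qed
qed

text \<open>
  A parametrised surface element: \<open>\<gamma>\<close> is \<open>C\<^sup>1\<close> on a neighbourhood of the compact parameter
  domain \<open>D\<close>, and an injective immersion on the interior of \<open>D\<close>. The area element is
  \<open>|\<partial>\<^sub>1\<gamma> \<times> \<partial>\<^sub>2\<gamma>|\<close>.
\<close>

type_synonym patch = "(real^2) set \<times> (real^2 \<Rightarrow> real^3)"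

definition area_element :: "(real^2 \<Rightarrow> real^3) \<Rightarrow> real^2 \<Rightarrow> real" where
  "area_element \<gamma> u =
     norm (cross3 (frechet_derivative \<gamma> (at u) (axis 1 1)) (frechet_derivative \<gamma> (at u) (axis 2 1)))"

definition smooth_patch :: "(real^2) set \<Rightarrow> (real^2 \<Rightarrow> real^3) \<Rightarrow> bool" where
  "smooth_patch D \<gamma> \<longleftrightarrow>
     compact D \<and> D = closure (interior D) \<and> negligible (frontier D) \<and>
     (\<exists>U (\<gamma>' :: real^2 \<Rightarrow> (real^2, real^3) blinfun).
        open U \<and> D \<subseteq> U \<and> continuous_on U \<gamma>' \<and>
        (\<forall>u\<in>U. (\<gamma> has_derivative blinfun_apply (\<gamma>' u)) (at u))) \<and>
     inj_on \<gamma> (interior D) \<and>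
     (\<forall>u\<in>interior D. area_element \<gamma> u \<noteq> 0)"

definition patches_union :: "patch set \<Rightarrow> (real^3) set" where
  "patches_union P = (\<Union>(D, \<gamma>)\<in>P. \<gamma> ` D)"

text \<open>
  The boundary of \<open>V\<close> is piecewise smooth, with \<open>P\<close> a decomposition of it into finitely many
  surface elements without common interior points. Edges and corners of \<open>V\<close> lie in the
  images of the parameter boundaries, which have zero area.
\<close>

definition piecewise_smooth_boundary :: "(real^3) set \<Rightarrow> patch set \<Rightarrow> bool" where
  "piecewise_smooth_boundary V P \<longleftrightarrow>
     finite P \<and>
     frontier V = patches_union P \<and>
     (\<forall>(D, \<gamma>)\<in>P. smooth_patch D \<gamma> \<and> \<gamma> ` interior D \<subseteq> smooth_boundary_points V) \<and>
     disjoint_family_on (\<lambda>(D, \<gamma>). \<gamma> ` interior D) P"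

text \<open>
  The surface measure \<open>dS\<close> on the Borel subsets of the surface. By the change of variables
  formula it does not depend on the choice of the decomposition \<open>P\<close> of a given surface.
\<close>

definition surface_measure :: "patch set \<Rightarrow> (real^3) measure" where
  "surface_measure P =
     measure_of (patches_union P) (sets (restrict_space borel (patches_union P)))
       (\<lambda>A. \<Sum>(D, \<gamma>)\<in>P.
          \<integral>\<^sup>+u\<in>interior D. ennreal (area_element \<gamma> u) * indicator A (\<gamma> u) \<partial>lborel)"

lemma area_element_continuous_on:
  assumes "smooth_patch D \<gamma>"
  shows "continuous_on (interior D) (area_element \<gamma>)" and "continuous_on D \<gamma>"
proof -
  obtain U and \<gamma>' :: "real^2 \<Rightarrow> (real^2, real^3) blinfun" where U: "open U" "D \<subseteq> U"
      "continuous_on U \<gamma>'" "\<And>u. u \<in> U \<Longrightarrow> (\<gamma> has_derivative blinfun_apply (\<gamma>' u)) (at u)"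
    using assms unfolding smooth_patch_def by blast
  have eq: "frechet_derivative \<gamma> (at u) = blinfun_apply (\<gamma>' u)" if "u \<in> U" for u
    using U(4)[OF that] frechet_derivative_at by metis
  have sub: "interior D \<subseteq> U" using U(2) interior_subset by blast
  have c: "continuous_on (interior D) \<gamma>'" using U(3) sub continuous_on_subset by blast
  have "continuous_on (interior D) (\<lambda>u. norm (cross3 (\<gamma>' u (axis 1 1)) (\<gamma>' u (axis 2 1))))"
    by (intro continuous_on_norm continuous_on_cross blinfun.continuous_on c continuous_intros)
  then show "continuous_on (interior D) (area_element \<gamma>)"
    using eq sub by (simp add: area_element_def subset_iff cong: continuous_on_cong)
  show "continuous_on D \<gamma>"
    using U(2,4) by (meson continuous_at_imp_continuous_on has_derivative_continuous subsetD)
qed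

lemma patches_union_compact:
  assumes "finite P" and "\<And>D \<gamma>. (D, \<gamma>) \<in> P \<Longrightarrow> smooth_patch D \<gamma>"
  shows "compact (patches_union P)"
  unfolding patches_union_def using assms area_element_continuous_on(2)
  by (auto intro!: compact_UN compact_continuous_image simp: smooth_patch_def)

lemma emeasure_surface_measure:
  assumes "finite P" and patch: "\<And>D \<gamma>. (D, \<gamma>) \<in> P \<Longrightarrow> smooth_patch D \<gamma>"
    and A: "A \<in> sets borel" "A \<subseteq> patches_union P"
  shows "emeasure (surface_measure P) A = (\<Sum>(D, \<gamma>)\<in>P.
           \<integral>\<^sup>+u\<in>interior D. ennreal (area_element \<gamma> u) * indicator A (\<gamma> u) \<partial>lborel)"
proof -
  let ?S = "patches_union P"
  let ?M = "sets (restrict_space borel ?S)"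
  let ?f = "\<lambda>A D \<gamma> u. ennreal (area_element \<gamma> u) * indicator A (\<gamma> u) * indicator (interior D) u"
  let ?\<mu> = "\<lambda>A. \<Sum>(D, \<gamma>)\<in>P. \<integral>\<^sup>+u. ?f A D \<gamma> u \<partial>lborel"
  have S: "?S \<in> sets borel"
    using patches_union_compact[OF assms(1) patch] by (simp add: borel_compact)
  have M: "B \<in> ?M \<longleftrightarrow> B \<in> sets borel \<and> B \<subseteq> ?S" for B
    using S by (subst sets_restrict_space_iff) auto
  have meas: "(\<lambda>u. ?f B D \<gamma> u) \<in> borel_measurable borel"
    if "(D, \<gamma>) \<in> P" "B \<in> sets borel" for B D \<gamma>
  proof -
    note sp = patch[OF that(1)]
    have 1: "area_element \<gamma> \<in> borel_measurable (restrict_space borel (interior D))"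
      by (intro borel_measurable_continuous_on_restrict area_element_continuous_on[OF sp])
    have 2: "\<gamma> \<in> borel_measurable (restrict_space borel (interior D))"
      by (intro borel_measurable_continuous_on_restrict
            continuous_on_subset[OF area_element_continuous_on(2)[OF sp] interior_subset])
    have 3: "(\<lambda>u. ennreal (area_element \<gamma> u) * indicator B (\<gamma> u))
        \<in> borel_measurable (restrict_space borel (interior D))"
      using 1 2 that(2) by measurable
    show ?thesis
      using 3 by (subst (asm) borel_measurable_restrict_space_iff_ennreal) auto
  qed
  have "emeasure (surface_measure P) A = ?\<mu> A"
    unfolding surface_measure_def
  proof (rule emeasure_measure_of_sigma)
    show "sigma_algebra ?S ?M"
      using sets.sigma_algebra_axioms[of "restrict_space borel ?S"] by (simp add: space_restrict_space)
    show "positive ?M ?\<mu>" by (auto simp: positive_def)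
    show "A \<in> ?M" using A M by simp
    show "countably_additive ?M ?\<mu>"
    proof (rule countably_additiveI)
      fix B :: "nat \<Rightarrow> (real^3) set"
      assume B: "range B \<subseteq> ?M" "disjoint_family B" "(\<Union>i. B i) \<in> ?M"
      have Bb: "B i \<in> sets borel" for i using B(1) M by blast
      have one: "(\<Sum>i. \<integral>\<^sup>+u. ?f (B i) D \<gamma> u \<partial>lborel) = (\<integral>\<^sup>+u. ?f (\<Union>i. B i) D \<gamma> u \<partial>lborel)"
        if "(D, \<gamma>) \<in> P" for D \<gamma>
      proof -
        have "(\<Sum>i. ?f (B i) D \<gamma> u) = ?f (\<Union>i. B i) D \<gamma> u" for u
          using suminf_indicator[OF B(2), of "\<gamma> u"] by (simp add: ac_simps)
        then show ?thesis
          using meas[OF that Bb] by (subst nn_integral_suminf[symmetric]) auto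
      qed
      have "(\<Sum>i. ?\<mu> (B i)) = (\<Sum>(D, \<gamma>)\<in>P. \<Sum>i. \<integral>\<^sup>+u. ?f (B i) D \<gamma> u \<partial>lborel)"
        by (subst suminf_sum) (auto simp: case_prod_beta)
      also have "\<dots> = ?\<mu> (\<Union>i. B i)" using one by (auto intro!: sum.cong)
      finally show "(\<Sum>i. ?\<mu> (B i)) = ?\<mu> (\<Union>i. B i)" .
    qed
  qed
  then show ?thesis .
qed

definition Lp_space :: "'a measure \<Rightarrow> ennreal \<Rightarrow> ('a \<Rightarrow> real) set" where
  "Lp_space M p =
     {f \<in> borel_measurable M.
        if p = \<infinity> then \<exists>C. AE x in M. \<bar>f x\<bar> \<le> C
        else integrable M (\<lambda>x. \<bar>f x\<bar> powr enn2real p)}"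


section \<open>The radiative integral operators\<close>

text \<open>
  In all the formulas below, \<open>x\<close> is the point at which the function is evaluated and \<open>y\<close> is
  the integration variable; \<open>dS\<close> is the surface measure on \<open>S = frontier V\<close>.
\<close>

abbreviation volume_measure :: "(real^3) set \<Rightarrow> (real^3) measure" where
  "volume_measure V \<equiv> restrict_space lborel V"

definition visibility :: "(real^3) set \<Rightarrow> real^3 \<Rightarrow> real^3 \<Rightarrow> real" where
  "visibility V x y = (if open_segment x y \<subseteq> V then 1 else 0)"

text \<open>\<open>cos_angle V x y\<close> is the cosine of the angle at \<open>x \<in> S\<close>, seen from \<open>y\<close>.\<close>

definition cos_angle :: "(real^3) set \<Rightarrow> real^3 \<Rightarrow> real^3 \<Rightarrow> real" where
  "cos_angle V x y = ((x - y) \<bullet> outward_normal V x) / norm (x - y)"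

definition K1 :: "(real^3) set \<Rightarrow> (real^3) measure \<Rightarrow> real \<Rightarrow> real \<Rightarrow> (real^3 \<Rightarrow> real) \<Rightarrow> real^3 \<Rightarrow> real"
  where
  "K1 V dS \<beta> \<epsilon> q x = (1 - \<epsilon>) / pi *
     (\<integral>y. exp (- \<beta> * norm (x - y)) * (cos_angle V x y * cos_angle V y x / norm (x - y)^2)
          * visibility V x y * q y \<partial>dS)"

definition K2 :: "(real^3) set \<Rightarrow> real \<Rightarrow> real \<Rightarrow> real \<Rightarrow> (real^3 \<Rightarrow> real) \<Rightarrow> real^3 \<Rightarrow> real"
  where
  "K2 V \<beta> \<epsilon> \<sigma>\<^sub>s G x = \<epsilon> * \<sigma>\<^sub>s / (4 * pi) *
     (\<integral>y. exp (- \<beta> * norm (x - y)) * (cos_angle V x y / norm (x - y)^2)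
          * visibility V x y * G y \<partial>volume_measure V)"

definition K3 :: "(real^3) set \<Rightarrow> real \<Rightarrow> real \<Rightarrow> (real^3 \<Rightarrow> real) \<Rightarrow> real^3 \<Rightarrow> real"
  where
  "K3 V \<beta> \<sigma>\<^sub>s G x = \<sigma>\<^sub>s / (4 * pi) *
     (\<integral>y. exp (- \<beta> * norm (x - y)) * (1 / norm (x - y)^2)
          * visibility V x y * G y \<partial>volume_measure V)"

definition K4 :: "(real^3) set \<Rightarrow> (real^3) measure \<Rightarrow> real \<Rightarrow> real \<Rightarrow> (real^3 \<Rightarrow> real) \<Rightarrow> real^3 \<Rightarrow> real"
  where
  "K4 V dS \<beta> \<epsilon> q x = (1 - \<epsilon>) / (\<epsilon> * pi) *
     (\<integral>y. exp (- \<beta> * norm (x - y)) * (cos_angle V y x / norm (x - y)^2)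
          * visibility V x y * q y \<partial>dS)"

text \<open>The black-body emissive power and intensity at temperature \<open>T\<close>, with Stefan--Boltzmann
  constant \<open>\<sigma>\<close>.\<close>

definition E_b :: "real \<Rightarrow> (real^3 \<Rightarrow> real) \<Rightarrow> real^3 \<Rightarrow> real" where
  "E_b \<sigma> T y = \<sigma> * T y ^ 4"

definition I_b :: "real \<Rightarrow> (real^3 \<Rightarrow> real) \<Rightarrow> real^3 \<Rightarrow> real" where
  "I_b \<sigma> T y = \<sigma> * T y ^ 4 / pi"

definition f1 :: "(real^3) set \<Rightarrow> (real^3) measure \<Rightarrow> real \<Rightarrow> real \<Rightarrow> real \<Rightarrow> real \<Rightarrow>
    (real^3 \<Rightarrow> real) \<Rightarrow> real^3 \<Rightarrow> real" where
  "f1 V dS \<beta> \<epsilon> \<sigma>\<^sub>a \<sigma> T x =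
     \<epsilon> * (\<integral>y. E_b \<sigma> T y * exp (- \<beta> * norm (x - y))
              * (cos_angle V x y * cos_angle V y x / (pi * norm (x - y)^2)) * visibility V x y \<partial>dS)
     - \<epsilon> * E_b \<sigma> T x
     + \<epsilon> * \<sigma>\<^sub>a * (\<integral>y. I_b \<sigma> T y * exp (- \<beta> * norm (x - y))
              * (cos_angle V x y / norm (x - y)^2) * visibility V x y \<partial>volume_measure V)"

definition f2 :: "(real^3) set \<Rightarrow> (real^3) measure \<Rightarrow> real \<Rightarrow> real \<Rightarrow> real \<Rightarrow>
    (real^3 \<Rightarrow> real) \<Rightarrow> real^3 \<Rightarrow> real" where
  "f2 V dS \<beta> \<sigma>\<^sub>a \<sigma> T x =
     (\<integral>y. E_b \<sigma> T y * exp (- \<beta> * norm (x - y))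
          * (cos_angle V y x / (pi * norm (x - y)^2)) * visibility V x y \<partial>dS)
     + \<sigma>\<^sub>a * (\<integral>y. I_b \<sigma> T y * exp (- \<beta> * norm (x - y))
          * (1 / norm (x - y)^2) * visibility V x y \<partial>volume_measure V)"

text \<open>Elements of \<open>L\<^sup>p\<close> are represented by functions, so the system is an identity of classes:
  both equations hold almost everywhere.\<close>

definition radiative_solution :: "(real^3) set \<Rightarrow> (real^3) measure \<Rightarrow> real \<Rightarrow> real \<Rightarrow> real \<Rightarrow> ennreal \<Rightarrow>
    (real^3 \<Rightarrow> real) \<Rightarrow> (real^3 \<Rightarrow> real) \<Rightarrow> (real^3 \<Rightarrow> real) \<Rightarrow> (real^3 \<Rightarrow> real) \<Rightarrow> bool" where
  "radiative_solution V dS \<beta> \<epsilon> \<sigma>\<^sub>s p F1 F2 q G \<longleftrightarrow>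
     q \<in> Lp_space dS p \<and> G \<in> Lp_space (volume_measure V) p \<and>
     (AE x in dS. (q x - K1 V dS \<beta> \<epsilon> q x) - K2 V \<beta> \<epsilon> \<sigma>\<^sub>s G x = F1 x) \<and>
     (AE x in volume_measure V. - K4 V dS \<beta> \<epsilon> q x + (G x - K3 V \<beta> \<sigma>\<^sub>s G x) = F2 x)"

end

theory Submission
  imports Defs
begin

text \<open>
  Put \<open>S = frontier V\<close>. A pair \<open>(q, G)\<close> is one function on the disjoint union of \<open>S\<close> and \<open>V\<close>, and the
  system is the fixed point equation of an integral operator with nonnegative kernel \<open>k\<close>. If for
  positive weights \<open>h, w\<close> and some \<open>\<theta> < 1\<close> one has
  \<open>\<integral> k(x,y) h(y) dy \<le> \<theta> h(x)\<close> and \<open>\<integral> w(x) k(x,y) dx \<le> \<theta> w(y)\<close>,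
  then by Jensen's inequality the operator is a contraction for the norm of \<open>L\<^sup>p\<close> with density
  \<open>w h\<^bsup>1-p\<^esup>\<close> (for \<open>p = \<infinity>\<close>, the supremum of \<open>\<bar>u\<bar> / h\<close>), so the
  Neumann series converges in every \<open>L\<^sup>p\<close>. As the total mass is finite,
  \<open>L\<^sup>p\<close> is contained in \<open>L\<^sup>1\<close>, where uniqueness follows.

  The weights come from the energy balance of the rays leaving a point \<open>x\<close>. With \<open>R\<close> the distance to the
  first boundary point, \<open>\<beta>\<close> times the volume integral and the surface integral are the integrals of
  \<open>1 - exp (- \<beta> R)\<close> and \<open>exp (- \<beta> R)\<close> over the directions at \<open>x\<close>; their sum is at most \<open>4 \<pi>\<close> for \<open>x\<close> in \<open>V\<close>
  and \<open>\<pi>\<close> for \<open>x\<close> in \<open>S\<close> because of the cosine. Since \<open>V\<close> is bounded, the volume part is at most \<open>1 - \<delta>\<close>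
  times that total, and a fixed proportion of the radiation reaching \<open>S\<close> is absorbed.
\<close>

section \<open>Contractive positive kernels\<close>

text \<open>Only \<open>\<sigma>\<^sub>s \<le> \<beta>\<close> is available, so the medium alone
  need not lose energy; the loss has to come from the factor \<open>1 - \<epsilon>\<close> at the
  boundary. That factor takes effect only if the volume part never exhausts a ray bundle, and this
  is why the mass of \<open>\<beta> exp (- \<beta> r)\<close> beyond the diameter of
  \<open>V\<close> is bounded below uniformly in the starting point and its normal. Two weights are
  needed because the kernel is not symmetric. Its geometric part is, but the constants are a product
  of a factor at \<open>x\<close> and a different factor at \<open>y\<close>, and \<open>K4\<close>
  carries \<open>1 / \<epsilon>\<close>. Without weights neither row nor column integrals need be
  below 1. Integrals over directions never occur as such. A function \<open>c\<close> that is
  constant on rays is integrated over the sphere by integrating \<open>decay \<beta> z * c z\<close>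
  over all of space, since \<open>\<beta> exp (- \<beta> r)\<close> has integral 1 on each ray. The
  totals \<open>4 * pi\<close> and \<open>pi\<close> then follow from moments of balls, and the
  surface measure enters through cone coordinates with apex \<open>x\<close>.\<close>

lemma young_tangent:
  fixes c v p :: real
  assumes "0 < c" "0 \<le> v" "1 \<le> p"
  shows "v \<le> v powr p * c powr (1 - p) / p + (1 - 1/p) * c"
proof (cases "v = 0")
  case False
  then have v: "0 < v" using assms by simp
  \<comment> \<open>The claim is the weighted arithmetic-geometric mean inequality with weights
    \<open>1/p\<close> and \<open>1 - 1/p\<close>. Equality holds at \<open>v = c\<close>, so
    \<open>c\<close> is a tangent point that later uses may choose freely.\<close>
  have "v = (v powr p * c powr (1 - p)) powr (1/p) * c powr (1 - 1/p)"
    using v assms by (simp add: powr_mult powr_powr powr_add[symmetric] mult.assoc diff_divide_distrib)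
  also have "\<dots> \<le> (1/p) * (v powr p * c powr (1 - p)) + (1 - 1/p) * c"
    using v assms by (intro Youngs_inequality_0) auto
  finally show ?thesis by simp
qed (use assms in simp)

text \<open>Convexity of the power at the combination \<open>(1 - \<theta>) * (a / (1 - \<theta>)) +
  \<theta> * (b / \<theta>)\<close>. It takes the place of Minkowski's inequality for p-th powers:
  if \<open>b\<close> comes from an operator of norm \<open>\<theta>\<close>, this splitting
  reproduces the constant \<open>(1 - \<theta>) powr (- p)\<close> in an induction.\<close>

lemma powr_sum_le:
  fixes a b \<theta> p :: real
  assumes "0 \<le> a" "0 \<le> b" "1 \<le> p" "0 < \<theta>" "\<theta> < 1"
  shows "(a + b) powr p \<le> (1 - \<theta>) powr (1 - p) * a powr p + \<theta> powr (1 - p) * b powr p"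
proof (cases "a + b = 0")
  case False
  then have ab: "0 < a + b" using assms by simp
  define c where "c = a + b"
  have c: "0 < c" using ab by (simp add: c_def)
  let ?y = "\<lambda>t. t powr p * c powr (1 - p) / p + (1 - 1/p) * c"
  \<comment> \<open>Both tangents are taken at the same point \<open>c = a + b\<close>, so their
    constant terms add up to \<open>(1 - 1/p) * c\<close>.\<close>
  have "a / (1 - \<theta>) \<le> ?y (a / (1 - \<theta>))"
    using assms c by (intro young_tangent) auto
  then have 1: "a \<le> (1 - \<theta>) * ?y (a / (1 - \<theta>))"
    using assms by (simp add: pos_divide_le_eq mult.commute)
  have "b / \<theta> \<le> ?y (b / \<theta>)"
    using assms c by (intro young_tangent) auto
  then have 2: "b \<le> \<theta> * ?y (b / \<theta>)"
    using assms by (simp add: pos_divide_le_eq mult.commute)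
  define R where "R = (1 - \<theta>) powr (1 - p) * a powr p + \<theta> powr (1 - p) * b powr p"
  have e1: "(1 - \<theta>) * (a / (1 - \<theta>)) powr p = (1 - \<theta>) powr (1 - p) * a powr p"
    using assms by (simp add: powr_divide powr_diff)
  have e2: "\<theta> * (b / \<theta>) powr p = \<theta> powr (1 - p) * b powr p"
    using assms by (simp add: powr_divide powr_diff)
  have "(1 - \<theta>) * ?y (a / (1 - \<theta>))
      + \<theta> * ?y (b / \<theta>)
    = ((1 - \<theta>) * (a / (1 - \<theta>)) powr p + \<theta> * (b / \<theta>) powr p) * c powr (1 - p) / p + (1 - 1/p) * c"
    using assms by (simp add: field_simps)
  with 1 2 have "c \<le> R * c powr (1 - p) / p + (1 - 1/p) * c"
    unfolding e1 e2 R_def[symmetric] c_def by linarith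
  then have "c / p \<le> R * c powr (1 - p) / p" by (simp add: algebra_simps)
  then have "c \<le> R * c powr (1 - p)" using assms by (simp add: divide_le_cancel)
  then have "c * c powr (p - 1) \<le> R * c powr (1 - p) * c powr (p - 1)"
    by (intro mult_right_mono) auto
  then have "c powr p \<le> R" using c by (simp add: mult.assoc powr_add[symmetric] powr_mult_base)
  then show ?thesis by (simp add: c_def R_def)
qed (use assms in simp)

section \<open>Elementary facts on L^p\<close>

lemma Lp_space_cong:
  assumes eq: "\<And>x. x \<in> space L \<Longrightarrow> f x = g x"
  shows "f \<in> Lp_space L p \<longleftrightarrow> g \<in> Lp_space L p"
proof -
  have 1: "f \<in> borel_measurable L \<longleftrightarrow> g \<in> borel_measurable L" using eq by (rule measurable_cong)
  have 2: "(AE x in L. \<bar>f x\<bar> \<le> C) \<longleftrightarrow> (AE x in L. \<bar>g x\<bar> \<le> C)" for C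
    using eq by (intro AE_cong) simp
  have 3: "integrable L (\<lambda>x. \<bar>f x\<bar> powr enn2real p) \<longleftrightarrow> integrable L (\<lambda>x. \<bar>g x\<bar> powr enn2real p)"
    using eq by (intro Bochner_Integration.integrable_cong) auto
  show ?thesis using 1 2 3 by (simp add: Lp_space_def)
qed

lemma Lp_space_dominated:
  assumes "g \<in> Lp_space M p" "f \<in> borel_measurable M" "AE x in M. \<bar>f x\<bar> \<le> \<bar>g x\<bar>"
  shows "f \<in> Lp_space M p"
proof (cases "p = \<infinity>")
  case True
  then obtain C where "AE x in M. \<bar>g x\<bar> \<le> C" using assms by (auto simp: Lp_space_def)
  then have "AE x in M. \<bar>f x\<bar> \<le> C" using assms(3) by eventually_elim linarith
  then show ?thesis using True assms by (auto simp: Lp_space_def)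
next
  case False
  then have "integrable M (\<lambda>x. \<bar>g x\<bar> powr enn2real p)" using assms by (simp add: Lp_space_def)
  then have "integrable M (\<lambda>x. \<bar>f x\<bar> powr enn2real p)"
    by (rule Bochner_Integration.integrable_bound)
      (use assms in \<open>auto elim!: eventually_mono intro!: powr_mono2\<close>)
  then show ?thesis using False assms by (simp add: Lp_space_def)
qed

lemma enn2real_ge_1: "1 \<le> p \<Longrightarrow> p \<noteq> \<infinity> \<Longrightarrow> 1 \<le> enn2real p"
  by (metis enn2real_1 enn2real_mono infinity_ennreal_def less_top)

text \<open>For finite exponents \<open>\<bar>f x\<bar> \<le> 1 + \<bar>f x\<bar> powr r\<close>,
  and constants are integrable for a finite measure.\<close>

lemma (in finite_measure) Lp_space_imp_L1:
  assumes f: "f \<in> Lp_space M p" and p: "1 \<le> p"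
  shows "(\<integral>\<^sup>+x. ennreal \<bar>f x\<bar> \<partial>M) < \<infinity>"
proof -
  have [measurable]: "f \<in> borel_measurable M" using f by (simp add: Lp_space_def)
  obtain g :: "'a \<Rightarrow> real" where g: "integrable M g" "AE x in M. \<bar>f x\<bar> \<le> g x"
  proof (cases "p = \<infinity>")
    case True
    then obtain C where "AE x in M. \<bar>f x\<bar> \<le> C" using f by (auto simp: Lp_space_def)
    then show ?thesis by (intro that[of "\<lambda>_. C"]) auto
  next
    case False
    define r where "r = enn2real p"
    have r: "1 \<le> r" unfolding r_def by (rule enn2real_ge_1[OF p False])
    have int: "integrable M (\<lambda>x. \<bar>f x\<bar> powr r)" using f False by (simp add: Lp_space_def r_def)
    have "\<bar>f x\<bar> \<le> 1 + \<bar>f x\<bar> powr r" for x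
    proof (cases "\<bar>f x\<bar> \<le> 1")
      case False
      then have "\<bar>f x\<bar> powr 1 \<le> \<bar>f x\<bar> powr r" using r by (intro powr_mono) auto
      then show ?thesis by simp
    qed (simp add: add_increasing2)
    then show ?thesis using int by (intro that[of "\<lambda>x. 1 + \<bar>f x\<bar> powr r"]) auto
  qed
  have "integrable M f"
    by (rule Bochner_Integration.integrable_bound[OF g(1)]) (use g(2) in auto)
  then show ?thesis by (simp add: integrable_iff_bounded)
qed

text \<open>The setting of Schur's test. The weights lie between positive constants everywhere, so
  weighted and unweighted norms are equivalent. The row and column inequalities are asked for only
  almost everywhere, because on the boundary they are derived at points with a normal.\<close>

locale contractive_kernel = finite_measure M for M :: "'a measure" +
  fixes k :: "'a \<Rightarrow> 'a \<Rightarrow> real" and h w :: "'a \<Rightarrow> real" and \<theta> lo hi :: real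
  assumes k_measurable [measurable]: "(\<lambda>(x, y). k x y) \<in> borel_measurable (M \<Otimes>\<^sub>M M)"
    and k_nonneg: "\<And>x y. 0 \<le> k x y"
    and h_measurable [measurable]: "h \<in> borel_measurable M"
    and w_measurable [measurable]: "w \<in> borel_measurable M"
    and lo_pos: "0 < lo"
    and h_bounds: "\<And>x. lo \<le> h x" "\<And>x. h x \<le> hi"
    and w_bounds: "\<And>x. lo \<le> w x" "\<And>x. w x \<le> hi"
    and theta: "0 < \<theta>" "\<theta> < 1"
    and row: "AE x in M. (\<integral>\<^sup>+y. ennreal (k x y * h y) \<partial>M) \<le> ennreal (\<theta> * h x)"
    and col: "AE y in M. (\<integral>\<^sup>+x. ennreal (w x * k x y) \<partial>M) \<le> ennreal (\<theta> * w y)"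
begin

lemma h_pos: "0 < h x" and w_pos: "0 < w x"
  using lo_pos h_bounds[of x] w_bounds[of x] by auto

text \<open>Values in \<open>ennreal\<close> let order, infinite sums and Tonelli's theorem be used
  before any integrability is known; the real operator \<open>K\<close> is compared with
  \<open>N\<close> only afterwards.\<close>

definition N :: "('a \<Rightarrow> ennreal) \<Rightarrow> 'a \<Rightarrow> ennreal" where
  "N u x = (\<integral>\<^sup>+y. ennreal (k x y) * u y \<partial>M)"

lemma N_measurable [measurable]:
  assumes [measurable]: "u \<in> borel_measurable M"
  shows "N u \<in> borel_measurable M"
proof -
  have "(\<lambda>x. \<integral>\<^sup>+y. ennreal (k x y) * u y \<partial>M) \<in> borel_measurable M"
    by measurable
  then show ?thesis unfolding N_def .
qed

lemma N_mono_AE: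
  assumes "AE y in M. u y \<le> v y"
  shows "N u x \<le> N v x"
  unfolding N_def using assms by (intro nn_integral_mono_AE) (elim eventually_mono, intro mult_left_mono, auto)

lemma k_section [measurable]: "x \<in> space M \<Longrightarrow> k x \<in> borel_measurable M"
  using measurable_compose_Pair1[OF _ k_measurable] by simp

lemma N_add:
  assumes [measurable]: "u \<in> borel_measurable M" "v \<in> borel_measurable M" and "x \<in> space M"
  shows "N (\<lambda>y. u y + v y) x = N u x + N v x"
  unfolding N_def distrib_left using assms(3) by (intro nn_integral_add) measurable

lemma N_cmult:
  assumes [measurable]: "u \<in> borel_measurable M" and "x \<in> space M"
  shows "N (\<lambda>y. c * u y) x = c * N u x"
  unfolding N_def using assms(2)
  by (subst nn_integral_cmult[symmetric]) (measurable, auto simp: ac_simps)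

lemma N_weight:
  "AE x in M. N (\<lambda>y. ennreal (h y)) x \<le> ennreal (\<theta> * h x)"
  using row by (simp add: N_def ennreal_mult' k_nonneg)

abbreviation wint :: "('a \<Rightarrow> ennreal) \<Rightarrow> ennreal" where
  "wint u \<equiv> \<integral>\<^sup>+x. ennreal (w x) * u x \<partial>M"

text \<open>Tonelli's theorem brings the weight \<open>w\<close> into an inner integral over the
  first variable, where \<open>col\<close> applies.\<close>

lemma L1_contraction:
  assumes [measurable]: "u \<in> borel_measurable M"
  shows "wint (N u) \<le> ennreal \<theta> * wint u"
proof -
  interpret pair_sigma_finite M M ..
  have "wint (N u) = (\<integral>\<^sup>+x. \<integral>\<^sup>+y. ennreal (w x * k x y) * u y \<partial>M \<partial>M)"
    unfolding N_def
  proof (intro nn_integral_cong)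
    fix x assume "x \<in> space M"
    then show "ennreal (w x) * (\<integral>\<^sup>+y. ennreal (k x y) * u y \<partial>M) = (\<integral>\<^sup>+y. ennreal (w x * k x y) * u y \<partial>M)"
      using w_pos[of x]
      by (subst nn_integral_cmult[symmetric]) (measurable, auto simp: ac_simps ennreal_mult' less_imp_le)
  qed
  also have "\<dots> = (\<integral>\<^sup>+y. \<integral>\<^sup>+x. ennreal (w x * k x y) * u y \<partial>M \<partial>M)"
    by (rule Fubini') measurable
  also have "\<dots> = (\<integral>\<^sup>+y. (\<integral>\<^sup>+x. ennreal (w x * k x y) \<partial>M) * u y \<partial>M)"
    by (intro nn_integral_cong nn_integral_multc) measurable
  also have "\<dots> \<le> (\<integral>\<^sup>+y. ennreal (\<theta> * w y) * u y \<partial>M)"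
    using col by (intro nn_integral_mono_AE) (elim eventually_mono, intro mult_right_mono, auto)
  also have "\<dots> = (\<integral>\<^sup>+y. ennreal \<theta> * (ennreal (w y) * u y) \<partial>M)"
    using theta w_pos by (intro nn_integral_cong) (simp add: ennreal_mult' less_imp_le ac_simps)
  also have "\<dots> = ennreal \<theta> * wint u"
    by (intro nn_integral_cmult) measurable
  finally show ?thesis .
qed

section \<open>The Neumann series in the weighted L^1 norm and in the supremum norm\<close>

definition neumann :: "('a \<Rightarrow> ennreal) \<Rightarrow> 'a \<Rightarrow> ennreal" where
  "neumann f x = (\<Sum>n. (N ^^ n) f x)"

lemma N_pow_measurable [measurable]:
  assumes [measurable]: "f \<in> borel_measurable M"
  shows "(N ^^ n) f \<in> borel_measurable M"
  by (induction n) auto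

lemma neumann_measurable [measurable]:
  assumes [measurable]: "f \<in> borel_measurable M"
  shows "neumann f \<in> borel_measurable M"
  unfolding neumann_def by measurable

text \<open>Monotone convergence exchanges the operator with the infinite sum for nonnegative
  functions, so the identity needs no convergence and also holds where both sides are
  infinite.\<close>

lemma neumann_fixpoint:
  assumes [measurable]: "f \<in> borel_measurable M" and x: "x \<in> space M"
  shows "neumann f x = f x + N (neumann f) x"
proof -
  have "N (neumann f) x = (\<Sum>n. N ((N ^^ n) f) x)"
    unfolding N_def[of "neumann f" x] N_def[of "(N ^^ _) f" x] using x
    by (subst nn_integral_suminf[symmetric]) (simp_all add: neumann_def)
  then have "N (neumann f) x = (\<Sum>n. (N ^^ Suc n) f x)" by simp
  then show ?thesis
    using suminf_offset[OF summableI, of "\<lambda>n. (N ^^ n) f x" 1] by (simp add: neumann_def)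
qed

lemma partial_sum_step:
  assumes [measurable]: "f \<in> borel_measurable M" and x: "x \<in> space M"
  shows "(\<Sum>n<Suc m. (N ^^ n) f x) = f x + N (\<lambda>y. \<Sum>n<m. (N ^^ n) f y) x"
proof -
  have "N (\<lambda>y. \<Sum>n<m. (N ^^ n) f y) x = (\<Sum>n<m. N ((N ^^ n) f) x)"
    unfolding N_def[of "\<lambda>y. \<Sum>n<m. (N ^^ n) f y" x] N_def[of "(N ^^ _) f" x] using x
    by (subst nn_integral_sum[symmetric]) (simp_all add: sum_distrib_left)
  then show ?thesis by (simp add: sum.lessThan_Suc_shift del: sum.lessThan_Suc)
qed

lemma geometric_ennreal: "(\<Sum>n. ennreal (\<theta> ^ n)) = ennreal (1 / (1 - \<theta>))"
  using theta by (subst suminf_ennreal2) (auto simp: suminf_geometric)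

lemma neumann_L1:
  assumes [measurable]: "f \<in> borel_measurable M"
  shows "wint (neumann f) \<le> ennreal (1 / (1 - \<theta>)) * wint f"
proof -
  have pow: "wint ((N ^^ n) f) \<le> ennreal (\<theta> ^ n) * wint f" for n
  proof (induction n)
    case (Suc n)
    have "wint ((N ^^ Suc n) f) \<le> ennreal \<theta> * wint ((N ^^ n) f)"
      using L1_contraction[of "(N ^^ n) f"] by simp
    also have "\<dots> \<le> ennreal \<theta> * (ennreal (\<theta> ^ n) * wint f)"
      using Suc by (intro mult_left_mono) auto
    also have "\<dots> = ennreal (\<theta> ^ Suc n) * wint f"
      using theta by (simp add: ennreal_mult' ac_simps)
    finally show ?case .
  qed simp
  have "wint (neumann f) = (\<Sum>n. \<integral>\<^sup>+x. ennreal (w x) * (N ^^ n) f x \<partial>M)"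
    unfolding neumann_def by (subst nn_integral_suminf[symmetric]) simp_all
  also have "\<dots> \<le> (\<Sum>n. ennreal (\<theta> ^ n) * wint f)"
    by (intro suminf_le pow) auto
  also have "\<dots> = ennreal (1 / (1 - \<theta>)) * wint f"
    by (simp add: geometric_ennreal)
  finally show ?thesis .
qed

lemma weighted_L1_finite:
  assumes [measurable]: "u \<in> borel_measurable M" and "nn_integral M u < \<infinity>"
  shows "wint u < \<infinity>"
proof -
  have "wint u \<le> (\<integral>\<^sup>+x. ennreal hi * u x \<partial>M)"
    using w_bounds by (intro nn_integral_mono mult_right_mono ennreal_leI) auto
  also have "\<dots> = ennreal hi * nn_integral M u" by (intro nn_integral_cmult) measurable
  also have "\<dots> < \<infinity>" using assms(2) by (simp add: ennreal_mult_less_top)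
  finally show ?thesis .
qed

lemma weighted_L1_AE_finite:
  assumes [measurable]: "u \<in> borel_measurable M" and "wint u < \<infinity>"
  shows "AE x in M. u x < \<infinity>"
proof -
  have "AE x in M. ennreal (w x) * u x \<noteq> \<infinity>"
    using assms(2) by (intro nn_integral_PInf_AE) auto
  then show ?thesis
    by eventually_elim (use w_pos in \<open>auto simp: ennreal_mult_eq_top_iff less_top ennreal_eq_0_iff not_le\<close>)
qed

text \<open>Pointwise convergence of the series is read off from its finite weighted integral, the
  weight being positive.\<close>

lemma neumann_AE_finite:
  assumes [measurable]: "f \<in> borel_measurable M" and "nn_integral M f < \<infinity>"
  shows "AE x in M. neumann f x < \<infinity>"
proof (rule weighted_L1_AE_finite)
  have "ennreal (1 / (1 - \<theta>)) * wint f < \<infinity>"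
    using weighted_L1_finite[OF assms] by (simp add: ennreal_mult_less_top)
  then show "wint (neumann f) < \<infinity>"
    using neumann_L1[OF assms(1)] by (rule le_less_trans[rotated])
qed measurable

lemma N_AE_finite:
  assumes [measurable]: "u \<in> borel_measurable M" and "nn_integral M u < \<infinity>"
  shows "AE x in M. N u x < \<infinity>"
proof (rule weighted_L1_AE_finite)
  have "ennreal \<theta> * wint u < \<infinity>"
    using weighted_L1_finite[OF assms] by (simp add: ennreal_mult_less_top)
  then show "wint (N u) < \<infinity>"
    using L1_contraction[OF assms(1)] by (rule le_less_trans[rotated])
qed measurable

text \<open>The iterates are compared with multiples of \<open>h\<close>, which
  \<open>N_weight\<close> contracts, and not with constants, for which no row bound below 1 is
  available.\<close>

lemma neumann_bounded:
  assumes [measurable]: "f \<in> borel_measurable M" and C: "0 \<le> C" "AE x in M. f x \<le> ennreal C"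
  shows "AE x in M. neumann f x \<le> ennreal (C / lo * hi / (1 - \<theta>))"
proof -
  \<comment> \<open>Chosen so that \<open>C \<le> B * h x\<close> at every point, which starts the
    induction.\<close>
  define B where "B = C / lo"
  have B0: "0 \<le> B" using C lo_pos by (simp add: B_def)
  have pow: "AE x in M. (N ^^ n) f x \<le> ennreal (\<theta> ^ n) * ennreal (B * h x)" for n
  proof (induction n)
    case 0
    from C(2) show ?case
    proof eventually_elim
      case (elim x)
      have "C \<le> B * h x"
        using h_bounds(1)[of x] lo_pos C(1) mult_left_mono[of lo "h x" B] B0 by (simp add: B_def)
      then show ?case using elim by (simp add: order_trans ennreal_leI)
    qed
  next
    case (Suc n)
    have "AE x in M. x \<in> space M" by simp
    with N_weight show ?case
    proof eventually_elim
      case (elim x)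
      have "(N ^^ Suc n) f x \<le> N (\<lambda>y. ennreal (\<theta> ^ n * B) * ennreal (h y)) x"
        using N_mono_AE[OF Suc] B0 theta h_pos by (simp add: ennreal_mult[symmetric] less_imp_le mult.assoc)
      also have "\<dots> = ennreal (\<theta> ^ n * B) * N (\<lambda>y. ennreal (h y)) x"
        using elim(2) by (intro N_cmult) auto
      also have "\<dots> \<le> ennreal (\<theta> ^ n * B) * ennreal (\<theta> * h x)"
        using elim(1) by (intro mult_left_mono) auto
      also have "\<dots> = ennreal (\<theta> ^ Suc n) * ennreal (B * h x)"
        using theta B0 h_pos[of x] by (simp add: ennreal_mult[symmetric] less_imp_le ac_simps)
      finally show ?case .
    qed
  qed
  have "AE x in M. \<forall>n. (N ^^ n) f x \<le> ennreal (\<theta> ^ n) * ennreal (B * h x)"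
    using pow by (simp add: AE_all_countable)
  then show ?thesis
  proof eventually_elim
    case (elim x)
    have "neumann f x \<le> (\<Sum>n. ennreal (\<theta> ^ n) * ennreal (B * h x))"
      unfolding neumann_def using elim by (intro suminf_le) auto
    also have "\<dots> = ennreal (1 / (1 - \<theta>)) * ennreal (B * h x)"
      by (simp add: geometric_ennreal)
    also have "\<dots> = ennreal (1 / (1 - \<theta>) * (B * h x))"
      using theta B0 h_pos[of x] by (simp add: ennreal_mult[symmetric] less_imp_le)
    also have "\<dots> \<le> ennreal (C / lo * hi / (1 - \<theta>))"
    proof (rule ennreal_leI)
      have "B * h x \<le> B * hi" using B0 h_bounds(2) by (intro mult_left_mono) auto
      then have "B * h x / (1 - \<theta>) \<le> B * hi / (1 - \<theta>)"
        using theta by (intro divide_right_mono) auto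
      then show "1 / (1 - \<theta>) * (B * h x) \<le> C / lo * hi / (1 - \<theta>)" by (simp add: B_def mult.commute[of lo])
    qed
    finally show ?case .
  qed
qed

section \<open>Weighted L^p bounds for finite exponents\<close>

definition wpow :: "real \<Rightarrow> ('a \<Rightarrow> real) \<Rightarrow> ennreal" where
  "wpow p u = (\<integral>\<^sup>+x. ennreal (w x) * ennreal (h x powr (1 - p) * u x powr p) \<partial>M)"

text \<open>Jensen's inequality for the measure with density \<open>k x y * h y\<close>, whose mass
  is at most \<open>\<theta> * h x\<close> but is not normalised. Integrating the tangent inequality
  for \<open>u / h\<close> avoids a division by that mass.\<close>

lemma jensen_N:
  assumes [measurable]: "u \<in> borel_measurable M" and u0: "\<And>y. 0 \<le> u y" and x: "x \<in> space M"
    and p: "1 \<le> p"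
    and rowx: "N (\<lambda>y. ennreal (h y)) x \<le> ennreal (\<theta> * h x)"
    and X: "N (\<lambda>y. ennreal (u y)) x = ennreal X" "0 \<le> X"
  shows "ennreal (h x powr (1 - p) * X powr p)
    \<le> ennreal (\<theta> powr (p - 1)) * N (\<lambda>y. ennreal (h y powr (1 - p) * u y powr p)) x" (is "_ \<le> _ * ?J")
proof (cases "X = 0 \<or> ?J = \<infinity>")
  case True
  then show ?thesis
  proof
    assume "X = 0"
    then show ?thesis by simp
  next
    assume "?J = \<infinity>"
    moreover have "ennreal (\<theta> powr (p - 1)) \<noteq> 0" using theta by simp
    ultimately show ?thesis by (simp add: ennreal_mult_eq_top_iff)
  qed
next
  case False
  then obtain j where j: "?J = ennreal j" "0 \<le> j"
    by (cases "?J") auto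
  have X0: "0 < X" using False X by simp
  \<comment> \<open>The tangent point is \<open>X\<close> per unit of the admissible mass
    \<open>\<theta> * h x\<close>. With it the constant term integrates to at most
    \<open>(1 - 1 / p) * X\<close> and can be subtracted from \<open>X\<close>.\<close>
  define c where "c = X / (\<theta> * h x)"
  have c0: "0 < c" using X0 theta h_pos by (simp add: c_def)
  define a where "a = c powr (1 - p) / p"
  define b where "b = (1 - 1 / p) * c"
  have ab: "0 \<le> a" "0 \<le> b" using p c0 by (auto simp: a_def b_def)
  have pt: "u y \<le> a * (h y powr (1 - p) * u y powr p) + b * h y" for y
  proof -
    have "u y / h y \<le> (u y / h y) powr p * c powr (1 - p) / p + (1 - 1/p) * c"
      using h_pos[of y] u0[of y] p c0 by (intro young_tangent) auto
    then have "h y * (u y / h y) \<le> h y * ((u y / h y) powr p * a + b)"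
      using h_pos[of y] by (intro mult_left_mono) (auto simp: a_def b_def less_imp_le)
    moreover have "h y * (u y / h y) powr p = h y powr (1 - p) * u y powr p"
      using h_pos[of y] u0[of y] by (simp add: powr_divide powr_diff)
    ultimately show ?thesis using h_pos[of y] by (simp add: algebra_simps)
  qed
  have "ennreal X \<le> N (\<lambda>y. ennreal a * ennreal (h y powr (1 - p) * u y powr p) + ennreal b * ennreal (h y)) x"
    unfolding X(1)[symmetric]
  proof (intro N_mono_AE AE_I2)
    fix y
    have "ennreal (u y) \<le> ennreal (a * (h y powr (1 - p) * u y powr p) + b * h y)"
      using pt by (rule ennreal_leI)
    also have "\<dots> = ennreal a * ennreal (h y powr (1 - p) * u y powr p) + ennreal b * ennreal (h y)"
      using ab h_pos[of y] u0[of y] by (simp add: ennreal_plus ennreal_mult less_imp_le)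
    finally show "ennreal (u y) \<le> \<dots>" .
  qed
  also have "\<dots> = ennreal a * ennreal j + ennreal b * N (\<lambda>y. ennreal (h y)) x"
    using x by (subst N_add) (measurable, auto simp: N_cmult j(1))
  also have "\<dots> \<le> ennreal a * ennreal j + ennreal b * ennreal (\<theta> * h x)"
    using rowx by (intro add_left_mono mult_left_mono) auto
  also have "\<dots> = ennreal (a * j + b * (\<theta> * h x))"
    using ab j theta h_pos[of x] by (simp add: ennreal_plus ennreal_mult less_imp_le)
  finally have "X \<le> a * j + b * (\<theta> * h x)"
    using ab j theta h_pos[of x] by (subst (asm) ennreal_le_iff) (auto simp: less_imp_le)
  moreover have "b * (\<theta> * h x) = (1 - 1 / p) * X"
    using theta h_pos[of x] by (simp add: b_def c_def)
  ultimately have "X / p \<le> a * j" by (simp add: algebra_simps)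
  then have "X \<le> c powr (1 - p) * j" using p by (simp add: a_def field_simps)
  then have "h x powr (1 - p) * X powr (p - 1) * X \<le> h x powr (1 - p) * X powr (p - 1) * (c powr (1 - p) * j)"
    by (intro mult_left_mono) auto
  also have "\<dots> = \<theta> powr (p - 1) * j"
    using X0 theta h_pos[of x] by (simp add: c_def powr_divide powr_mult powr_diff powr_minus field_simps)
  also have "h x powr (1 - p) * X powr (p - 1) * X = h x powr (1 - p) * X powr p"
    using X0 by (simp add: powr_diff)
  finally show ?thesis
    unfolding j(1) using j by (simp add: ennreal_mult[symmetric] ennreal_leI)
qed

text \<open>The rows give the factor \<open>\<theta> powr (p - 1)\<close> through
  \<open>jensen_N\<close>; the columns give the remaining factor \<open>\<theta>\<close> through
  \<open>L1_contraction\<close>, applied to \<open>h powr (1 - p) * u powr p\<close>.\<close>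

lemma wpow_N:
  assumes [measurable]: "u \<in> borel_measurable M" and u0: "\<And>y. 0 \<le> u y" and p: "1 \<le> p"
    and fin: "AE x in M. N (\<lambda>y. ennreal (u y)) x < \<infinity>"
  shows "wpow p (\<lambda>x. enn2real (N (\<lambda>y. ennreal (u y)) x)) \<le> ennreal (\<theta> powr p) * wpow p u"
proof -
  let ?v = "\<lambda>y. ennreal (h y powr (1 - p) * u y powr p)"
  have "AE x in M. x \<in> space M" by simp
  with fin N_weight have "AE x in M. ennreal (h x powr (1 - p) * enn2real (N (\<lambda>y. ennreal (u y)) x) powr p)
      \<le> ennreal (\<theta> powr (p - 1)) * N ?v x"
    by eventually_elim (rule jensen_N; (simp add: u0 p)?)
  then have "wpow p (\<lambda>x. enn2real (N (\<lambda>y. ennreal (u y)) x))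
      \<le> (\<integral>\<^sup>+x. ennreal (w x) * (ennreal (\<theta> powr (p - 1)) * N ?v x) \<partial>M)"
    unfolding wpow_def by (intro nn_integral_mono_AE) (elim eventually_mono, intro mult_left_mono, auto)
  also have "\<dots> = (\<integral>\<^sup>+x. ennreal (\<theta> powr (p - 1)) * (ennreal (w x) * N ?v x) \<partial>M)"
    by (simp add: ac_simps)
  also have "\<dots> = ennreal (\<theta> powr (p - 1)) * (\<integral>\<^sup>+x. ennreal (w x) * N ?v x \<partial>M)"
    by (intro nn_integral_cmult) measurable
  also have "\<dots> \<le> ennreal (\<theta> powr (p - 1)) * (ennreal \<theta> * wpow p u)"
    unfolding wpow_def by (intro mult_left_mono L1_contraction) auto
  also have "\<dots> = ennreal (\<theta> powr p) * wpow p u"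
    using theta by (simp add: mult.assoc[symmetric] ennreal_mult[symmetric] powr_diff)
  finally show ?thesis .
qed

text \<open>The partial sums satisfy \<open>s (Suc m) = f + N (s m)\<close>, so one constant bounds
  all of them by induction, and Fatou's lemma passes to the series. The constant is the p-th power
  of the sum \<open>1 / (1 - \<theta>)\<close> of the geometric series.\<close>

lemma wpow_U:
  assumes [measurable]: "f \<in> borel_measurable M" and f0: "\<And>y. 0 \<le> f y" and p: "1 \<le> p"
    and fin: "AE x in M. neumann (\<lambda>y. ennreal (f y)) x < \<infinity>"
  shows "wpow p (\<lambda>x. enn2real (neumann (\<lambda>y. ennreal (f y)) x)) \<le> ennreal ((1 - \<theta>) powr (- p)) * wpow p f"
proof -
  let ?f = "\<lambda>y. ennreal (f y)"
  let ?U = "neumann ?f"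
  define s where "s m x = (\<Sum>n<m. (N ^^ n) ?f x)" for m x
  define r where "r m x = enn2real (s m x)" for m x
  let ?Nr = "\<lambda>m. N (\<lambda>y. ennreal (r m y))"
  have s_meas [measurable]: "s m \<in> borel_measurable M" for m unfolding s_def by measurable
  have r_meas [measurable]: "r m \<in> borel_measurable M" for m unfolding r_def by measurable
  have s_U: "s m x \<le> ?U x" for m x
    unfolding s_def neumann_def by (intro sum_le_suminf) auto
  have s_fin: "AE x in M. s m x = ennreal (r m x)" for m
    using fin
  proof eventually_elim
    case (elim x)
    then have "s m x < \<infinity>" using s_U[of m x] by (rule le_less_trans[rotated])
    then show ?case by (simp add: r_def)
  qed
  have step: "AE x in M. r (Suc m) x = f x + enn2real (?Nr m x)
      \<and> ?Nr m x < \<infinity>" for m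
  proof -
    have eq: "N (s m) x = ?Nr m x" for x
      using s_fin[of m] by (intro antisym N_mono_AE) auto
    have "AE x in M. x \<in> space M" by simp
    with s_fin[of "Suc m"] show ?thesis
    proof eventually_elim
      case (elim x)
      have *: "ennreal (r (Suc m) x) = ennreal (f x) + ?Nr m x"
        using partial_sum_step[of "\<lambda>y. ennreal (f y)" x m] elim unfolding eq[symmetric]
        by (simp add: s_def[abs_def])
      then have "ennreal (f x) + ?Nr m x < \<infinity>" by (metis ennreal_less_top infinity_ennreal_def)
      then have "?Nr m x < \<infinity>" by simp
      with * show ?case using f0[of x]
        by (metis enn2real_ennreal enn2real_nonneg enn2real_plus ennreal_less_top infinity_ennreal_def r_def)
    qed
  qed
  have r0: "0 \<le> r m x" for m x by (simp add: r_def)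
  have bound: "wpow p (r m) \<le> ennreal ((1 - \<theta>) powr (- p)) * wpow p f" for m
  proof (induction m)
    case 0
    show ?case using p by (simp add: wpow_def r_def s_def)
  next
    case (Suc m)
    let ?g = "\<lambda>x. enn2real (?Nr m x)"
    have "AE x in M. ennreal (w x) * ennreal (h x powr (1 - p) * r (Suc m) x powr p)
       \<le> ennreal ((1 - \<theta>) powr (1 - p)) * (ennreal (w x) * ennreal (h x powr (1 - p) * f x powr p))
        + ennreal (\<theta> powr (1 - p)) * (ennreal (w x) * ennreal (h x powr (1 - p) * ?g x powr p))"
      using step[of m]
    proof eventually_elim
      case (elim x)
      have "r (Suc m) x powr p \<le> (1 - \<theta>) powr (1 - p) * f x powr p + \<theta> powr (1 - p) * ?g x powr p"
        using elim powr_sum_le[OF f0 enn2real_nonneg p theta] by simp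
      then have "w x * (h x powr (1 - p) * r (Suc m) x powr p)
          \<le> w x * (h x powr (1 - p) * ((1 - \<theta>) powr (1 - p) * f x powr p + \<theta> powr (1 - p) * ?g x powr p))"
        using w_pos[of x] by (intro mult_left_mono) (auto simp: less_imp_le)
      also have "\<dots> = (1 - \<theta>) powr (1 - p) * (w x * (h x powr (1 - p) * f x powr p))
          + \<theta> powr (1 - p) * (w x * (h x powr (1 - p) * ?g x powr p))"
        by (simp add: algebra_simps)
      finally show ?case
        using w_pos[of x] by (simp add: ennreal_mult[symmetric] ennreal_plus[symmetric] ennreal_leI less_imp_le del: ennreal_plus)
    qed
    then have "wpow p (r (Suc m)) \<le> (\<integral>\<^sup>+x. ennreal ((1 - \<theta>) powr (1 - p)) * (ennreal (w x) * ennreal (h x powr (1 - p) * f x powr p))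
        + ennreal (\<theta> powr (1 - p)) * (ennreal (w x) * ennreal (h x powr (1 - p) * ?g x powr p)) \<partial>M)"
      unfolding wpow_def by (rule nn_integral_mono_AE)
    also have "\<dots> = ennreal ((1 - \<theta>) powr (1 - p)) * wpow p f + ennreal (\<theta> powr (1 - p)) * wpow p ?g"
      unfolding wpow_def by (subst nn_integral_add) (measurable, auto simp: nn_integral_cmult)
    also have "\<dots> \<le> ennreal ((1 - \<theta>) powr (1 - p)) * wpow p f
        + ennreal (\<theta> powr (1 - p)) * (ennreal (\<theta> powr p) * (ennreal ((1 - \<theta>) powr (- p)) * wpow p f))"
    proof (intro add_left_mono mult_left_mono)
      have "wpow p ?g \<le> ennreal (\<theta> powr p) * wpow p (r m)"
        using step[of m] by (intro wpow_N r0 p) (auto elim: AE_mp)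
      also have "\<dots> \<le> ennreal (\<theta> powr p) * (ennreal ((1 - \<theta>) powr (- p)) * wpow p f)"
        using Suc by (intro mult_left_mono) auto
      finally show "wpow p ?g \<le> \<dots>" .
    qed auto
    also have "\<dots> = ennreal ((1 - \<theta>) powr (1 - p) + \<theta> * (1 - \<theta>) powr (- p)) * wpow p f"
    proof -
      have "\<theta> powr (1 - p) * (\<theta> powr p * (1 - \<theta>) powr (- p)) = \<theta> * (1 - \<theta>) powr (- p)"
        using theta by (simp add: powr_diff)
      then show ?thesis
        using theta by (simp add: mult.assoc[symmetric] ennreal_mult[symmetric] distrib_right[symmetric]
            ennreal_plus[symmetric] del: ennreal_plus)
    qed
    \<comment> \<open>The constant is a fixed point of the recursion, hence does not grow with
      \<open>m\<close>.\<close>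
    also have "(1 - \<theta>) powr (1 - p) + \<theta> * (1 - \<theta>) powr (- p) = (1 - \<theta>) powr (- p)"
    proof -
      have "(1 - \<theta>) powr (1 - p) = (1 - \<theta>) * (1 - \<theta>) powr (- p)"
        using theta by (simp add: powr_diff powr_minus divide_inverse)
      then show ?thesis by (simp add: algebra_simps)
    qed
    finally show ?case .
  qed
  have lim: "AE x in M. (\<lambda>m. ennreal (w x) * ennreal (h x powr (1 - p) * r m x powr p))
      \<longlonglongrightarrow> ennreal (w x) * ennreal (h x powr (1 - p) * enn2real (?U x) powr p)"
    using fin
  proof eventually_elim
    case (elim x)
    have "(\<lambda>m. s m x) \<longlonglongrightarrow> ?U x"
      unfolding s_def neumann_def by (rule summable_LIMSEQ) simp
    then have "(\<lambda>m. r m x) \<longlonglongrightarrow> enn2real (?U x)"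
      unfolding r_def using elim by (intro tendsto_enn2real) auto
    then have "(\<lambda>m. h x powr (1 - p) * r m x powr p) \<longlonglongrightarrow> h x powr (1 - p) * enn2real (?U x) powr p"
      using p r0 by (intro tendsto_mult tendsto_const tendsto_powr2) auto
    then show ?case
      by (intro ennreal_tendsto_cmult tendsto_ennrealI) auto
  qed
  have "wpow p (\<lambda>x. enn2real (?U x))
      = (\<integral>\<^sup>+x. liminf (\<lambda>m. ennreal (w x) * ennreal (h x powr (1 - p) * r m x powr p)) \<partial>M)"
    unfolding wpow_def using lim by (intro nn_integral_cong_AE) (auto dest!: lim_imp_Liminf[rotated])
  also have "\<dots> \<le> liminf (\<lambda>m. wpow p (r m))"
    unfolding wpow_def by (intro nn_integral_liminf) measurable
  also have "\<dots> \<le> ennreal ((1 - \<theta>) powr (- p)) * wpow p f"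
  proof -
    have "liminf (\<lambda>m. wpow p (r m)) \<le> liminf (\<lambda>m::nat. ennreal ((1 - \<theta>) powr (- p)) * wpow p f)"
      using bound by (intro Liminf_mono) auto
    then show ?thesis by (simp add: Liminf_const)
  qed
  finally show ?thesis .
qed

text \<open>The exponent \<open>1 - p\<close> is at most 0, so the power reverses the bounds for
  \<open>h\<close>: \<open>lo\<close> enters the upper bound and \<open>hi\<close> the lower
  one.\<close>

lemma weight_powr_bounds:
  assumes p: "1 \<le> p"
  shows "w x * h x powr (1 - p) \<le> hi * lo powr (1 - p)"
    and "lo * hi powr (1 - p) \<le> w x * h x powr (1 - p)"
proof -
  have "h x powr (1 - p) \<le> lo powr (1 - p)"
    using p lo_pos h_bounds by (intro powr_mono2') auto
  then show "w x * h x powr (1 - p) \<le> hi * lo powr (1 - p)"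
    using w_bounds[of x] w_pos[of x] by (intro mult_mono) auto
  have "hi powr (1 - p) \<le> h x powr (1 - p)"
    using p h_pos[of x] h_bounds by (intro powr_mono2') auto
  then show "lo * hi powr (1 - p) \<le> w x * h x powr (1 - p)"
    using w_bounds[of x] w_pos[of x] by (intro mult_mono) auto
qed

lemma neumann_Lp:
  assumes f: "f \<in> Lp_space M p" and p: "1 \<le> p"
  shows "(\<lambda>x. enn2real (neumann (\<lambda>y. ennreal \<bar>f y\<bar>) x)) \<in> Lp_space M p"
proof -
  have [measurable]: "f \<in> borel_measurable M" using f by (simp add: Lp_space_def)
  let ?u = "\<lambda>x. enn2real (neumann (\<lambda>y. ennreal \<bar>f y\<bar>) x)"
  have fin: "AE x in M. neumann (\<lambda>y. ennreal \<bar>f y\<bar>) x < \<infinity>"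
    using Lp_space_imp_L1[OF f p] by (intro neumann_AE_finite) auto
  show ?thesis
  proof (cases "p = \<infinity>")
    case True
    then obtain C where C: "AE x in M. \<bar>f x\<bar> \<le> C" using f by (auto simp: Lp_space_def)
    have "AE x in M. neumann (\<lambda>y. ennreal \<bar>f y\<bar>) x \<le> ennreal (max 0 C / lo * hi / (1 - \<theta>))"
      using C by (intro neumann_bounded) (auto elim!: eventually_mono intro!: ennreal_leI)
    then have "AE x in M. \<bar>?u x\<bar> \<le> max 0 C / lo * hi / (1 - \<theta>)"
    proof eventually_elim
      case (elim x)
      have "0 < hi" using h_bounds[of x] h_pos[of x] by linarith
      then have "0 \<le> max 0 C / lo * hi / (1 - \<theta>)" using lo_pos theta by auto
      then show ?case using elim by (simp add: enn2real_leI)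
    qed
    then show ?thesis using True by (auto simp: Lp_space_def)
  next
    case False
    define r where "r = enn2real p"
    have r: "1 \<le> r" unfolding r_def by (rule enn2real_ge_1[OF p False])
    have int: "integrable M (\<lambda>x. \<bar>f x\<bar> powr r)" using f False by (simp add: Lp_space_def r_def)
    have "wpow r (\<lambda>x. \<bar>f x\<bar>) \<le> (\<integral>\<^sup>+x. ennreal (hi * lo powr (1 - r)) * ennreal (\<bar>f x\<bar> powr r) \<partial>M)"
      unfolding wpow_def using weight_powr_bounds(1)[OF r] w_pos
      by (intro nn_integral_mono)
        (simp add: ennreal_mult''[symmetric] less_imp_le mult.assoc[symmetric] ennreal_leI mult_right_mono)
    also have "\<dots> = ennreal (hi * lo powr (1 - r)) * (\<integral>\<^sup>+x. ennreal (\<bar>f x\<bar> powr r) \<partial>M)"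
      by (intro nn_integral_cmult) measurable
    also have "\<dots> < \<infinity>"
      using int by (simp add: integrable_iff_bounded ennreal_mult_less_top)
    finally have "ennreal ((1 - \<theta>) powr (- r)) * wpow r (\<lambda>x. \<bar>f x\<bar>) < \<infinity>"
      by (simp add: ennreal_mult_less_top)
    moreover have "wpow r ?u \<le> ennreal ((1 - \<theta>) powr (- r)) * wpow r (\<lambda>x. \<bar>f x\<bar>)"
      by (intro wpow_U r fin) auto
    ultimately have wpu: "wpow r ?u < \<infinity>" by (rule le_less_trans[rotated])
    have "ennreal (lo * hi powr (1 - r)) * (\<integral>\<^sup>+x. ennreal (?u x powr r) \<partial>M)
        = (\<integral>\<^sup>+x. ennreal (lo * hi powr (1 - r)) * ennreal (?u x powr r) \<partial>M)"
      by (intro nn_integral_cmult[symmetric]) measurable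
    also have "\<dots> \<le> wpow r ?u"
      unfolding wpow_def using weight_powr_bounds(2)[OF r] w_pos
      by (intro nn_integral_mono)
        (simp add: ennreal_mult''[symmetric] less_imp_le mult.assoc[symmetric] ennreal_leI mult_right_mono)
    finally have le: "ennreal (lo * hi powr (1 - r)) * (\<integral>\<^sup>+x. ennreal (?u x powr r) \<partial>M) < \<infinity>"
      using wpu by (rule le_less_trans)
    \<comment> \<open>\<open>undefined\<close> stands for an arbitrary point: the bounds on
      \<open>h\<close> hold on the whole type.\<close>
    have "0 < hi" using h_bounds[of undefined] h_pos[of undefined] by linarith
    then have "0 < lo * hi powr (1 - r)" using lo_pos by simp
    then have "(\<integral>\<^sup>+x. ennreal (?u x powr r) \<partial>M) < \<infinity>"
      using le by (auto simp: ennreal_mult_less_top ennreal_eq_0_iff)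
    then have "integrable M (\<lambda>x. ?u x powr r)" by (intro integrableI_bounded) auto
    then show ?thesis using False by (simp add: Lp_space_def r_def)
  qed
qed

text \<open>A Bochner integral of a non-integrable function is 0 by convention. This lemma makes
  \<open>K u x\<close> a genuine integral for almost every \<open>x\<close>.\<close>

lemma kernel_integrable:
  assumes u: "u \<in> Lp_space M p" and p: "1 \<le> p"
  shows "AE x in M. integrable M (\<lambda>y. k x y * u y)"
proof -
  have [measurable]: "u \<in> borel_measurable M" using u by (simp add: Lp_space_def)
  have "AE x in M. N (\<lambda>y. ennreal \<bar>u y\<bar>) x < \<infinity>"
    using Lp_space_imp_L1[OF u p] by (intro N_AE_finite) auto
  moreover have "AE x in M. x \<in> space M" by simp
  ultimately show ?thesis
  proof eventually_elim
    case (elim x)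
    then show ?case
      using k_nonneg by (simp add: integrable_iff_bounded N_def ennreal_mult' abs_mult)
  qed
qed

section \<open>The equation for functions of arbitrary sign\<close>

abbreviation K :: "('a \<Rightarrow> real) \<Rightarrow> 'a \<Rightarrow> real" where
  "K u x \<equiv> \<integral>y. k x y * u y \<partial>M"

text \<open>Existence: the Neumann series of the positive and of the negative part of
  \<open>f\<close> are subtracted where both are finite, which is almost everywhere. Uniqueness: the
  modulus \<open>d\<close> of a difference of solutions satisfies \<open>d x \<le> N d x\<close>
  almost everywhere.\<close>

theorem unique_solution:
  assumes f: "f \<in> Lp_space M p" and p: "1 \<le> p"
  obtains u where "u \<in> Lp_space M p" and "AE x in M. u x - K u x = f x"
    and "\<And>v. v \<in> Lp_space M p \<Longrightarrow> AE x in M. v x - K v x = f x \<Longrightarrow> AE x in M. v x = u x"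
proof -
  have [measurable]: "f \<in> borel_measurable M" using f by (simp add: Lp_space_def)
  \<comment> \<open>\<open>ennreal\<close> sends negative numbers to 0, so \<open>?f1\<close> and
    \<open>?f2\<close> are the positive and the negative part of \<open>f\<close>.\<close>
  let ?f1 = "\<lambda>y. ennreal (f y)" and ?f2 = "\<lambda>y. ennreal (- f y)" and ?f = "\<lambda>y. ennreal \<bar>f y\<bar>"
  define a where "a x = enn2real (neumann ?f1 x)" for x
  define b where "b x = enn2real (neumann ?f2 x)" for x
  let ?Na = "N (\<lambda>y. ennreal (a y))" and ?Nb = "N (\<lambda>y. ennreal (b y))"
  have [measurable]: "a \<in> borel_measurable M" "b \<in> borel_measurable M"
    unfolding a_def b_def by measurable
  have neumann_mono: "neumann g x \<le> neumann g' x" if "\<And>y. g y \<le> g' y" for g g' x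
  proof -
    have "(N ^^ n) g x \<le> (N ^^ n) g' x" for n x
    proof (induction n arbitrary: x)
      case (Suc n)
      then show ?case by (auto intro: N_mono_AE)
    qed (simp add: that)
    then show ?thesis unfolding neumann_def by (intro suminf_le) auto
  qed
  have fin: "AE x in M. neumann ?f x < \<infinity>"
    using Lp_space_imp_L1[OF f p] by (intro neumann_AE_finite) auto
  have le1: "neumann ?f1 x \<le> neumann ?f x" and le2: "neumann ?f2 x \<le> neumann ?f x" for x
    by (rule neumann_mono; simp add: ennreal_leI)+
  have eq1: "AE x in M. neumann ?f1 x = ennreal (a x)" and eq2: "AE x in M. neumann ?f2 x = ennreal (b x)"
  proof -
    show "AE x in M. neumann ?f1 x = ennreal (a x)"
      using fin
    proof eventually_elim
      case (elim x)
      then show ?case using le_less_trans[OF le1[of x]] by (simp add: a_def)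
    qed
    show "AE x in M. neumann ?f2 x = ennreal (b x)"
      using fin
    proof eventually_elim
      case (elim x)
      then show ?case using le_less_trans[OF le2[of x]] by (simp add: b_def)
    qed
  qed
  have N1: "N (neumann ?f1) x = ?Na x" and N2: "N (neumann ?f2) x = ?Nb x" for x
    using eq1 eq2 by (intro antisym N_mono_AE; auto)+
  define u where "u x = a x - b x" for x
  have [measurable]: "u \<in> borel_measurable M" unfolding u_def by measurable
  have u_dom: "AE x in M. \<bar>u x\<bar> \<le> \<bar>enn2real (neumann ?f x)\<bar>"
    using fin
  proof eventually_elim
    case (elim x)
    have "a x \<le> enn2real (neumann ?f x)" "b x \<le> enn2real (neumann ?f x)"
      using elim le1[of x] le2[of x] by (auto simp: a_def b_def intro!: enn2real_mono)
    moreover have "0 \<le> a x" "0 \<le> b x" by (auto simp: a_def b_def)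
    ultimately show ?case unfolding u_def by linarith
  qed
  have uL: "u \<in> Lp_space M p"
    by (rule Lp_space_dominated[OF neumann_Lp[OF f p] _ u_dom]) measurable
  have "AE x in M. x \<in> space M" by simp
  with fin eq1 eq2 have sol: "AE x in M. u x - K u x = f x"
  proof eventually_elim
    case (elim x)
    have 1: "ennreal (a x) = ?f1 x + ?Na x"
      using neumann_fixpoint[of ?f1 x] elim by (simp add: N1)
    have 2: "ennreal (b x) = ?f2 x + ?Nb x"
      using neumann_fixpoint[of ?f2 x] elim by (simp add: N2)
    have n1: "?Na x < \<infinity>" and n2: "?Nb x < \<infinity>"
      using 1 2 by (metis ennreal_add_eq_top ennreal_neq_top infinity_ennreal_def less_top)+
    have ab0: "0 \<le> a y" "0 \<le> b y" for y by (auto simp: a_def b_def)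
    have i1: "integrable M (\<lambda>y. k x y * a y)" and i2: "integrable M (\<lambda>y. k x y * b y)"
      using n1 n2 elim k_nonneg ab0 by (simp_all add: integrable_iff_bounded N_def ennreal_mult' abs_mult)
    have e1: "K a x = enn2real (?Na x)"
      and e2: "K b x = enn2real (?Nb x)"
      using elim k_nonneg ab0 by (simp_all add: integral_eq_nn_integral N_def ennreal_mult')
    have "a x = max 0 (f x) + enn2real (?Na x)"
      using arg_cong[OF 1, of enn2real] n1 ab0 by (simp add: enn2real_plus max_def ennreal_neg)
    moreover have "b x = max 0 (- f x) + enn2real (?Nb x)"
      using arg_cong[OF 2, of enn2real] n2 ab0 by (simp add: enn2real_plus max_def ennreal_neg)
    moreover have "K u x = K a x - K b x"
      using i1 i2 by (simp add: u_def right_diff_distrib)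
    ultimately show ?case by (simp add: u_def e1 e2)
  qed
  have uniq: "AE x in M. v x = u x"
    if v: "v \<in> Lp_space M p" and vs: "AE x in M. v x - K v x = f x" for v
  proof -
    have [measurable]: "v \<in> borel_measurable M" using v by (simp add: Lp_space_def)
    define d where "d x = ennreal \<bar>v x - u x\<bar>" for x
    have [measurable]: "d \<in> borel_measurable M" unfolding d_def by measurable
    have "AE x in M. x \<in> space M" by simp
    with vs sol kernel_integrable[OF v p] kernel_integrable[OF uL p] have dN: "AE x in M. d x \<le> N d x"
    proof eventually_elim
      case (elim x)
      have "v x - u x = (\<integral>y. k x y * (v y - u y) \<partial>M)"
        using elim by (simp add: right_diff_distrib)
      moreover have "ennreal \<bar>\<integral>y. k x y * (v y - u y) \<partial>M\<bar> \<le> (\<integral>\<^sup>+y. ennreal \<bar>k x y * (v y - u y)\<bar> \<partial>M)"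
        using integral_norm_bound_ennreal[of M "\<lambda>y. k x y * (v y - u y)"] elim
        by (simp add: right_diff_distrib)
      ultimately show ?case
        using k_nonneg by (simp add: d_def N_def abs_mult ennreal_mult')
    qed
    have "nn_integral M d \<le> (\<integral>\<^sup>+x. ennreal \<bar>v x\<bar> + ennreal \<bar>u x\<bar> \<partial>M)"
      unfolding d_def by (intro nn_integral_mono) (simp add: ennreal_plus[symmetric] ennreal_leI del: ennreal_plus)
    also have "\<dots> < \<infinity>"
      using Lp_space_imp_L1[OF v p] Lp_space_imp_L1[OF uL p] by (subst nn_integral_add) auto
    finally have wd: "wint d < \<infinity>"
      by (intro weighted_L1_finite) auto
    then obtain c where c: "wint d = ennreal c" "0 \<le> c"
      by (metis ennreal_cases infinity_ennreal_def less_irrefl)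
    have "wint d \<le> wint (N d)"
      using dN by (intro nn_integral_mono_AE) (elim eventually_mono, intro mult_left_mono, auto)
    also have "\<dots> \<le> ennreal \<theta> * wint d"
      by (intro L1_contraction) measurable
    \<comment> \<open>Finiteness of \<open>wint d\<close> matters here: an infinite value would
      satisfy the same inequality.\<close>
    finally have "c \<le> \<theta> * c"
      using c theta by (simp add: ennreal_mult[symmetric])
    then have "c = 0" using c(2) theta mult_strict_right_mono[of \<theta> 1 c] by (cases "c = 0") auto
    then have "AE x in M. ennreal (w x) * d x = 0"
      using c by (subst nn_integral_0_iff_AE[symmetric]) auto
    then show ?thesis
    proof eventually_elim
      case (elim x)
      then show ?case using w_pos[of x] by (simp add: d_def ennreal_eq_0_iff)
    qed
  qed
  show ?thesis using that uL sol uniq by blast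
qed

end

section \<open>Integrals over three-dimensional space\<close>

lemma emeasure_cball_real2:
  assumes "0 \<le> r" shows "emeasure lborel (cball (c :: real^2) r) = ennreal (pi * r\<^sup>2)"
  using emeasure_cball[OF assms, of c] by (simp add: unit_ball_vol_2)

lemma emeasure_cball_real3:
  assumes "0 \<le> r" shows "emeasure lborel (cball (c :: real^3) r) = ennreal (4/3 * pi * r^3)"
  using emeasure_cball[OF assms, of c] by (simp add: unit_ball_vol_3)

text \<open>The third coordinate is singled out because it is the height in the slicing of a half
  ball and the ray parameter of a cone.\<close>

definition join3 :: "real^2 \<Rightarrow> real \<Rightarrow> real^3" where
  "join3 u t = vector [u$1, u$2, t]"

lemma join3_nth [simp]: "join3 u t $ 1 = u $ 1" "join3 u t $ 2 = u $ 2" "join3 u t $ 3 = t"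
  by (simp_all add: join3_def)

lemma continuous_join3: "continuous_on UNIV (\<lambda>x. join3 (fst x) (snd x))"
proof -
  have eq: "(\<lambda>x. join3 (fst x) (snd x)) =
    (\<lambda>x. (fst x $ 1) *\<^sub>R axis 1 1 + (fst x $ 2) *\<^sub>R axis 2 1 + snd x *\<^sub>R axis 3 1)"
    by (rule ext) (simp add: vec_eq_iff forall_3 axis_def)
  show ?thesis unfolding eq by (intro continuous_intros)
qed

lemma join3_measurable [measurable]:
  "(\<lambda>x. join3 (fst x) (snd x)) \<in> borel_measurable (lborel \<Otimes>\<^sub>M lborel)"
  using borel_measurable_continuous_onI[OF continuous_join3] by (simp add: lborel_prod)

lemma prod_Basis_cart: "(\<Prod>b\<in>(Basis :: (real^'n) set). f b) = (\<Prod>i\<in>(UNIV :: 'n set). f (axis i 1))"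
proof -
  have *: "(Basis :: (real^'n) set) = range (\<lambda>i. axis i 1)" by (auto simp: Basis_vec_def)
  have "inj (\<lambda>i::'n. axis i (1::real))" by (simp add: inj_on_def axis_eq_axis)
  then show ?thesis unfolding * by (simp add: prod.reindex)
qed

lemma lborel_join3: "distr (lborel \<Otimes>\<^sub>M lborel) borel (\<lambda>x. join3 (fst x) (snd x)) = (lborel :: (real^3) measure)"
proof (rule lborel_eqI[symmetric])
  fix l u :: "real^3"
  assume le: "\<And>b. b \<in> Basis \<Longrightarrow> l \<bullet> b \<le> u \<bullet> b"
  then have le': "l $ i \<le> u $ i" for i
    using le[of "axis i 1"] by (simp add: inner_axis axis_in_Basis_iff)
  have le2: "vector [l$1, l$2] \<bullet> b \<le> vector [u$1, u$2] \<bullet> b" if b: "b \<in> Basis" for b :: "real^2"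
  proof -
    obtain i where "b = axis i 1" using b unfolding Basis_vec_def by auto
    then show ?thesis using le'[of 1] le'[of 2] exhaust_2[of i] by (auto simp: inner_axis)
  qed
  have vim: "(\<lambda>x. join3 (fst x) (snd x)) -` box l u \<inter> space (lborel \<Otimes>\<^sub>M lborel)
      = box (vector [l$1, l$2]) (vector [u$1, u$2]) \<times> box (l$3) (u$3)"
    by (auto simp: mem_box_cart forall_3 forall_2 space_pair_measure)
  have "emeasure (distr (lborel \<Otimes>\<^sub>M lborel) borel (\<lambda>x. join3 (fst x) (snd x))) (box l u)
      = emeasure lborel (box (vector [l$1, l$2] :: real^2) (vector [u$1, u$2])) * emeasure lborel (box (l$3) (u$3))"
    by (subst emeasure_distr) (simp_all add: vim lborel.emeasure_pair_measure_Times)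
  also have "emeasure lborel (box (vector [l$1, l$2] :: real^2) (vector [u$1, u$2])) = ennreal ((u$1 - l$1) * (u$2 - l$2))"
    using le2 by (subst emeasure_lborel_box) (simp_all add: prod_Basis_cart UNIV_2 inner_axis mult.commute)
  also have "emeasure lborel (box (l$3) (u$3)) = ennreal (u$3 - l$3)"
    using le'[of 3] by (subst emeasure_lborel_box) auto
  also have "ennreal ((u$1 - l$1) * (u$2 - l$2)) * ennreal (u$3 - l$3) = ennreal ((u$1 - l$1) * (u$2 - l$2) * (u$3 - l$3))"
    using le'[of 1] le'[of 2] le'[of 3] by (intro ennreal_mult[symmetric]) simp_all
  also have "(u$1 - l$1) * (u$2 - l$2) * (u$3 - l$3) = (\<Prod>b\<in>Basis. (u - l) \<bullet> b)"
  proof -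
    have "(\<Prod>b\<in>Basis. (u - l) \<bullet> b) = (\<Prod>i\<in>(UNIV :: 3 set). u $ i - l $ i)"
      by (simp add: prod_Basis_cart inner_axis)
    then show ?thesis by (simp only: UNIV_3) simp
  qed
  finally show "emeasure (distr (lborel \<Otimes>\<^sub>M lborel) borel (\<lambda>x. join3 (fst x) (snd x))) (box l u)
      = ennreal (\<Prod>b\<in>Basis. (u - l) \<bullet> b)" .
qed simp

lemma nn_integral_join3:
  assumes [measurable]: "f \<in> borel_measurable borel"
  shows "nn_integral lborel f = (\<integral>\<^sup>+u. \<integral>\<^sup>+t. f (join3 u t) \<partial>lborel \<partial>lborel)"
  by (subst lborel_join3[symmetric])
    (simp add: nn_integral_distr lborel.nn_integral_fst[symmetric])

text \<open>Equality with \<open>lborel\<close> is tested on boxes, whose images under the inverse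
  transformation keep their Lebesgue measure.\<close>

lemma lborel_orthogonal:
  fixes g :: "real^3 \<Rightarrow> real^3"
  assumes g: "orthogonal_transformation g"
  shows "distr lborel borel g = lborel"
proof (rule lborel_eqI[symmetric])
  have lin: "linear g" using g by (simp add: orthogonal_transformation_linear)
  then have [measurable]: "g \<in> borel_measurable borel"
    by (intro borel_measurable_continuous_onI linear_continuous_on linear_conv_bounded_linear[THEN iffD1])
  fix l u :: "real^3"
  assume le: "\<And>b. b \<in> Basis \<Longrightarrow> l \<bullet> b \<le> u \<bullet> b"
  have g': "orthogonal_transformation (inv g)"
    using g by (rule orthogonal_transformation_inv)
  have "g -` box l u = inv g ` box l u"
    using bij_vimage_eq_inv_image[OF orthogonal_transformation_bij[OF g]] by simp
  moreover have "emeasure lborel (inv g ` box l u) = emeasure lborel (box l u)"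
  proof -
    have 1: "inv g ` box l u \<in> sets borel"
      unfolding \<open>g -` box l u = inv g ` box l u\<close>[symmetric]
      using measurable_sets[of g borel borel "box l u"] by simp
    have 2: "inv g ` box l u \<in> lmeasurable" "measure lebesgue (inv g ` box l u) = measure lebesgue (box l u)"
      using measurable_orthogonal_image[OF g', of "box l u"] measure_orthogonal_image[OF g', of "box l u"] by auto
    have "emeasure lborel (inv g ` box l u) = emeasure lebesgue (inv g ` box l u)"
      using 1 by simp
    also have "\<dots> = emeasure lebesgue (box l u)"
      using 2 by (metis emeasure_eq_measure2 lmeasurable_box)
    finally show ?thesis by simp
  qed
  ultimately show "emeasure (distr lborel borel g) (box l u) = ennreal (\<Prod>b\<in>Basis. (u - l) \<bullet> b)"
    using le by (simp add: emeasure_distr emeasure_lborel_box_eq)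
qed simp

lemma exp_tendsto_lin: "0 < \<beta> \<Longrightarrow> ((\<lambda>s::real. (\<beta> * s + c) * exp (- \<beta> * s)) \<longlongrightarrow> 0) at_top"
proof -
  assume b: "0 < \<beta>"
  have lin: "filterlim (\<lambda>s. \<beta> * s) at_top at_top"
    using b by (intro filterlim_tendsto_pos_mult_at_top[OF tendsto_const]) (auto simp: filterlim_ident)
  have "((\<lambda>x::real. x ^ 1 / exp x + c * (x ^ 0 / exp x)) \<longlongrightarrow> 0 + c * 0) at_top"
    by (intro tendsto_intros tendsto_power_div_exp_0)
  from filterlim_compose[OF this lin] show ?thesis
    by (simp add: exp_minus field_simps)
qed

text \<open>Layer cake instead of spherical coordinates: the radial profile is the integral of
  \<open>\<rho>\<close> over \<open>{r..}\<close>, and after exchanging the integrals only the given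
  moments of \<open>g\<close> over balls are needed. The remaining integral of
  \<open>\<rho> s * C * s ^ Suc n\<close> has the terms
  \<open>\<beta>\<^sup>2 * s * exp (- \<beta> * s)\<close> and
  \<open>n * \<beta> * exp (- \<beta> * s)\<close>, which contribute \<open>1\<close> and
  \<open>n\<close>.\<close>

lemma nn_integral_radial_weight:
  fixes g :: "real^3 \<Rightarrow> real" and n :: nat
  assumes [measurable]: "g \<in> borel_measurable borel" and g0: "\<And>z. 0 \<le> g z"
    and \<beta>: "0 < \<beta>" and C: "0 \<le> C"
    and ball: "\<And>s. 0 < s \<Longrightarrow> (\<integral>\<^sup>+z. ennreal (g z) * indicator (cball 0 s) z \<partial>lborel) = ennreal (C * s ^ Suc n)"
  shows "(\<integral>\<^sup>+z. ennreal (\<beta> * exp (- \<beta> * norm z) / norm z ^ n * g z) \<partial>lborel) = ennreal (C * real (Suc n))"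
proof -
  \<comment> \<open>Minus the derivative of the profile
    \<open>\<beta> * exp (- \<beta> * s) / s ^ n\<close>.\<close>
  define \<rho> where "\<rho> s = \<beta> * (\<beta> * exp (- \<beta> * s) / s ^ n + n * exp (- \<beta> * s) / s ^ Suc n)" for s :: real
  let ?G = "\<lambda>s z. ennreal (\<rho> s) * indicator {0<..} s * (ennreal (g z) * indicator (cball 0 s) z)"
  have [measurable]: "\<rho> \<in> borel_measurable borel" unfolding \<rho>_def by measurable
  have \<rho>0: "0 \<le> \<rho> s" if "0 < s" for s using that \<beta> by (simp add: \<rho>_def)
  have layer: "ennreal (\<beta> * exp (- \<beta> * r) / r ^ n) = (\<integral>\<^sup>+s. ennreal (\<rho> s) * indicator {r..} s \<partial>lborel)"
    if r: "0 < r" for r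
  proof -
    have "(\<integral>\<^sup>+s. ennreal (\<rho> s) * indicator {r..} s \<partial>lborel) = ennreal (0 - (- \<beta> * exp (- \<beta> * r) / r ^ n))"
    proof (rule nn_integral_FTC_atLeast)
      show "DERIV (\<lambda>s. - \<beta> * exp (- \<beta> * s) / s ^ n) s :> \<rho> s" if "r \<le> s" for s
      proof -
        have "s \<noteq> 0" using that r by simp
        moreover have "s * s ^ (n - 1) = s ^ n \<or> n = 0" by (cases n) auto
        ultimately show ?thesis unfolding \<rho>_def
          by (auto intro!: derivative_eq_intros simp: field_simps)
      qed
      have "((\<lambda>s. - \<beta> * exp (- \<beta> * s) / s ^ n) \<longlongrightarrow> 0) at_top"
      proof (rule Lim_null_comparison)
        show "\<forall>\<^sub>F s in at_top. norm (- \<beta> * exp (- \<beta> * s) / s ^ n) \<le> \<beta> * exp (- \<beta> * s)"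
          using eventually_ge_at_top[of 1]
        proof eventually_elim
          case (elim s)
          then have "1 \<le> s ^ n" by simp
          then show ?case using \<beta> elim by (simp add: abs_mult field_simps)
        qed
        \<comment> \<open>The plain exponential is written as a difference of two instances of
          \<open>exp_tendsto_lin\<close>.\<close>
        have "((\<lambda>s. (\<beta> * s + (0 + \<beta>)) * exp (- \<beta> * s) - (\<beta> * s + 0) * exp (- \<beta> * s)) \<longlongrightarrow> 0 - 0) at_top"
          using \<beta> by (intro tendsto_diff exp_tendsto_lin)
        then show "((\<lambda>s. \<beta> * exp (- \<beta> * s)) \<longlongrightarrow> 0) at_top" by (simp add: algebra_simps)
      qed
      then show "((\<lambda>s. - \<beta> * exp (- \<beta> * s) / s ^ n) \<longlongrightarrow> 0) at_top" .
    qed (use \<rho>0 r in auto)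
    then show ?thesis by simp
  qed
  have "(\<integral>\<^sup>+z. ennreal (\<beta> * exp (- \<beta> * norm z) / norm z ^ n * g z) \<partial>lborel)
      = (\<integral>\<^sup>+z. \<integral>\<^sup>+s. ?G s z \<partial>lborel \<partial>lborel)"
  proof (rule nn_integral_cong_AE)
    have "AE z in lborel. z \<noteq> (0::real^3)" by (rule AE_lborel_singleton)
    then show "AE z in lborel. ennreal (\<beta> * exp (- \<beta> * norm z) / norm z ^ n * g z)
      = (\<integral>\<^sup>+s. ?G s z \<partial>lborel)"
    proof eventually_elim
      case (elim z)
      have "ennreal (\<beta> * exp (- \<beta> * norm z) / norm z ^ n * g z)
          = (\<integral>\<^sup>+s. ennreal (\<rho> s) * indicator {norm z..} s \<partial>lborel) * ennreal (g z)"
        using elim \<beta> g0[of z] by (subst layer[symmetric]) (simp_all add: ennreal_mult[symmetric])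
      also have "\<dots> = (\<integral>\<^sup>+s. ennreal (\<rho> s) * indicator {norm z..} s * ennreal (g z) \<partial>lborel)"
        by (intro nn_integral_multc[symmetric]) measurable
      also have "\<dots> = (\<integral>\<^sup>+s. ?G s z \<partial>lborel)"
      proof (intro nn_integral_cong)
        fix s
        have "\<not> norm z \<le> s" if "\<not> 0 < s" using elim that zero_less_norm_iff[of z] by linarith
        then show "ennreal (\<rho> s) * indicator {norm z..} s * ennreal (g z)
            = ?G s z"
          by (auto split: split_indicator)
      qed
      finally show ?case .
    qed
  qed
  also have "\<dots> = (\<integral>\<^sup>+s. \<integral>\<^sup>+z. ?G s z \<partial>lborel \<partial>lborel)"
  proof -
    have [measurable]: "Measurable.pred (lborel \<Otimes>\<^sub>M lborel) (\<lambda>(z::real^3, s::real). z \<in> cball 0 s)"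
      by (simp add: split_beta')
    show ?thesis
      by (intro lborel_pair.Fubini'[symmetric]) (simp add: split_beta', measurable)
  qed
  also have "\<dots> = (\<integral>\<^sup>+s. ennreal (C * \<beta> * (\<beta> * s * exp (- \<beta> * s) + n * exp (- \<beta> * s))) * indicator {0..} s \<partial>lborel)"
  proof (rule nn_integral_cong_AE)
    have "AE s in lborel. s \<noteq> (0::real)" by (rule AE_lborel_singleton)
    then show "AE s in lborel. (\<integral>\<^sup>+z. ?G s z \<partial>lborel)
        = ennreal (C * \<beta> * (\<beta> * s * exp (- \<beta> * s) + n * exp (- \<beta> * s))) * indicator {0..} s"
    proof eventually_elim
      case (elim s)
      show ?case
      proof (cases "0 < s")
        case True
        have "(\<integral>\<^sup>+z. ?G s z \<partial>lborel)
          = ennreal (\<rho> s) * ennreal (C * s ^ Suc n)"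
        proof -
          have [measurable]: "cball 0 s \<in> sets (borel :: (real^3) measure)" by simp
          have "(\<lambda>z. ennreal (g z) * indicator (cball 0 s) z) \<in> borel_measurable lborel" by measurable
          then show ?thesis using True by (subst nn_integral_cmult) (simp_all add: ball[OF True] del: power_Suc)
        qed
        also have "\<dots> = ennreal (\<rho> s * (C * s ^ Suc n))"
          using True C by (simp add: ennreal_mult'')
        also have "\<rho> s * (C * s ^ Suc n) = C * \<beta> * (\<beta> * s * exp (- \<beta> * s) + n * exp (- \<beta> * s))"
          using True by (simp add: \<rho>_def field_simps)
        finally show ?thesis using True by simp
      qed (use elim in simp)
    qed
  qed
  also have "\<dots> = ennreal (0 - (- C * ((\<beta> * 0 + 1) * exp (- \<beta> * 0) + n * exp (- \<beta> * 0))))"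
  proof (rule nn_integral_FTC_atLeast)
    show "DERIV (\<lambda>s. - C * ((\<beta> * s + 1) * exp (- \<beta> * s) + n * exp (- \<beta> * s))) s
        :> C * \<beta> * (\<beta> * s * exp (- \<beta> * s) + n * exp (- \<beta> * s))" for s
      by (auto intro!: derivative_eq_intros simp: algebra_simps)
    have "((\<lambda>s. - C * ((\<beta> * s + real (Suc n)) * exp (- \<beta> * s))) \<longlongrightarrow> - C * 0) at_top"
      by (intro tendsto_mult tendsto_const exp_tendsto_lin \<beta>)
    then show "((\<lambda>s. - C * ((\<beta> * s + 1) * exp (- \<beta> * s) + n * exp (- \<beta> * s))) \<longlongrightarrow> 0) at_top"
      by (simp add: algebra_simps)
  qed (use C \<beta> in auto)
  also have "\<dots> = ennreal (C * real (Suc n))" by (simp add: algebra_simps)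
  finally show ?thesis .
qed

section \<open>Total mass over all directions and over a half space\<close>

abbreviation decay :: "real \<Rightarrow> real^3 \<Rightarrow> real" where
  "decay \<beta> z \<equiv> \<beta> * exp (- \<beta> * norm z) / norm z ^ 2"

text \<open>The radial lemma with \<open>n = 2\<close> and \<open>g = 1\<close>: the factor
  \<open>Suc 2\<close> turns the volume of the unit ball into the area of the unit sphere.\<close>

lemma nn_integral_exp_inverse_square:
  assumes "0 < \<beta>"
  shows "(\<integral>\<^sup>+z. ennreal (decay \<beta> z) \<partial>(lborel :: (real^3) measure)) = ennreal (4 * pi)"
proof -
  have "(\<integral>\<^sup>+z. ennreal (decay \<beta> z * 1) \<partial>(lborel :: (real^3) measure))
      = ennreal (4/3 * pi * real (Suc 2))"
  proof (rule nn_integral_radial_weight)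
    have *: "Suc 2 = 3" by simp
    show "(\<integral>\<^sup>+z. ennreal 1 * indicator (cball 0 s) z \<partial>(lborel :: (real^3) measure)) = ennreal (4/3 * pi * s ^ Suc 2)"
      if "0 < s" for s unfolding * using that by (simp add: emeasure_cball_real3)
  qed (use assms in auto)
  then show ?thesis by simp
qed

text \<open>The slice at height \<open>t\<close> is a disc of area
  \<open>pi * (s\<^sup>2 - t\<^sup>2)\<close>, on which the integrand has the constant value
  \<open>t\<close>.\<close>

lemma nn_integral_half_ball_moment:
  assumes s: "0 < s"
  shows "(\<integral>\<^sup>+z. ennreal (max 0 (z $ 3)) * indicator (cball 0 s) z \<partial>(lborel :: (real^3) measure)) = ennreal (pi / 4 * s ^ 4)"
proof -
  let ?F = "\<lambda>u t. ennreal (max 0 (join3 u t $ 3)) * indicator (cball 0 s) (join3 u t)"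
  have mem: "join3 u t \<in> cball 0 s \<longleftrightarrow> u \<in> cball 0 (sqrt (s\<^sup>2 - t\<^sup>2))" if "0 \<le> t" "t \<le> s" for u t
  proof -
    have "t\<^sup>2 \<le> s\<^sup>2" using that by (intro power_mono) auto
    moreover have "norm (join3 u t) \<le> s \<longleftrightarrow> (norm u)\<^sup>2 + t\<^sup>2 \<le> s\<^sup>2"
      using s by (simp add: norm_le_square inner_vec_def sum_3 sum_2 power2_norm_eq_inner)
        (simp add: power2_eq_square)
    moreover have "norm u \<le> sqrt (s\<^sup>2 - t\<^sup>2) \<longleftrightarrow> (norm u)\<^sup>2 \<le> s\<^sup>2 - t\<^sup>2"
      using real_le_rsqrt sqrt_ge_absD by (metis abs_norm_cancel)
    ultimately show ?thesis by (simp add: le_diff_eq)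
  qed
  have out: "join3 u t \<notin> cball 0 s" if "s < t" for u t
  proof -
    have "\<bar>join3 u t $ 3\<bar> \<le> norm (join3 u t)" by (rule component_le_norm_cart)
    then show ?thesis using that by simp
  qed
  have [measurable]: "cball 0 s \<in> sets (borel :: (real^3) measure)" by simp
  have "(\<lambda>x. ennreal (max 0 (join3 (fst x) (snd x) $ 3)) * indicator (cball 0 s) (join3 (fst x) (snd x))) \<in> borel_measurable (lborel \<Otimes>\<^sub>M lborel)"
    by (rule measurable_compose[OF join3_measurable, of "\<lambda>z. ennreal (max 0 (z $ 3)) * indicator (cball 0 s) z"]) measurable
  then have [measurable]: "(\<lambda>(u, t). ?F u t) \<in> borel_measurable (lborel \<Otimes>\<^sub>M lborel)"
    by (simp add: split_beta')
  have "(\<integral>\<^sup>+z. ennreal (max 0 (z $ 3)) * indicator (cball 0 s) z \<partial>(lborel :: (real^3) measure))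
      = (\<integral>\<^sup>+u. \<integral>\<^sup>+t. ?F u t \<partial>lborel \<partial>lborel)"
    by (rule nn_integral_join3) measurable
  also have "\<dots> = (\<integral>\<^sup>+t. \<integral>\<^sup>+u. ?F u t \<partial>lborel \<partial>lborel)"
  proof -
    show ?thesis by (intro lborel_pair.Fubini'[symmetric]) measurable
  qed
  also have "\<dots> = (\<integral>\<^sup>+t. ennreal (pi * (s\<^sup>2 * t - t ^ 3)) * indicator {0..s} t \<partial>lborel)"
  proof (intro nn_integral_cong)
    fix t :: real
    show "(\<integral>\<^sup>+u. ?F u t \<partial>lborel)
      = ennreal (pi * (s\<^sup>2 * t - t ^ 3)) * indicator {0..s} t"
    proof (cases "0 \<le> t \<and> t \<le> s")
      case True
      then have sq: "0 \<le> s\<^sup>2 - t\<^sup>2" using power_mono[of t s 2] by simp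
      have "(\<integral>\<^sup>+u. ?F u t \<partial>lborel)
        = (\<integral>\<^sup>+u. ennreal t * indicator (cball 0 (sqrt (s\<^sup>2 - t\<^sup>2))) u \<partial>(lborel :: (real^2) measure))"
        using True mem by (intro nn_integral_cong) (auto split: split_indicator)
      also have "\<dots> = ennreal t * ennreal (pi * (s\<^sup>2 - t\<^sup>2))"
        using sq by (subst nn_integral_cmult_indicator) (auto simp: emeasure_cball_real2)
      also have "\<dots> = ennreal (pi * (s\<^sup>2 * t - t ^ 3))"
        using True sq by (simp add: ennreal_mult[symmetric]) (simp add: algebra_simps power2_eq_square power3_eq_cube)
      finally show ?thesis using True by simp
    next
      case False
      then have "?F u t = 0" for u
        using out[of t u] by (auto simp: max_def not_le split: split_indicator)
      then have "(\<integral>\<^sup>+u. ?F u t \<partial>lborel) = 0"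
        by (simp only: nn_integral_const mult_zero_left)
      then show ?thesis using False by (auto split: split_indicator)
    qed
  qed
  also have "\<dots> = ennreal ((pi * (s\<^sup>2 * s\<^sup>2 / 2 - s ^ 4 / 4)) - (pi * (s\<^sup>2 * 0\<^sup>2 / 2 - 0 ^ 4 / 4)))"
  proof (rule nn_integral_FTC_Icc)
    show "DERIV (\<lambda>t. pi * (s\<^sup>2 * t\<^sup>2 / 2 - t ^ 4 / 4)) t :> pi * (s\<^sup>2 * t - t ^ 3)" for t
      by (auto intro!: derivative_eq_intros simp: field_simps)
    show "0 \<le> pi * (s\<^sup>2 * t - t ^ 3)" if "t \<in> {0..s}" for t
    proof -
      have "t\<^sup>2 * t \<le> s\<^sup>2 * t" using that by (intro mult_right_mono power_mono) auto
      then show ?thesis by (simp add: power3_eq_cube power2_eq_square)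
    qed
  qed (use s in auto)
  also have "\<dots> = ennreal (pi / 4 * s ^ 4)"
  proof -
    have "s\<^sup>2 * s\<^sup>2 = s ^ 4" by (simp only: power_add[symmetric]) simp
    then have "(pi * (s\<^sup>2 * s\<^sup>2 / 2 - s ^ 4 / 4)) - (pi * (s\<^sup>2 * 0\<^sup>2 / 2 - 0 ^ 4 / 4)) = pi / 4 * s ^ 4"
      by (simp add: field_simps)
    then show ?thesis by simp
  qed
  finally show ?thesis .
qed

lemma exp_profile_measurable: "(\<lambda>r::real. \<beta> * exp (- \<beta> * r) / r ^ n) \<in> borel_measurable borel"
  by measurable

text \<open>With \<open>m\<close> the inward normal this is the cosine at a boundary point, cut off
  to 0 for directions in the outer half space.\<close>

definition half_cos :: "real^3 \<Rightarrow> real^3 \<Rightarrow> real" where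
  "half_cos m z = max 0 (m \<bullet> z) / norm z"

lemma half_cos_measurable [measurable]: "half_cos m \<in> borel_measurable borel"
  unfolding half_cos_def by measurable

lemma half_cos_nonneg: "0 \<le> half_cos m z"
  by (simp add: half_cos_def)

lemma half_cos_rotate:
  assumes "norm m = 1"
  shows "\<exists>T. orthogonal_transformation T \<and> (\<forall>z. half_cos m (T z) = half_cos (axis 3 1) z)"
proof -
  obtain T :: "real^3 \<Rightarrow> real^3" where T: "orthogonal_transformation T" "T (axis 3 1) = m"
    by (rule orthogonal_transformation_exists_1[of "axis 3 1" m]) (use assms in \<open>simp_all add: norm_axis_1\<close>)
  have "half_cos m (T z) = half_cos (axis 3 1) z" for z
  proof -
    have "m \<bullet> T z = axis 3 1 \<bullet> z"
      using T unfolding orthogonal_transformation_def by (metis T(2))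
    then show ?thesis unfolding half_cos_def by (simp only: orthogonal_transformation_norm[OF T(1)])
  qed
  then show ?thesis using T(1) by blast
qed

lemma nn_integral_half_cos_rotate:
  assumes m: "norm m = 1" and [measurable]: "\<psi> \<in> borel_measurable borel"
  shows "(\<integral>\<^sup>+z. ennreal (\<psi> (norm z) * half_cos m z) \<partial>lborel) = (\<integral>\<^sup>+z. ennreal (\<psi> (norm z) * half_cos (axis 3 1) z) \<partial>lborel)"
proof -
  obtain T where T: "orthogonal_transformation T" "\<forall>z. half_cos m (T z) = half_cos (axis 3 1) z"
    using half_cos_rotate[OF m] by (elim exE conjE)
  have [measurable]: "T \<in> borel_measurable borel"
    using orthogonal_transformation_linear[OF T(1)]
    by (intro borel_measurable_continuous_onI linear_continuous_on linear_conv_bounded_linear[THEN iffD1])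
  have "(\<integral>\<^sup>+z. ennreal (\<psi> (norm z) * half_cos m z) \<partial>lborel)
     = (\<integral>\<^sup>+z. ennreal (\<psi> (norm z) * half_cos m z) \<partial>distr lborel borel T)"
    by (simp only: lborel_orthogonal[OF T(1)])
  also have "\<dots> = (\<integral>\<^sup>+z. ennreal (\<psi> (norm (T z)) * half_cos m (T z)) \<partial>lborel)"
    by (intro nn_integral_distr) (simp, measurable)
  finally show ?thesis by (simp only: T(2)[rule_format] orthogonal_transformation_norm[OF T(1)])
qed

text \<open>After a rotation \<open>m\<close> is the third axis and the cosine is
  \<open>z $ 3\<close> over \<open>norm z\<close>, so the radial lemma applies with
  \<open>n = 3\<close>. The value is the cosine-weighted solid angle of a half space.\<close>

lemma nn_integral_exp_half_cos:
  assumes \<beta>: "0 < \<beta>" and m: "norm m = 1"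
  shows "(\<integral>\<^sup>+z. ennreal (decay \<beta> z * half_cos m z) \<partial>lborel) = ennreal pi"
proof -
  define \<psi> where "\<psi> r = \<beta> * exp (- \<beta> * r) / r ^ 2" for r :: real
  have "\<psi> \<in> borel_measurable borel" unfolding \<psi>_def by (rule exp_profile_measurable)
  note rot = nn_integral_half_cos_rotate[OF m this]
  have "\<psi> (norm z) * half_cos (axis 3 1) z = \<beta> * exp (- \<beta> * norm z) / norm z ^ 3 * max 0 (z $ 3)" for z
  proof -
    have 1: "axis 3 1 \<bullet> z = z $ 3" by (simp add: inner_axis')
    have 2: "norm z ^ 3 = norm z ^ 2 * norm z" by (simp add: power3_eq_cube power2_eq_square)
    show ?thesis unfolding half_cos_def \<psi>_def 1 2 by (simp only: times_divide_times_eq times_divide_eq_left times_divide_eq_right divide_divide_eq_left mult.commute[of "norm z"])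
  qed
  then have "(\<integral>\<^sup>+z. ennreal (\<psi> (norm z) * half_cos m z) \<partial>lborel)
      = (\<integral>\<^sup>+z. ennreal (\<beta> * exp (- \<beta> * norm z) / norm z ^ 3 * max 0 (z $ (3::3))) \<partial>lborel)"
    using rot by (simp only:)
  also have "\<dots> = ennreal (pi / 4 * real (Suc 3))"
  proof (rule nn_integral_radial_weight)
    have "Suc 3 = 4" by simp
    then show "(\<integral>\<^sup>+z. ennreal (max 0 (z $ (3::3))) * indicator (cball 0 s) z \<partial>lborel) = ennreal (pi / 4 * s ^ Suc 3)"
      if "0 < s" for s using nn_integral_half_ball_moment[OF that] by simp
  qed (use \<beta> in auto)
  finally show ?thesis by (simp add: \<psi>_def)
qed

section \<open>Measurability of visibility and normals\<close>

lemma visibility_commute: "visibility V x y = visibility V y x"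
  by (simp add: visibility_def open_segment_commute)

text \<open>For parameters in a compact interval inside the open unit interval, lying in the open
  set \<open>V\<close> is an open condition on the pair of end points, by compactness. Countably
  many such intervals exhaust the open segment.\<close>

lemma visibility_measurable:
  assumes V: "open (V :: (real^3) set)"
  shows "(\<lambda>p. visibility V (fst p) (snd p)) \<in> borel_measurable borel"
proof -
  define e where "e n = 1 / (real n + 3)" for n
  define A where "A n = {p. \<forall>t\<in>{e n..1 - e n}. (1 - t) *\<^sub>R fst p + t *\<^sub>R snd p \<in> V}" for n
  have e: "0 < e n" "e n < 1" for n by (auto simp: e_def)
  have "open (A n)" for n
  proof -
    let ?T = "{q :: real \<times> (real^3) \<times> (real^3). (1 - fst q) *\<^sub>R fst (snd q) + fst q *\<^sub>R snd (snd q) \<in> - V}"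
    have "closed ?T"
      using V by (intro closed_vimage[of "- V", unfolded vimage_def]) (auto intro!: continuous_intros)
    then have "closed {p. \<exists>t. t \<in> {e n..1 - e n} \<and> (t, p) \<in> ?T}"
      by (intro closed_compact_projection compact_Icc)
    moreover have "- A n = {p. \<exists>t. t \<in> {e n..1 - e n} \<and> (t, p) \<in> ?T}"
      by (auto simp: A_def)
    ultimately have "closed (- A n)" by (simp only:)
    then show ?thesis by (simp add: closed_def)
  qed
  then have "(\<Inter>n. A n) \<in> sets borel" by (intro sets.countable_INT) auto
  moreover have "{p :: (real^3) \<times> (real^3). fst p = snd p} \<in> sets borel"
    by (intro borel_closed closed_Collect_eq) (auto intro!: continuous_intros)
  ultimately have B: "{p. fst p = snd p} \<union> (\<Inter>n. A n) \<in> sets borel" by (rule sets.Un[rotated])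
  \<comment> \<open>For equal end points the open segment is empty and \<open>visibility\<close> is
    1, so the diagonal is part of the set.\<close>
  have "open_segment (fst p) (snd p) \<subseteq> V \<longleftrightarrow> p \<in> {p. fst p = snd p} \<union> (\<Inter>n. A n)" for p
  proof (cases "fst p = snd p")
    case False
    have "open_segment (fst p) (snd p) \<subseteq> V \<longleftrightarrow> (\<forall>t. 0 < t \<and> t < 1 \<longrightarrow> (1 - t) *\<^sub>R fst p + t *\<^sub>R snd p \<in> V)"
    proof
      assume "open_segment (fst p) (snd p) \<subseteq> V"
      moreover have "(1 - t) *\<^sub>R fst p + t *\<^sub>R snd p \<in> open_segment (fst p) (snd p)" if "0 < t \<and> t < 1" for t
        using False that unfolding in_segment by blast
      ultimately show "\<forall>t. 0 < t \<and> t < 1 \<longrightarrow> (1 - t) *\<^sub>R fst p + t *\<^sub>R snd p \<in> V" by blast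
    qed (auto simp: in_segment)
    also have "\<dots> \<longleftrightarrow> (\<forall>n. p \<in> A n)"
    proof
      assume "\<forall>t. 0 < t \<and> t < 1 \<longrightarrow> (1 - t) *\<^sub>R fst p + t *\<^sub>R snd p \<in> V"
      moreover have "0 < t \<and> t < 1" if "t \<in> {e n..1 - e n}" for t n
        using that e[of n] by (auto intro: less_le_trans)
      ultimately show "\<forall>n. p \<in> A n" unfolding A_def by blast
    next
      assume *: "\<forall>n. p \<in> A n"
      show "\<forall>t. 0 < t \<and> t < 1 \<longrightarrow> (1 - t) *\<^sub>R fst p + t *\<^sub>R snd p \<in> V"
      proof (intro allI impI)
        fix t :: real assume t: "0 < t \<and> t < 1"
        define s where "s = min t (1 - t)"
        have s: "0 < s" using t by (simp add: s_def)
        obtain n where n: "inverse (real (Suc n)) < s" using reals_Archimedean[OF s] by blast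
        have "e n \<le> inverse (real (Suc n))" by (simp add: e_def field_simps)
        then have "t \<in> {e n..1 - e n}" using n by (auto simp: s_def)
        then show "(1 - t) *\<^sub>R fst p + t *\<^sub>R snd p \<in> V" using * by (auto simp: A_def)
      qed
    qed
    finally show ?thesis using False by simp
  qed simp
  then have "(\<lambda>p. visibility V (fst p) (snd p)) = indicator ({p. fst p = snd p} \<union> (\<Inter>n. A n))"
    by (auto simp: visibility_def fun_eq_iff indicator_def)
  then show ?thesis using B by simp
qed

lemma visibility_section:
  assumes "open (V :: (real^3) set)"
  shows "visibility V x \<in> borel_measurable borel"
proof -
  have "(\<lambda>y. (x, y)) \<in> borel_measurable borel"
    by (intro borel_measurable_continuous_onI continuous_intros)
  from measurable_compose[OF this visibility_measurable[OF assms]] show ?thesis by simp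
qed

section \<open>Normals at smooth boundary points\<close>

lemma frontier_open_disjoint: "open V \<Longrightarrow> frontier V \<inter> V = {}"
  by (auto simp: frontier_def interior_open)

lemma outward_normal_eqI: "is_outward_unit_normal V x n \<Longrightarrow> outward_normal V x = n"
  unfolding outward_normal_def using is_outward_unit_normal_unique by (blast intro: the_equality)

lemma outward_normal_is:
  "x \<in> smooth_boundary_points V \<Longrightarrow> is_outward_unit_normal V x (outward_normal V x)"
  unfolding smooth_boundary_points_def using outward_normal_eqI by blast

lemma norm_outward_normal:
  assumes "x \<in> smooth_boundary_points V" shows "norm (outward_normal V x) = 1"
proof -
  obtain W g d where "x \<in> W" "\<forall>y\<in>W. (g has_derivative (\<lambda>h. d y \<bullet> h)) (at y) \<and> d y \<noteq> 0"
    "outward_normal V x = d x /\<^sub>R norm (d x)"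
    using outward_normal_is[OF assms] unfolding is_outward_unit_normal_def by blast
  then show ?thesis by simp
qed

lemma smooth_boundary_subset: "smooth_boundary_points V \<subseteq> frontier V"
  by (auto simp: smooth_boundary_points_def is_outward_unit_normal_def)

text \<open>One defining function serves all boundary points in its neighbourhood. Hence the smooth
  points are relatively open in the boundary, and the normal is locally given by a continuous
  field.\<close>

lemma smooth_point_chart:
  assumes "x \<in> smooth_boundary_points V"
  obtains W and d :: "real^3 \<Rightarrow> real^3" where "open W" "x \<in> W" "continuous_on W d" "\<forall>y\<in>W. d y \<noteq> 0"
    "W \<inter> frontier V \<subseteq> smooth_boundary_points V"
    "\<forall>y \<in> W \<inter> frontier V. outward_normal V y = d y /\<^sub>R norm (d y)"
proof -
  obtain W g d where W: "open W" "x \<in> W" "\<forall>y\<in>W. (g has_derivative (\<lambda>h. d y \<bullet> h)) (at y) \<and> d y \<noteq> 0"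
    "continuous_on W d" "V \<inter> W = {y \<in> W. g y < 0}" "frontier V \<inter> W = {y \<in> W. g y = 0}"
    using outward_normal_is[OF assms] unfolding is_outward_unit_normal_def by blast
  have n: "is_outward_unit_normal V y (d y /\<^sub>R norm (d y))" if "y \<in> W \<inter> frontier V" for y
    unfolding is_outward_unit_normal_def using that W by (intro conjI exI[of _ W] exI[of _ g] exI[of _ d]) auto
  show ?thesis
  proof (rule that[OF W(1,2,4)])
    show "W \<inter> frontier V \<subseteq> smooth_boundary_points V" using n by (auto simp: smooth_boundary_points_def)
    show "\<forall>y \<in> W \<inter> frontier V. outward_normal V y = d y /\<^sub>R norm (d y)"
      using n outward_normal_eqI by blast
  qed (use W(3) in auto)
qed

lemma smooth_boundary_borel: "smooth_boundary_points V \<in> sets borel"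
proof -
  let ?O = "\<Union>{W. open W \<and> W \<inter> frontier V \<subseteq> smooth_boundary_points V}"
  have "smooth_boundary_points V = ?O \<inter> frontier V"
  proof
    show "smooth_boundary_points V \<subseteq> ?O \<inter> frontier V"
    proof
      fix x assume x: "x \<in> smooth_boundary_points V"
      obtain W where "open W" "x \<in> W" "W \<inter> frontier V \<subseteq> smooth_boundary_points V"
        by (rule smooth_point_chart[OF x]) blast
      then show "x \<in> ?O \<inter> frontier V" using x smooth_boundary_subset by blast
    qed
  qed auto
  moreover have "?O \<inter> frontier V \<in> sets borel"
    by (intro sets.Int borel_open borel_closed frontier_closed open_Union) auto
  ultimately show ?thesis by (simp only:)
qed

lemma outward_normal_measurable [measurable]: "outward_normal V \<in> borel_measurable borel"
proof -
  have cont: "continuous_on (smooth_boundary_points V) (outward_normal V)"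
    unfolding continuous_on_eq_continuous_within
  proof
    fix x assume x: "x \<in> smooth_boundary_points V"
    obtain W and d :: "real^3 \<Rightarrow> real^3" where W: "open W" "x \<in> W" "continuous_on W d" "\<forall>y\<in>W. d y \<noteq> 0"
      "W \<inter> frontier V \<subseteq> smooth_boundary_points V"
      "\<forall>y \<in> W \<inter> frontier V. outward_normal V y = d y /\<^sub>R norm (d y)"
      by (rule smooth_point_chart[OF x])
    have "continuous_on W (\<lambda>y. d y /\<^sub>R norm (d y))"
      using W(3,4) by (intro continuous_intros) auto
    then have "continuous_on (W \<inter> frontier V) (outward_normal V)"
      by (rule continuous_on_eq[OF continuous_on_subset]) (use W(6) in auto)
    moreover have "x \<in> W \<inter> frontier V" using W(2) x smooth_boundary_subset by auto
    ultimately have "continuous (at x within W \<inter> frontier V) (outward_normal V)"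
      by (auto simp: continuous_on_eq_continuous_within)
    moreover have "at x within (W \<inter> frontier V) = at x within smooth_boundary_points V"
      using W(1,2,5) smooth_boundary_subset[of V] by (intro at_within_nhd[of x W]) auto
    ultimately show "continuous (at x within smooth_boundary_points V) (outward_normal V)" by simp
  qed
  \<comment> \<open>At a point without a normal the defining predicate is false for every vector, so
    the description is one fixed vector: the normal is constant off the smooth points.\<close>
  have "outward_normal V x = (THE n. False)" if "x \<notin> smooth_boundary_points V" for x
    using that by (simp add: smooth_boundary_points_def outward_normal_def)
  then have "outward_normal V = (\<lambda>x. if x \<in> smooth_boundary_points V then outward_normal V x else (THE n. False))"
    by auto
  also have "\<dots> \<in> borel_measurable borel"
    by (intro borel_measurable_continuous_on_if smooth_boundary_borel cont continuous_on_const)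
  finally show ?thesis .
qed

text \<open>With a negative cosine the segment would leave \<open>x\<close> in a direction in which
  the defining function grows, and so would run outside \<open>V\<close> at once. This allows
  \<open>max 0\<close> around the cosines of the kernels without changing them.\<close>

lemma cos_angle_visible_nonneg:
  assumes x: "x \<in> smooth_boundary_points V" and vis: "open_segment x y \<subseteq> V"
  shows "0 \<le> cos_angle V x y"
proof (rule ccontr)
  let ?n = "outward_normal V x"
  assume neg: "\<not> 0 \<le> cos_angle V x y"
  then have xy: "x \<noteq> y" by (auto simp: cos_angle_def)
  define h where "h = y - x"
  have nh: "?n \<bullet> h > 0"
    using neg by (auto simp: cos_angle_def h_def not_le divide_less_0_iff inner_commute inner_diff_left inner_diff_right)
  obtain W and g :: "real^3 \<Rightarrow> real" and d where W: "open W" "x \<in> W"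
    "\<forall>y\<in>W. (g has_derivative (\<lambda>h. d y \<bullet> h)) (at y) \<and> d y \<noteq> 0"
    "V \<inter> W = {y \<in> W. g y < 0}" "frontier V \<inter> W = {y \<in> W. g y = 0}" "?n = d x /\<^sub>R norm (d x)" "x \<in> frontier V"
    using outward_normal_is[OF x] unfolding is_outward_unit_normal_def by blast
  have g0: "g x = 0" and d0: "d x \<noteq> 0" using W by blast+
  define l where "l = (\<lambda>t::real. x + t *\<^sub>R h)"
  have l: "(l has_derivative (\<lambda>t. t *\<^sub>R h)) (at 0)"
    unfolding l_def by (auto intro!: derivative_eq_intros)
  have l0: "l 0 = x" by (simp add: l_def)
  have D1: "((g \<circ> l) has_derivative (\<lambda>t. d x \<bullet> (t *\<^sub>R h))) (at 0)"
    using diff_chain_at[OF l, of g "\<lambda>k. d x \<bullet> k"] W(2,3) l0 by (simp add: o_def)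
  have R1: "DERIV (g \<circ> l) 0 :> d x \<bullet> h"
    using D1 by (simp add: has_field_derivative_def mult.commute[of _ "d x \<bullet> h"] mult_commute_abs)
  have s1: "d x \<bullet> h > 0"
    using nh d0 unfolding W(6) by (simp add: zero_less_mult_iff)
  obtain e1 where e1: "e1 > 0" "\<And>t. 0 < t \<Longrightarrow> t < e1 \<Longrightarrow> (g \<circ> l) 0 < (g \<circ> l) (0 + t)"
    using DERIV_pos_inc_right[OF R1 s1] by auto
  have "continuous_on UNIV l" unfolding l_def by (intro continuous_intros)
  then have "open (l -` W)" by (rule open_vimage[OF W(1)])
  moreover have "0 \<in> l -` W" using l0 W(2) by simp
  ultimately have "\<exists>e>0. \<forall>t. dist t 0 < e \<longrightarrow> t \<in> l -` W"
    unfolding open_dist by (rule bspec)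
  then obtain e3 where e3: "e3 > 0" "\<And>t. dist t 0 < e3 \<Longrightarrow> l t \<in> W" by blast
  define t where "t = min e1 (min 1 e3) / 2"
  have t: "0 < t" "t < e1" "t < 1" "t < e3" using e1(1) e3(1) by (auto simp: t_def)
  have "l t \<in> open_segment x y"
    using t xy unfolding in_segment l_def h_def by (intro conjI exI[of _ t]) (auto simp: algebra_simps)
  then have "l t \<in> V" using vis by auto
  moreover have "l t \<in> W" using e3(2)[of t] t by auto
  moreover have "g (l t) > 0" using e1(2)[of t] t l0 g0 by auto
  ultimately show False using W(4) by force
qed

section \<open>Surface patches\<close>

text \<open>Kept as a vector and not only as its norm, because its inner product with
  \<open>\<gamma> u - x\<close> is the Jacobian of the cone coordinates up to a power of the ray
  parameter.\<close>

definition tangent_cross :: "(real^2 \<Rightarrow> real^3) \<Rightarrow> real^2 \<Rightarrow> real^3" where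
  "tangent_cross \<gamma> u = cross3 (frechet_derivative \<gamma> (at u) (axis 1 1)) (frechet_derivative \<gamma> (at u) (axis 2 1))"

lemma area_element_eq: "area_element \<gamma> u = norm (tangent_cross \<gamma> u)"
  by (simp add: area_element_def tangent_cross_def)

lemma smooth_patch_derivative:
  assumes "smooth_patch D \<gamma>"
  obtains \<gamma>' :: "real^2 \<Rightarrow> (real^2, real^3) blinfun" where "continuous_on D \<gamma>'"
    "\<forall>u\<in>D. (\<gamma> has_derivative blinfun_apply (\<gamma>' u)) (at u)"
    "\<forall>u\<in>D. tangent_cross \<gamma> u = cross3 (\<gamma>' u (axis 1 1)) (\<gamma>' u (axis 2 1))"
proof -
  obtain U and \<gamma>' :: "real^2 \<Rightarrow> (real^2, real^3) blinfun" where U: "open U" "D \<subseteq> U"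
      "continuous_on U \<gamma>'" "\<And>u. u \<in> U \<Longrightarrow> (\<gamma> has_derivative blinfun_apply (\<gamma>' u)) (at u)"
    using assms unfolding smooth_patch_def by blast
  have eq: "frechet_derivative \<gamma> (at u) = blinfun_apply (\<gamma>' u)" if "u \<in> U" for u
    using U(4)[OF that] frechet_derivative_at by metis
  show ?thesis
    by (rule that[of \<gamma>']) (use U eq continuous_on_subset in \<open>auto simp: tangent_cross_def subset_iff\<close>)
qed

lemma continuous_on_tangent_cross:
  assumes "smooth_patch D \<gamma>"
  shows "continuous_on D (tangent_cross \<gamma>)"
proof -
  obtain \<gamma>' :: "real^2 \<Rightarrow> (real^2, real^3) blinfun" where g: "continuous_on D \<gamma>'"
    "\<forall>u\<in>D. (\<gamma> has_derivative blinfun_apply (\<gamma>' u)) (at u)"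
    "\<forall>u\<in>D. tangent_cross \<gamma> u = cross3 (\<gamma>' u (axis 1 1)) (\<gamma>' u (axis 2 1))"
    by (rule smooth_patch_derivative[OF assms])
  have "continuous_on D (\<lambda>u. cross3 (\<gamma>' u (axis 1 1)) (\<gamma>' u (axis 2 1)))"
    by (intro continuous_on_cross blinfun.continuous_on g(1) continuous_intros)
  then show ?thesis using g(3) by (simp cong: continuous_on_cong)
qed

text \<open>The local defining function vanishes along the patch, so its composition with
  \<open>\<gamma>\<close> has derivative 0.\<close>

lemma normal_orthogonal_tangent:
  assumes sp: "smooth_patch D \<gamma>" and sm: "\<gamma> ` interior D \<subseteq> smooth_boundary_points V"
    and u: "u \<in> interior D" and \<gamma>': "(\<gamma> has_derivative \<gamma>') (at u)"
  shows "outward_normal V (\<gamma> u) \<bullet> \<gamma>' h = 0"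
proof -
  obtain W and g :: "real^3 \<Rightarrow> real" and d where W: "open W" "\<gamma> u \<in> W"
    "\<forall>y\<in>W. (g has_derivative (\<lambda>h. d y \<bullet> h)) (at y) \<and> d y \<noteq> 0"
    "frontier V \<inter> W = {y \<in> W. g y = 0}" "outward_normal V (\<gamma> u) = d (\<gamma> u) /\<^sub>R norm (d (\<gamma> u))"
    using outward_normal_is[of "\<gamma> u" V] sm u unfolding is_outward_unit_normal_def by blast
  have cont: "continuous_on (interior D) \<gamma>"
    by (rule continuous_on_subset[OF area_element_continuous_on(2)[OF sp] interior_subset])
  define O' where "O' = interior D \<inter> \<gamma> -` W"
  have O': "open O'" unfolding O'_def using continuous_open_preimage[OF cont open_interior W(1)] .
  have uO: "u \<in> O'" using u W(2) by (simp add: O'_def)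
  have zero: "(g \<circ> \<gamma>) v = 0" if "v \<in> O'" for v
  proof -
    have "\<gamma> v \<in> frontier V \<inter> W" using that sm smooth_boundary_subset[of V] by (auto simp: O'_def)
    then show ?thesis using W(4) by auto
  qed
  have "((g \<circ> \<gamma>) has_derivative ((\<lambda>h. d (\<gamma> u) \<bullet> h) \<circ> \<gamma>')) (at u)"
    using W(2,3) by (intro diff_chain_at \<gamma>') auto
  moreover have "((g \<circ> \<gamma>) has_derivative (\<lambda>_. 0)) (at u)"
    using has_derivative_transform_within_open[OF has_derivative_const[of 0] O' uO, of "g \<circ> \<gamma>"] zero by simp
  ultimately have "(\<lambda>h. d (\<gamma> u) \<bullet> h) \<circ> \<gamma>' = (\<lambda>_. 0)" by (rule has_derivative_unique)
  then have "d (\<gamma> u) \<bullet> \<gamma>' h = 0" by (metis comp_apply)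
  then show ?thesis unfolding W(5) by simp
qed

text \<open>By Lagrange's identity and orthogonality the cross product of the normal with
  \<open>tangent_cross\<close> vanishes, so the two are parallel. The absolute values remain because
  a patch may be oriented either way.\<close>

lemma area_element_inner_normal:
  assumes sp: "smooth_patch D \<gamma>" and sm: "\<gamma> ` interior D \<subseteq> smooth_boundary_points V"
    and u: "u \<in> interior D"
  shows "\<bar>tangent_cross \<gamma> u \<bullet> a\<bar> = area_element \<gamma> u * \<bar>a \<bullet> outward_normal V (\<gamma> u)\<bar>"
proof -
  let ?n = "outward_normal V (\<gamma> u)" and ?J = "tangent_cross \<gamma> u"
  have uD: "u \<in> D" using u interior_subset by blast
  obtain \<gamma>' :: "real^2 \<Rightarrow> (real^2, real^3) blinfun" where "continuous_on D \<gamma>'" and g: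
    "\<forall>u\<in>D. (\<gamma> has_derivative blinfun_apply (\<gamma>' u)) (at u)"
    "\<forall>u\<in>D. tangent_cross \<gamma> u = cross3 (\<gamma>' u (axis 1 1)) (\<gamma>' u (axis 2 1))"
    by (rule smooth_patch_derivative[OF sp])
  have orth: "?n \<bullet> \<gamma>' u h = 0" for h
    by (rule normal_orthogonal_tangent[OF sp sm u g(1)[rule_format, OF uD]])
  have "cross3 ?n ?J = 0"
    unfolding g(2)[rule_format, OF uD] Lagrange orth by simp
  moreover have n1: "norm ?n = 1" using sm u by (intro norm_outward_normal) auto
  ultimately have "?J = (?n \<bullet> ?J) *\<^sub>R ?n"
    using Lagrange[of ?n ?n ?J] by (simp add: cross_zero_right norm_eq_1)
  then have J: "?J = (?n \<bullet> ?J) *\<^sub>R ?n" .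
  have "area_element \<gamma> u = \<bar>?n \<bullet> ?J\<bar>"
    unfolding area_element_eq by (subst J) (simp add: n1)
  moreover have "?J \<bullet> a = (?n \<bullet> ?J) * (a \<bullet> ?n)"
    by (subst J) (simp add: inner_commute)
  ultimately show ?thesis by (simp add: abs_mult)
qed

text \<open>For a measure known only through its values on sets; serves both the sum over patches
  and the union of boundary and domain.\<close>

lemma nn_integral_sum_measures:
  assumes fin: "finite I" and sets: "\<And>i. i \<in> I \<Longrightarrow> sets (N i) = sets M"
    and em: "\<And>A. A \<in> sets M \<Longrightarrow> emeasure M A = (\<Sum>i\<in>I. emeasure (N i) A)"
    and f: "f \<in> borel_measurable M"
  shows "nn_integral M f = (\<Sum>i\<in>I. \<integral>\<^sup>+x. f x \<partial>N i)"
  using f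
proof (induction rule: borel_measurable_induct)
  case (cong f g)
  have "space (N i) = space M" if "i \<in> I" for i using sets[OF that] by (rule sets_eq_imp_space_eq)
  then have "(\<Sum>i\<in>I. \<integral>\<^sup>+x. f x \<partial>N i) = (\<Sum>i\<in>I. \<integral>\<^sup>+x. g x \<partial>N i)"
    using cong by (intro sum.cong nn_integral_cong) auto
  moreover have "nn_integral M f = nn_integral M g" using cong by (intro nn_integral_cong) auto
  ultimately show ?case using cong by simp
next
  case (set A)
  then show ?case using em sets by simp
next
  case (mult u c)
  have "u \<in> borel_measurable (N i)" if "i \<in> I" for i
    using mult(2) measurable_cong_sets[OF sets[OF that] refl] by blast
  then show ?case using mult by (simp add: nn_integral_cmult sum_distrib_left)
next
  case (add u v)
  have "u \<in> borel_measurable (N i)" "v \<in> borel_measurable (N i)" if "i \<in> I" for i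
    using add measurable_cong_sets[OF sets[OF that] refl] by blast+
  then show ?case using add by (simp add: nn_integral_add sum.distrib)
next
  case (seq F)
  have F: "F k \<in> borel_measurable (N i)" if "i \<in> I" for i k
    using seq(1) measurable_cong_sets[OF sets[OF that] refl] by blast
  have "(\<integral>\<^sup>+x. (SUP k. F k) x \<partial>M) = (SUP k. \<integral>\<^sup>+x. F k x \<partial>M)"
    using seq by (simp add: nn_integral_monotone_convergence_SUP image_comp)
  also have "\<dots> = (SUP k. \<Sum>i\<in>I. \<integral>\<^sup>+x. F k x \<partial>N i)" using seq by simp
  also have "\<dots> = (\<Sum>i\<in>I. SUP k. \<integral>\<^sup>+x. F k x \<partial>N i)"
    using seq by (intro ennreal_SUP_sum) (auto simp: incseq_def le_fun_def intro!: nn_integral_mono)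
  also have "\<dots> = (\<Sum>i\<in>I. \<integral>\<^sup>+x. (SUP k. F k) x \<partial>N i)"
    using seq F by (intro sum.cong refl) (simp add: nn_integral_monotone_convergence_SUP image_comp)
  finally show ?case by simp
qed

lemma sets_surface_measure:
  "sets (surface_measure P) = sets (restrict_space borel (patches_union P))"
  and space_surface_measure: "space (surface_measure P) = patches_union P"
proof -
  let ?R = "restrict_space borel (patches_union P)"
  have sp: "space ?R = patches_union P" by (simp add: space_restrict_space)
  have *: "sets ?R \<subseteq> Pow (patches_union P)"
    using sets.space_closed[of ?R] unfolding sp .
  have "sigma_sets (patches_union P) (sets ?R) = sets ?R"
    using sets.sigma_sets_eq[of ?R] unfolding sp .
  then show "sets (surface_measure P) = sets ?R"
    unfolding surface_measure_def using * by (simp only: sets_measure_of)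
  show "space (surface_measure P) = patches_union P"
    unfolding surface_measure_def using * by (simp only: space_measure_of)
qed

lemma surface_measurableI: "f \<in> borel_measurable borel \<Longrightarrow> f \<in> borel_measurable (surface_measure P)"
  unfolding measurable_cong_sets[OF sets_surface_measure refl] by (rule measurable_restrict_space1)

text \<open>Each patch contributes the image under \<open>\<gamma>\<close> of the measure with
  density \<open>area_element \<gamma>\<close> on the interior of its parameter domain, and the
  surface measure is the sum of these images.\<close>

lemma nn_integral_surface_measure:
  assumes fin: "finite P" and patch: "\<And>D \<gamma>. (D, \<gamma>) \<in> P \<Longrightarrow> smooth_patch D \<gamma>"
    and f: "f \<in> borel_measurable borel"
  shows "nn_integral (surface_measure P) f
    = (\<Sum>(D, \<gamma>)\<in>P. \<integral>\<^sup>+u. ennreal (area_element \<gamma> u) * f (\<gamma> u) * indicator (interior D) u \<partial>lborel)"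
proof -
  let ?S = "surface_measure P"
  have S: "patches_union P \<in> sets borel"
    using patches_union_compact[OF fin patch] by (simp add: borel_compact)
  define \<nu> where "\<nu> p = density (restrict_space lborel (interior (fst p))) (\<lambda>u. ennreal (area_element (snd p) u))" for p :: patch
  define N where "N p = distr (\<nu> p) (borel :: (real^3) measure) (snd p)" for p :: patch
  have meas: "snd p \<in> borel_measurable (\<nu> p)"
    "(\<lambda>u. ennreal (area_element (snd p) u)) \<in> borel_measurable (restrict_space lborel (interior (fst p)))"
    if "p \<in> P" for p
  proof -
    have sp: "smooth_patch (fst p) (snd p)" using patch that by (metis prod.collapse)
    have 1: "area_element (snd p) \<in> borel_measurable (restrict_space borel (interior (fst p)))"
      by (intro borel_measurable_continuous_on_restrict area_element_continuous_on[OF sp])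
    then show "(\<lambda>u. ennreal (area_element (snd p) u)) \<in> borel_measurable (restrict_space lborel (interior (fst p)))"
      unfolding measurable_cong_sets[OF restrict_space_sets_cong[OF refl sets_lborel] refl] by measurable
    have "snd p \<in> borel_measurable (restrict_space borel (interior (fst p)))"
      by (intro borel_measurable_continuous_on_restrict
            continuous_on_subset[OF area_element_continuous_on(2)[OF sp] interior_subset])
    then show "snd p \<in> borel_measurable (\<nu> p)"
      unfolding \<nu>_def measurable_cong_sets[OF sets_density refl]
        measurable_cong_sets[OF restrict_space_sets_cong[OF refl sets_lborel] refl] .
  qed
  let ?A = "\<lambda>A p u. ennreal (area_element (snd p) u) * indicator A (snd p u) * indicator (interior (fst p)) u"
  have idm: "(\<lambda>x. x) \<in> measurable ?S borel"
    by (rule surface_measurableI) simp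
  have nuint: "(\<integral>\<^sup>+x. g x \<partial>N p) = (\<integral>\<^sup>+u. ennreal (area_element (snd p) u) * g (snd p u) * indicator (interior (fst p)) u \<partial>lborel)"
    if "p \<in> P" and g: "g \<in> borel_measurable borel" for p g
  proof -
    have "(\<integral>\<^sup>+x. g x \<partial>N p) = (\<integral>\<^sup>+u. g (snd p u) \<partial>\<nu> p)"
      unfolding N_def using g by (intro nn_integral_distr meas that) simp
    also have "\<dots> = (\<integral>\<^sup>+u. ennreal (area_element (snd p) u) * g (snd p u) \<partial>restrict_space lborel (interior (fst p)))"
    proof -
      have "(\<lambda>u. g (snd p u)) \<in> borel_measurable (\<nu> p)" by (rule measurable_compose[OF meas(1)[OF that(1)] g])
      then show ?thesis
        unfolding \<nu>_def by (intro nn_integral_density meas that) simp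
    qed
    also have "\<dots> = (\<integral>\<^sup>+u. ennreal (area_element (snd p) u) * g (snd p u) * indicator (interior (fst p)) u \<partial>lborel)"
      by (intro nn_integral_restrict_space) simp
    finally show ?thesis .
  qed
  \<comment> \<open>The surface measure lives on the trace of the Borel sets. Pushed forward by the
    identity it has the same sigma-algebra as the image measures \<open>N p\<close>.\<close>
  have "nn_integral ?S f = (\<integral>\<^sup>+x. f x \<partial>distr ?S borel (\<lambda>x. x))"
    using f by (intro nn_integral_distr[symmetric] idm) simp
  also have "\<dots> = (\<Sum>p\<in>P. \<integral>\<^sup>+x. f x \<partial>N p)"
  proof (rule nn_integral_sum_measures[OF fin])
    fix A :: "(real^3) set" assume "A \<in> sets (distr ?S borel (\<lambda>x. x))"
    then have A: "A \<in> sets borel" by simp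
    have "emeasure (distr ?S borel (\<lambda>x. x)) A = emeasure ?S (A \<inter> patches_union P)"
      using A idm by (simp add: emeasure_distr space_surface_measure)
    also have "\<dots> = (\<Sum>(D, \<gamma>)\<in>P. \<integral>\<^sup>+u\<in>interior D. ennreal (area_element \<gamma> u) * indicator (A \<inter> patches_union P) (\<gamma> u) \<partial>lborel)"
      using A S by (intro emeasure_surface_measure fin patch) auto
    also have "\<dots> = (\<Sum>p\<in>P. emeasure (N p) A)"
    proof (intro sum.cong refl)
      fix p assume p: "p \<in> P"
      have "emeasure (N p) A = (\<integral>\<^sup>+x. indicator A x \<partial>N p)" using A by (simp add: N_def)
      also have "\<dots> = (\<integral>\<^sup>+u. ?A A p u \<partial>lborel)"
        using A by (intro nuint p) simp
      also have "\<dots> = (\<integral>\<^sup>+u. ?A (A \<inter> patches_union P) p u \<partial>lborel)"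
      proof (intro nn_integral_cong)
        fix u
        have "snd p u \<in> patches_union P" if "u \<in> interior (fst p)"
          using that p interior_subset unfolding patches_union_def by (fastforce simp: case_prod_beta)
        then show "?A A p u
          = ?A (A \<inter> patches_union P) p u"
          by (auto split: split_indicator)
      qed
      finally show "(case p of (D, \<gamma>) \<Rightarrow> \<integral>\<^sup>+u\<in>interior D. ennreal (area_element \<gamma> u) * indicator (A \<inter> patches_union P) (\<gamma> u) \<partial>lborel) = emeasure (N p) A"
        by (simp add: case_prod_beta)
    qed
    finally show "emeasure (distr ?S borel (\<lambda>x. x)) A = (\<Sum>p\<in>P. emeasure (N p) A)" .
  qed (use f in \<open>auto simp: N_def\<close>)
  also have "\<dots> = (\<Sum>(D, \<gamma>)\<in>P. \<integral>\<^sup>+u. ennreal (area_element \<gamma> u) * f (\<gamma> u) * indicator (interior D) u \<partial>lborel)"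
    using nuint[OF _ f] by (auto intro!: sum.cong simp: case_prod_beta)
  finally show ?thesis .
qed

text \<open>\<open>tangent_cross\<close> is continuous on the whole compact parameter domain, hence
  the area element is bounded.\<close>

lemma finite_surface_measure:
  assumes fin: "finite P" and patch: "\<And>D \<gamma>. (D, \<gamma>) \<in> P \<Longrightarrow> smooth_patch D \<gamma>"
  shows "finite_measure (surface_measure P)"
proof (rule finite_measureI)
  have "(\<integral>\<^sup>+u. ennreal (area_element \<gamma> u) * indicator (interior D) u \<partial>lborel) < \<infinity>" if "(D, \<gamma>) \<in> P" for D \<gamma>
  proof -
    note sp = patch[OF that]
    have D: "compact D" using sp by (simp add: smooth_patch_def)
    have "compact (tangent_cross \<gamma> ` D)"
      by (rule compact_continuous_image[OF continuous_on_tangent_cross[OF sp] D])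
    then obtain B where B: "\<And>u. u \<in> D \<Longrightarrow> norm (tangent_cross \<gamma> u) \<le> B"
      using compact_imp_bounded bounded_iff by (metis imageI)
    have "(\<integral>\<^sup>+u. ennreal (area_element \<gamma> u) * indicator (interior D) u \<partial>lborel) \<le> (\<integral>\<^sup>+u. ennreal B * indicator D u \<partial>lborel)"
      using B interior_subset[of D]
      by (intro nn_integral_mono) (auto simp: area_element_eq ennreal_leI split: split_indicator)
    also have "\<dots> = ennreal B * emeasure lborel D"
      using D by (intro nn_integral_cmult_indicator) (simp add: borel_compact)
    also have "\<dots> < \<infinity>"
      using emeasure_compact_finite[OF D] by (simp add: ennreal_mult_less_top)
    finally show ?thesis .
  qed
  then have "(\<integral>\<^sup>+x. 1 \<partial>surface_measure P) < \<infinity>"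
    using nn_integral_surface_measure[OF fin patch, of "\<lambda>_. 1"] fin
    by (auto simp: ennreal_sum_less_top)
  then show "emeasure (surface_measure P) (space (surface_measure P)) \<noteq> \<infinity>" by simp
qed

lemma piecewise_smoothD:
  assumes "piecewise_smooth_boundary V P"
  shows "finite P" "frontier V = patches_union P"
    "(D, \<gamma>) \<in> P \<Longrightarrow> smooth_patch D \<gamma>"
    "(D, \<gamma>) \<in> P \<Longrightarrow> \<gamma> ` interior D \<subseteq> smooth_boundary_points V"
    "disjoint_family_on (\<lambda>(D, \<gamma>). \<gamma> ` interior D) P"
  using assms unfolding piecewise_smooth_boundary_def by blast+

text \<open>Only the interiors of the parameter domains carry mass, and these are mapped to smooth
  points.\<close>

lemma AE_surface_smooth:
  assumes fin: "finite P" and patch: "\<And>D \<gamma>. (D, \<gamma>) \<in> P \<Longrightarrow> smooth_patch D \<gamma>"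
    and sm: "\<And>D \<gamma>. (D, \<gamma>) \<in> P \<Longrightarrow> \<gamma> ` interior D \<subseteq> smooth_boundary_points V"
  shows "AE x in surface_measure P. x \<in> smooth_boundary_points V"
proof -
  let ?f = "\<lambda>x. indicator (- smooth_boundary_points V) x :: ennreal"
  have f: "?f \<in> borel_measurable borel"
    using smooth_boundary_borel by (intro borel_measurable_indicator) (metis borel_comp)
  have "(\<Sum>(D, \<gamma>)\<in>P. \<integral>\<^sup>+u. ennreal (area_element \<gamma> u) * ?f (\<gamma> u) * indicator (interior D) u \<partial>lborel) = 0"
  proof (intro sum.neutral ballI)
    fix p assume p: "p \<in> P"
    have "ennreal (area_element (snd p) u) * ?f (snd p u) * indicator (interior (fst p)) u = 0" for u
      using sm[of "fst p" "snd p"] p by (auto split: split_indicator)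
    then show "(case p of (D, \<gamma>) \<Rightarrow> \<integral>\<^sup>+u. ennreal (area_element \<gamma> u) * ?f (\<gamma> u) * indicator (interior D) u \<partial>lborel) = 0"
      by (simp only: case_prod_beta nn_integral_const mult_zero_left)
  qed
  then have "nn_integral (surface_measure P) ?f = 0"
    using nn_integral_surface_measure[OF fin patch f] by simp
  then have "AE x in surface_measure P. ?f x = 0"
    using nn_integral_0_iff_AE[OF surface_measurableI[OF f]] by simp
  then show ?thesis by eventually_elim (auto split: split_indicator_asm)
qed

section \<open>The shadow of the boundary\<close>

lemma nn_integral_absolutely_integrable:
  fixes f :: "real^3 \<Rightarrow> real"
  assumes f: "f absolutely_integrable_on S" and f0: "\<And>x. 0 \<le> f x"
  shows "(\<integral>\<^sup>+x. ennreal (f x) * indicator S x \<partial>lebesgue) = ennreal (integral S f)"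
proof -
  have int: "integrable lebesgue (\<lambda>x. indicator S x *\<^sub>R f x)" using f by (simp add: set_integrable_def)
  have "(\<integral>\<^sup>+x. ennreal (f x) * indicator S x \<partial>lebesgue) = (\<integral>\<^sup>+x. ennreal (indicator S x *\<^sub>R f x) \<partial>lebesgue)"
    by (intro nn_integral_cong) (auto split: split_indicator)
  also have "\<dots> = ennreal (\<integral>x. indicator S x *\<^sub>R f x \<partial>lebesgue)"
    using f0 by (intro nn_integral_eq_integral int) auto
  also have "\<dots> = ennreal (integral S f)"
    using set_lebesgue_integral_eq_integral(2)[OF f] by (simp add: set_lebesgue_integral_def)
  finally show ?thesis .
qed

text \<open>The real integrand is passed through \<open>real^1\<close> to match the vector-valued
  change of variables theorem; nonnegativity then turns both sides into
  \<open>nn_integral\<close>.\<close>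

lemma nn_integral_change_of_variables:
  fixes g :: "real^3 \<Rightarrow> real^3" and f :: "real^3 \<Rightarrow> real"
  assumes S: "S \<in> sets lebesgue"
    and der: "\<And>x. x \<in> S \<Longrightarrow> (g has_derivative g' x) (at x within S)" and inj: "inj_on g S"
    and f: "integrable lebesgue f" and f0: "\<And>x. 0 \<le> f x"
  shows "g ` S \<in> sets lebesgue"
    and "(\<integral>\<^sup>+x. ennreal (\<bar>det (matrix (g' x))\<bar> * f (g x)) * indicator S x \<partial>lebesgue)
      = (\<integral>\<^sup>+y. ennreal (f y) * indicator (g ` S) y \<partial>lebesgue)"
proof -
  show im: "g ` S \<in> sets lebesgue"
    by (rule differentiable_image_in_sets_lebesgue[OF S]) (use der in \<open>auto simp: differentiable_on_def differentiable_def\<close>)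
  have fi: "f absolutely_integrable_on g ` S"
    unfolding set_integrable_def using im f by (rule integrable_mult_indicator)
  define b where "b = integral (g ` S) f"
  have "(\<lambda>x. vec (f x) :: real^1) absolutely_integrable_on g ` S \<and> integral (g ` S) (\<lambda>x. vec (f x)) = (vec b :: real^1)"
    using fi by (simp add: absolutely_integrable_on_1_iff integral_on_1_eq b_def)
  then have "(\<lambda>x. \<bar>det (matrix (g' x))\<bar> *\<^sub>R (vec (f (g x)) :: real^1)) absolutely_integrable_on S \<and>
      integral S (\<lambda>x. \<bar>det (matrix (g' x))\<bar> *\<^sub>R (vec (f (g x)) :: real^1)) = vec b"
    using has_absolute_integral_change_of_variables[OF S der inj, of "\<lambda>x. vec (f x) :: real^1" "vec b"] by blast
  then have 1: "(\<lambda>x. \<bar>det (matrix (g' x))\<bar> * f (g x)) absolutely_integrable_on S"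
    and 2: "integral S (\<lambda>x. \<bar>det (matrix (g' x))\<bar> * f (g x)) = b"
    by (auto simp: absolutely_integrable_on_1_iff integral_on_1_eq vec_eq_iff)
  show "(\<integral>\<^sup>+x. ennreal (\<bar>det (matrix (g' x))\<bar> * f (g x)) * indicator S x \<partial>lebesgue)
      = (\<integral>\<^sup>+y. ennreal (f y) * indicator (g ` S) y \<partial>lebesgue)"
    using nn_integral_absolutely_integrable[OF 1] nn_integral_absolutely_integrable[OF fi] f0
    by (simp add: 2 b_def)
qed

lemma det_matrix_columns:
  fixes A :: "real^3 \<Rightarrow> real^3"
  shows "det (matrix A) = cross3 (A (axis 1 1)) (A (axis 2 1)) \<bullet> A (axis 3 1)"
  by (simp add: matrix_def det_3 cross3_def inner_vec_def sum_3 algebra_simps)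

definition proj3 :: "real^3 \<Rightarrow> real^2" where
  "proj3 v = vector [v$1, v$2]"

lemma proj3_join3 [simp]: "proj3 (join3 u t) = u"
  by (simp add: proj3_def vec_eq_iff forall_2)

lemma bounded_linear_proj3: "bounded_linear proj3"
  by (intro linear_conv_bounded_linear[THEN iffD1] linearI) (simp_all add: proj3_def vec_eq_iff forall_2)

lemma proj3_axis: "proj3 (axis 1 1) = axis 1 1" "proj3 (axis 2 1) = axis 2 1" "proj3 (axis 3 1) = 0"
  by (simp_all add: proj3_def vec_eq_iff forall_2 axis_def)

lemma proj3_measurable [measurable]: "proj3 \<in> borel_measurable borel"
  by (intro borel_measurable_continuous_onI linear_continuous_on bounded_linear_proj3)

text \<open>Cone coordinates with apex \<open>x\<close>: \<open>proj3 v\<close> selects a point of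
  the patch, and the third coordinate stretches the ray through it, the patch itself being at
  parameter 1.\<close>

definition cone_map :: "(real^2 \<Rightarrow> real^3) \<Rightarrow> real^3 \<Rightarrow> real^3 \<Rightarrow> real^3" where
  "cone_map \<gamma> x v = x + (v$3) *\<^sub>R (\<gamma> (proj3 v) - x)"

text \<open>Parameters from 1 on: the image under \<open>cone_map\<close> is the shadow that the
  patch casts for a light source at \<open>x\<close>.\<close>

definition cone_domain :: "(real^2) set \<Rightarrow> (real^3) set" where
  "cone_domain E = {v. proj3 v \<in> E \<and> 1 \<le> v$3}"

lemma cone_map_derivative:
  assumes "(\<gamma> has_derivative \<gamma>') (at (proj3 v))"
  shows "(cone_map \<gamma> x has_derivative (\<lambda>h. (v$3) *\<^sub>R \<gamma>' (proj3 h) + (h$3) *\<^sub>R (\<gamma> (proj3 v) - x))) (at v)"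
proof -
  have 1: "(proj3 has_derivative proj3) (at v)"
    by (rule bounded_linear_imp_has_derivative[OF bounded_linear_proj3])
  have 2: "((\<lambda>v. \<gamma> (proj3 v)) has_derivative (\<lambda>h. \<gamma>' (proj3 h))) (at v)"
    using diff_chain_at[OF 1 assms] by (simp add: o_def)
  have 3: "((\<lambda>v::real^3. v$3) has_derivative (\<lambda>h. h$3)) (at v)"
    by (rule bounded_linear_imp_has_derivative[OF bounded_linear_vec_nth])
  show ?thesis
    unfolding cone_map_def[abs_def]
    by (rule derivative_eq_intros 2 3 refl)+ simp
qed

text \<open>The columns are \<open>t\<close> times the two tangent vectors and the ray direction
  \<open>d\<close>, so the determinant is a triple product.\<close>

lemma cone_map_det:
  assumes lin: "linear \<gamma>'"
  shows "det (matrix (\<lambda>h::real^3. t *\<^sub>R \<gamma>' (proj3 h) + (h$3) *\<^sub>R d))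
    = t\<^sup>2 * (cross3 (\<gamma>' (axis 1 1)) (\<gamma>' (axis 2 1)) \<bullet> d)"
  using linear_0[OF lin] unfolding det_matrix_columns proj3_axis
  by (simp add: axis_def cross_mult_left cross_mult_right power2_eq_square)

text \<open>The part of \<open>\<beta> exp (- \<beta> r)\<close> beyond distance \<open>R\<close> on
  a ray, with \<open>a = \<beta> R\<close> and lengths measured in units of
  \<open>R\<close>.\<close>

lemma nn_integral_exp_ray:
  assumes "0 < a"
  shows "(\<integral>\<^sup>+t. ennreal (a * exp (- a * t)) * indicator {1..} t \<partial>lborel) = ennreal (exp (- a))"
proof -
  have "(\<integral>\<^sup>+t. ennreal (a * exp (- a * t)) * indicator {1..} t \<partial>lborel) = ennreal (0 - (- exp (- a * 1)))"
  proof (rule nn_integral_FTC_atLeast)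
    show "DERIV (\<lambda>t. - exp (- a * t)) t :> a * exp (- a * t)" for t
      by (auto intro!: derivative_eq_intros)
    have "((\<lambda>s. (a * s + (0 + 1)) * exp (- a * s) - (a * s + 0) * exp (- a * s)) \<longlongrightarrow> 0 - 0) at_top"
      using assms by (intro tendsto_diff exp_tendsto_lin)
    then have "((\<lambda>s. exp (- a * s)) \<longlongrightarrow> 0) at_top" by (simp add: algebra_simps)
    then show "((\<lambda>t. - exp (- a * t)) \<longlongrightarrow> 0) at_top" using tendsto_minus by fastforce
  qed (use assms in auto)
  then show ?thesis by simp
qed

text \<open>Along each ray the factor \<open>t\<^sup>2\<close> of the Jacobian cancels the inverse
  square in \<open>decay\<close>, \<open>c\<close> is constant, and integration over
  \<open>t \<ge> 1\<close> leaves the attenuation at the patch.\<close>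

lemma cone_integral:
  fixes \<gamma> :: "real^2 \<Rightarrow> real^3" and c :: "real^3 \<Rightarrow> real" and x :: "real^3" and \<beta> :: real
  defines "f \<equiv> \<lambda>y. decay \<beta> (y - x) * c (y - x)"
  assumes E [measurable]: "E \<in> sets borel"
    and der: "\<And>u. u \<in> E \<Longrightarrow> (\<gamma> has_derivative \<gamma>' u) (at u)"
    and gm: "(\<lambda>u. indicator E u *\<^sub>R \<gamma> u) \<in> borel_measurable borel"
    and Jm: "(\<lambda>u. indicator E u *\<^sub>R J u) \<in> borel_measurable borel"
    and J: "\<And>u. u \<in> E \<Longrightarrow> J u = cross3 (\<gamma>' u (axis 1 1)) (\<gamma>' u (axis 2 1))"
    and ne: "\<And>u. u \<in> E \<Longrightarrow> \<gamma> u \<noteq> x"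
    and c [measurable]: "c \<in> borel_measurable borel" and c0: "\<And>z. 0 \<le> c z"
    and hom: "\<And>t z. 0 < t \<Longrightarrow> c (t *\<^sub>R z) = c z"
    and \<beta>: "0 < \<beta>"
    and inj: "inj_on (cone_map \<gamma> x) (cone_domain E)"
    and f: "integrable lebesgue f"
  shows "cone_map \<gamma> x ` cone_domain E \<in> sets lebesgue"
    and "(\<integral>\<^sup>+u. ennreal (exp (- \<beta> * norm (\<gamma> u - x)) * c (\<gamma> u - x) * \<bar>J u \<bullet> (\<gamma> u - x)\<bar> / norm (\<gamma> u - x) ^ 3)
        * indicator E u \<partial>lborel)
      = (\<integral>\<^sup>+y. ennreal (f y) * indicator (cone_map \<gamma> x ` cone_domain E) y \<partial>lebesgue)"
proof -
  let ?C = "\<lambda>u. ennreal (exp (- \<beta> * norm (\<gamma> u - x)) * c (\<gamma> u - x) * \<bar>J u \<bullet> (\<gamma> u - x)\<bar> / norm (\<gamma> u - x) ^ 3)"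
  define g' where "g' v h = (v$3) *\<^sub>R \<gamma>' (proj3 v) (proj3 h) + (h$3) *\<^sub>R (\<gamma> (proj3 v) - x)" for v h :: "real^3"
  have S: "cone_domain E \<in> sets borel"
    unfolding cone_domain_def by measurable
  have S': "cone_domain E \<in> sets lebesgue" using S by simp
  have d: "(cone_map \<gamma> x has_derivative g' v) (at v within cone_domain E)" if "v \<in> cone_domain E" for v
    using cone_map_derivative[OF der, of v x] that unfolding g'_def[abs_def]
    by (auto simp: cone_domain_def intro: has_derivative_at_withinI)
  have f0: "0 \<le> f y" for y using c0 \<beta> by (simp add: f_def)
  note cov = nn_integral_change_of_variables[OF S' d inj f f0]
  show "cone_map \<gamma> x ` cone_domain E \<in> sets lebesgue" by (rule cov(1))
  \<comment> \<open>\<open>\<gamma>\<close> and \<open>J\<close> are controlled only on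
    \<open>E\<close>; the extensions by 0 are measurable on the whole plane.\<close>
  define \<gamma>0 where "\<gamma>0 u = indicator E u *\<^sub>R \<gamma> u" for u
  define J0 where "J0 u = indicator E u *\<^sub>R J u" for u
  have [measurable]: "\<gamma>0 \<in> borel_measurable borel" "J0 \<in> borel_measurable borel"
    using gm Jm by (simp_all add: \<gamma>0_def[abs_def] J0_def[abs_def])
  have [measurable]: "f \<in> borel_measurable borel" unfolding f_def by measurable
  define h where "h v = ennreal ((v$3)\<^sup>2 * \<bar>J0 (proj3 v) \<bullet> (\<gamma>0 (proj3 v) - x)\<bar> * f (x + (v$3) *\<^sub>R (\<gamma>0 (proj3 v) - x)))
     * indicator E (proj3 v) * indicator {1..} (v$3)" for v :: "real^3"
  have [measurable]: "h \<in> borel_measurable borel" unfolding h_def by measurable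
  have "(\<integral>\<^sup>+y. ennreal (f y) * indicator (cone_map \<gamma> x ` cone_domain E) y \<partial>lebesgue)
      = (\<integral>\<^sup>+v. ennreal (\<bar>det (matrix (g' v))\<bar> * f (cone_map \<gamma> x v)) * indicator (cone_domain E) v \<partial>lebesgue)"
    by (rule cov(2)[symmetric])
  also have "\<dots> = nn_integral lebesgue h"
  proof (rule nn_integral_cong)
    fix v :: "real^3"
    show "ennreal (\<bar>det (matrix (g' v))\<bar> * f (cone_map \<gamma> x v)) * indicator (cone_domain E) v = h v"
    proof (cases "proj3 v \<in> E \<and> 1 \<le> v$3")
      case True
      then have lin: "linear (\<gamma>' (proj3 v))" using der has_derivative_linear by blast
      have "\<bar>det (matrix (g' v))\<bar> = (v$3)\<^sup>2 * \<bar>J (proj3 v) \<bullet> (\<gamma> (proj3 v) - x)\<bar>"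
        unfolding g'_def[abs_def] cone_map_det[OF lin] using True J by (simp add: abs_mult)
      then show ?thesis using True by (simp add: h_def cone_domain_def cone_map_def \<gamma>0_def J0_def)
    next
      case False
      then show ?thesis by (auto simp: h_def cone_domain_def)
    qed
  qed
  also have "\<dots> = nn_integral lborel h" by (rule nn_integral_completion)
  also have "\<dots> = (\<integral>\<^sup>+u. \<integral>\<^sup>+t. h (join3 u t) \<partial>lborel \<partial>lborel)"
    by (rule nn_integral_join3) measurable
  also have "\<dots> = (\<integral>\<^sup>+u. ?C u
        * indicator E u \<partial>lborel)"
  proof (intro nn_integral_cong)
    fix u
    show "(\<integral>\<^sup>+t. h (join3 u t) \<partial>lborel) = ?C u
        * indicator E u"
    proof (cases "u \<in> E")
      case True
      define R where "R = norm (\<gamma> u - x)"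
      have R: "0 < R" using ne[OF True] by (simp add: R_def)
      define K where "K = \<bar>J u \<bullet> (\<gamma> u - x)\<bar> * c (\<gamma> u - x) / R ^ 3"
      have K: "0 \<le> K" using R c0 by (simp add: K_def)
      have "h (join3 u t) = ennreal K * (ennreal ((\<beta> * R) * exp (- (\<beta> * R) * t)) * indicator {1..} t)" for t
      proof (cases "1 \<le> t")
        case t: True
        have "t\<^sup>2 * \<bar>J u \<bullet> (\<gamma> u - x)\<bar> * f (x + t *\<^sub>R (\<gamma> u - x))
            = t\<^sup>2 * \<bar>J u \<bullet> (\<gamma> u - x)\<bar> * (\<beta> * exp (- \<beta> * (t * R)) / (t * R)\<^sup>2 * c (\<gamma> u - x))"
          using t hom[of t "\<gamma> u - x"] by (simp add: f_def R_def)
        also have "\<dots> = K * ((\<beta> * R) * exp (- (\<beta> * R) * t))"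
          using t R by (simp add: K_def power2_eq_square power3_eq_cube field_simps)
        finally show ?thesis
          using True t K by (simp add: h_def \<gamma>0_def J0_def ennreal_mult')
      qed (simp add: h_def)
      then have "(\<integral>\<^sup>+t. h (join3 u t) \<partial>lborel) = (\<integral>\<^sup>+t. ennreal K * (ennreal ((\<beta> * R) * exp (- (\<beta> * R) * t)) * indicator {1..} t) \<partial>lborel)"
        by simp
      also have "\<dots> = ennreal K * ennreal (exp (- (\<beta> * R)))"
        using nn_integral_exp_ray[of "\<beta> * R"] \<beta> R by (subst nn_integral_cmult) auto
      also have "\<dots> = ennreal (K * exp (- (\<beta> * R)))" using K by (simp add: ennreal_mult')
      also have "K * exp (- (\<beta> * R)) = exp (- \<beta> * norm (\<gamma> u - x)) * c (\<gamma> u - x) * \<bar>J u \<bullet> (\<gamma> u - x)\<bar> / norm (\<gamma> u - x) ^ 3"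
        by (simp add: K_def R_def)
      finally show ?thesis using True by simp
    qed (simp add: h_def)
  qed
  finally show "(\<integral>\<^sup>+u. ?C u
        * indicator E u \<partial>lborel)
      = (\<integral>\<^sup>+y. ennreal (f y) * indicator (cone_map \<gamma> x ` cone_domain E) y \<partial>lebesgue)" by simp
qed

text \<open>Of two boundary points on one ray the nearer would lie on the open segment to the
  farther, hence in \<open>V\<close>. So a point of space is in the shadow of at most one visible
  boundary point.\<close>

lemma visible_boundary_unique:
  fixes V :: "(real^3) set"
  assumes V: "open V" and y: "y \<in> frontier V" "y \<noteq> x" "open_segment x y \<subseteq> V"
    and y': "y' \<in> frontier V" "y' \<noteq> x" "open_segment x y' \<subseteq> V"
    and t: "1 \<le> t" "1 \<le> t'" and eq: "x + t *\<^sub>R (y - x) = x + t' *\<^sub>R (y' - x)"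
  shows "y = y' \<and> t = t'"
proof -
  have aux: "\<not> a < b" if "z \<in> frontier V" "z \<noteq> x" "z' \<in> frontier V" "open_segment x z \<subseteq> V" "1 \<le> a" "1 \<le> b"
    "a *\<^sub>R (z - x) = b *\<^sub>R (z' - x)" for a b :: real and z z'
  proof
    assume ab: "a < b"
    have "(1 / b) *\<^sub>R (a *\<^sub>R (z - x)) = (1 / b) *\<^sub>R (b *\<^sub>R (z' - x))"
      using that(7) by (simp only:)
    then have "z' - x = (a / b) *\<^sub>R (z - x)" using that(6) by simp
    then have "z' = (1 - a / b) *\<^sub>R x + (a / b) *\<^sub>R z" by (simp add: algebra_simps)
    moreover have "0 < a / b" "a / b < 1" using that ab by auto
    ultimately have "z' \<in> open_segment x z" using that(2) unfolding in_segment by blast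
    then show False using that frontier_open_disjoint[OF V] by blast
  qed
  have eq': "t *\<^sub>R (y - x) = t' *\<^sub>R (y' - x)" using eq by simp
  have tt: "t = t'"
    using aux[OF y(1,2) y'(1) y(3) t eq'] aux[OF y'(1,2) y(1) y'(3) t(2,1) eq'[symmetric]] by simp
  then show ?thesis using eq' t by simp
qed

lemma nn_integral_translate:
  fixes f :: "real^3 \<Rightarrow> ennreal"
  assumes [measurable]: "f \<in> borel_measurable borel"
  shows "(\<integral>\<^sup>+y. f (y - x) \<partial>lborel) = nn_integral lborel f"
proof -
  have "nn_integral lborel f = (\<integral>\<^sup>+z. f z \<partial>distr lborel borel ((+) (- x)))"
    by (simp only: lborel_distr_plus)
  also have "\<dots> = (\<integral>\<^sup>+y. f (- x + y) \<partial>lborel)" by (intro nn_integral_distr) measurable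
  finally show ?thesis by simp
qed

text \<open>
  Prolonging each ray from \<open>x\<close> beyond its visible boundary point, where \<open>exp (- \<beta> R)\<close> is the
  integral of \<open>\<beta> exp (- \<beta> t)\<close> over \<open>t \<ge> R\<close>, turns the surface integral into a volume integral
  over the shadow of the boundary. The shadow is disjoint from the visible part of \<open>V\<close>.
\<close>

lemma shadow_bound:
  fixes V :: "(real^3) set" and c :: "real^3 \<Rightarrow> real" and x :: "real^3" and \<beta> Q :: real
  assumes V: "open V" and ps: "piecewise_smooth_boundary V P"
    and c [measurable]: "c \<in> borel_measurable borel" and c0: "\<And>z. 0 \<le> c z"
    and hom: "\<And>t z. 0 < t \<Longrightarrow> c (t *\<^sub>R z) = c z"
    and \<beta>: "0 < \<beta>"
    and Q: "(\<integral>\<^sup>+z. ennreal (decay \<beta> z * c z) \<partial>lborel) = ennreal Q"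
  shows "(\<integral>\<^sup>+y. ennreal (exp (- \<beta> * norm (y - x)) * c (y - x) * (max 0 (cos_angle V y x) / norm (y - x) ^ 2) * visibility V x y) \<partial>surface_measure P)
    + (\<integral>\<^sup>+y. ennreal (decay \<beta> (y - x) * c (y - x) * visibility V x y) * indicator V y \<partial>lborel)
    \<le> ennreal Q"
proof -
  note fin = piecewise_smoothD(1)[OF ps] and patch = piecewise_smoothD(3)[OF ps]
    and sm = piecewise_smoothD(4)[OF ps] and disj = piecewise_smoothD(5)[OF ps]
  define f where "f y = decay \<beta> (y - x) * c (y - x)" for y :: "real^3"
  have fm [measurable]: "f \<in> borel_measurable borel" unfolding f_def by measurable
  have f0: "0 \<le> f y" for y using c0 \<beta> by (simp add: f_def)
  have fint: "(\<integral>\<^sup>+y. ennreal (f y) \<partial>lborel) = ennreal Q"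
    using nn_integral_translate[of "\<lambda>z. ennreal (decay \<beta> z * c z)" x] Q
    by (simp add: f_def)
  have "integrable lborel f"
    using fint f0 by (intro integrableI_nonneg) auto
  then have fleb: "integrable lebesgue f" by (simp add: integrable_completion)
  have vis [measurable]: "visibility V x \<in> borel_measurable borel"
    by (rule visibility_section[OF V])
  have cosm [measurable]: "(\<lambda>y. cos_angle V y x) \<in> borel_measurable borel"
    unfolding cos_angle_def by measurable
  \<comment> \<open>The surface points at which the integrand \<open>G\<close> can be nonzero; at
    \<open>y = x\<close> it vanishes by the convention for division by zero.\<close>
  define B where "B = {y. y \<noteq> x \<and> visibility V x y = 1 \<and> 0 < cos_angle V y x}"
  have B: "B \<in> sets borel" unfolding B_def by measurable
  define E where "E p = interior (fst p) \<inter> {u. snd p u \<in> B}" for p :: patch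
  define I where "I p = cone_map (snd p) x ` cone_domain (E p)" for p :: patch
  define G where "G y = exp (- \<beta> * norm (y - x)) * c (y - x) * (max 0 (cos_angle V y x) / norm (y - x) ^ 2) * visibility V x y" for y
  let ?L = "\<lambda>p u. ennreal (area_element (snd p) u) * ennreal (G (snd p u)) * indicator (interior (fst p)) u"
  have Gm: "G \<in> borel_measurable borel" unfolding G_def by measurable
  have E_in: "u \<in> interior (fst p)" "snd p u \<in> frontier V" "snd p u \<noteq> x" "open_segment x (snd p u) \<subseteq> V"
    "0 < cos_angle V (snd p u) x" "snd p u \<in> smooth_boundary_points V"
    if "p \<in> P" "u \<in> E p" for p u
  proof -
    show u: "u \<in> interior (fst p)" using that by (simp add: E_def)
    then show s: "snd p u \<in> smooth_boundary_points V" using sm[of "fst p" "snd p"] that by auto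
    then show "snd p u \<in> frontier V" using smooth_boundary_subset by blast
    have "snd p u \<in> B" using that by (simp add: E_def)
    then show "snd p u \<noteq> x" "open_segment x (snd p u) \<subseteq> V" "0 < cos_angle V (snd p u) x"
      by (auto simp: B_def visibility_def split: if_splits)
  qed
  \<comment> \<open>Injectivity on the union of all cones: it yields injectivity of each cone map
    and disjointness of the shadows of different patches.\<close>
  have uniq: "p = p' \<and> v = v'"
    if "p \<in> P" "p' \<in> P" "v \<in> cone_domain (E p)" "v' \<in> cone_domain (E p')" "cone_map (snd p) x v = cone_map (snd p') x v'" for p p' v v'
  proof -
    have e: "proj3 v \<in> E p" "proj3 v' \<in> E p'" "1 \<le> v$3" "1 \<le> v'$3"
      using that by (auto simp: cone_domain_def)
    have *: "snd p (proj3 v) = snd p' (proj3 v') \<and> v$3 = v'$3"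
      using visible_boundary_unique[OF V E_in(2-4)[OF that(1) e(1)] E_in(2-4)[OF that(2) e(2)] e(3,4)] that(5)
      by (simp add: cone_map_def)
    have pp: "p = p'"
    proof (rule ccontr)
      assume "p \<noteq> p'"
      then have "snd p ` interior (fst p) \<inter> snd p' ` interior (fst p') = {}"
        using disj that by (auto simp: disjoint_family_on_def case_prod_beta)
      then show False using * E_in(1)[OF that(1) e(1)] E_in(1)[OF that(2) e(2)] by auto
    qed
    have "inj_on (snd p) (interior (fst p))"
      using patch[of "fst p" "snd p"] that(1) by (simp add: smooth_patch_def)
    then have "proj3 v = proj3 v'"
      using * E_in(1)[OF that(1) e(1)] E_in(1)[OF that(2) e(2)] unfolding pp by (auto dest: inj_onD)
    then have "v = v'" using * by (simp add: proj3_def vec_eq_iff forall_2 forall_3)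
    then show ?thesis using pp by simp
  qed
  have cone: "I p \<in> sets lebesgue \<and> (\<integral>\<^sup>+u. ?L p u \<partial>lborel)
      = (\<integral>\<^sup>+y. ennreal (f y) * indicator (I p) y \<partial>lebesgue)" if p: "p \<in> P" for p
  proof -
    have sp: "smooth_patch (fst p) (snd p)" using patch[of "fst p" "snd p"] p by simp
    have smp: "snd p ` interior (fst p) \<subseteq> smooth_boundary_points V" using sm[of "fst p" "snd p"] p by simp
    obtain \<gamma>' :: "real^2 \<Rightarrow> (real^2, real^3) blinfun" where g: "continuous_on (fst p) \<gamma>'"
      "\<forall>u\<in>fst p. (snd p has_derivative blinfun_apply (\<gamma>' u)) (at u)"
      "\<forall>u\<in>fst p. tangent_cross (snd p) u = cross3 (\<gamma>' u (axis 1 1)) (\<gamma>' u (axis 2 1))"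
      by (rule smooth_patch_derivative[OF sp])
    let ?K = "\<lambda>u. ennreal (exp (- \<beta> * norm (snd p u - x)) * c (snd p u - x) * \<bar>tangent_cross (snd p) u \<bullet> (snd p u - x)\<bar> / norm (snd p u - x) ^ 3)"
    have int: "interior (fst p) \<in> sets borel" by simp
    define \<gamma>0 where "\<gamma>0 u = indicator (interior (fst p)) u *\<^sub>R snd p u" for u
    define J0 where "J0 u = indicator (interior (fst p)) u *\<^sub>R tangent_cross (snd p) u" for u
    have m0 [measurable]: "\<gamma>0 \<in> borel_measurable borel" "J0 \<in> borel_measurable borel"
      unfolding \<gamma>0_def[abs_def] J0_def[abs_def]
      by (intro borel_measurable_continuous_on_indicator int
          continuous_on_subset[OF area_element_continuous_on(2)[OF sp] interior_subset]
          continuous_on_subset[OF continuous_on_tangent_cross[OF sp] interior_subset])+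
    have Eeq: "E p = interior (fst p) \<inter> (\<gamma>0 -` B \<inter> space borel)"
      by (auto simp: E_def \<gamma>0_def)
    have Em [measurable]: "E p \<in> sets borel"
      unfolding Eeq by (intro sets.Int int measurable_sets[OF m0(1) B])
    have "(\<lambda>u. indicator (E p) u *\<^sub>R \<gamma>0 u) \<in> borel_measurable borel" by measurable
    also have "(\<lambda>u. indicator (E p) u *\<^sub>R \<gamma>0 u) = (\<lambda>u. indicator (E p) u *\<^sub>R snd p u)"
      by (auto simp: fun_eq_iff \<gamma>0_def E_def split: split_indicator)
    finally have gm: "(\<lambda>u. indicator (E p) u *\<^sub>R snd p u) \<in> borel_measurable borel" .
    have "(\<lambda>u. indicator (E p) u *\<^sub>R J0 u) \<in> borel_measurable borel" by measurable
    also have "(\<lambda>u. indicator (E p) u *\<^sub>R J0 u) = (\<lambda>u. indicator (E p) u *\<^sub>R tangent_cross (snd p) u)"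
      by (auto simp: fun_eq_iff J0_def E_def split: split_indicator)
    finally have Jm: "(\<lambda>u. indicator (E p) u *\<^sub>R tangent_cross (snd p) u) \<in> borel_measurable borel" .
    have ED: "u \<in> fst p" if "u \<in> E p" for u using E_in(1)[OF p that] interior_subset by blast
    have inj: "inj_on (cone_map (snd p) x) (cone_domain (E p))"
      using uniq[OF p p] by (intro inj_onI) blast
    have g1: "(snd p has_derivative blinfun_apply (\<gamma>' u)) (at u)"
      and g2: "tangent_cross (snd p) u = cross3 (\<gamma>' u (axis 1 1)) (\<gamma>' u (axis 2 1))" if "u \<in> E p" for u
      using g ED[OF that] by blast+
    note ci = cone_integral[of "E p" "snd p" "\<lambda>u. blinfun_apply (\<gamma>' u)" "tangent_cross (snd p)" x c \<beta>,
        OF Em g1 gm Jm g2 E_in(3)[OF p] c c0 hom \<beta> inj fleb[unfolded f_def]]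
    have ci1: "I p \<in> sets lebesgue"
      unfolding I_def by (rule ci(1))
    have ci2: "(\<integral>\<^sup>+u. ?K u
        * indicator (E p) u \<partial>lborel) = (\<integral>\<^sup>+y. ennreal (f y) * indicator (I p) y \<partial>lebesgue)"
      unfolding I_def f_def by (rule ci(2))
    have "(\<integral>\<^sup>+u. ?L p u \<partial>lborel)
      = (\<integral>\<^sup>+u. ?K u
        * indicator (E p) u \<partial>lborel)"
    proof (intro nn_integral_cong)
      fix u
      show "?L p u
        = ?K u
        * indicator (E p) u"
      proof (cases "u \<in> E p")
        case True
        note e = E_in[OF p True]
        let ?y = "snd p u"
        have R: "0 < norm (?y - x)" using e(3) by simp
        have "0 < (?y - x) \<bullet> outward_normal V ?y"
          using e(5) R by (simp add: cos_angle_def zero_less_divide_iff)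
        \<comment> \<open>The factor \<open>norm (?y - x)\<close> gained here reduces the cube in
          \<open>cone_integral\<close> to the square in \<open>G\<close>.\<close>
        then have "\<bar>tangent_cross (snd p) u \<bullet> (?y - x)\<bar> = area_element (snd p) u * (cos_angle V ?y x * norm (?y - x))"
          unfolding area_element_inner_normal[OF sp smp e(1)] using R by (simp add: cos_angle_def)
        then have "exp (- \<beta> * norm (?y - x)) * c (?y - x) * \<bar>tangent_cross (snd p) u \<bullet> (?y - x)\<bar> / norm (?y - x) ^ 3
          = area_element (snd p) u * G ?y"
          using e(4,5) R by (simp add: G_def visibility_def power2_eq_square power3_eq_cube field_simps)
        moreover have "ennreal (area_element (snd p) u) * ennreal (G ?y) = ennreal (area_element (snd p) u * G ?y)"
          by (rule ennreal_mult'[symmetric]) (simp add: area_element_eq)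
        ultimately show ?thesis using True e(1) by simp
      next
        case False
        show ?thesis
        proof (cases "u \<in> interior (fst p)")
          case True
          then have "snd p u \<notin> B" using False by (simp add: E_def)
          then have "G (snd p u) = 0" by (auto simp: B_def G_def visibility_def split: if_splits)
          then show ?thesis using False by simp
        qed (use False in simp)
      qed
    qed
    then show ?thesis using ci1 ci2 by simp
  qed
  define A where "A = {y \<in> V. visibility V x y = 1}"
  have A: "A \<in> sets borel" 
  proof -
    have "{y. visibility V x y = 1} \<in> sets borel" by measurable
    moreover have "A = V \<inter> {y. visibility V x y = 1}" by (auto simp: A_def)
    ultimately show ?thesis using V by simp
  qed
  \<comment> \<open>The boundary point \<open>s\<close> casting the shadow is either
    \<open>y\<close> itself or on the open segment from \<open>x\<close> to \<open>y\<close>. Both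
    contradict \<open>y \<in> A\<close>, since the boundary does not meet \<open>V\<close>.\<close>
  have AI: "y \<notin> A" if pI: "p \<in> P" "y \<in> I p" for p y
  proof
    assume y: "y \<in> A"
    obtain v where v: "v \<in> cone_domain (E p)" "y = cone_map (snd p) x v" using pI by (auto simp: I_def)
    define s where "s = snd p (proj3 v)"
    have e: "s \<in> frontier V" "s \<noteq> x" "1 \<le> v$3"
      using v(1) E_in[OF pI(1)] by (auto simp: cone_domain_def s_def)
    have ys: "y = x + (v$3) *\<^sub>R (s - x)" by (simp add: v(2) cone_map_def s_def)
    show False
    proof (cases "v$3 = 1")
      case True
      then have "y = s" using ys by simp
      then show False using y e(1) frontier_open_disjoint[OF V] by (auto simp: A_def)
    next
      case False
      have "s = (1 - 1 / v$3) *\<^sub>R x + (1 / v$3) *\<^sub>R y"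
        using e(3) unfolding ys by (simp add: algebra_simps)
      moreover have "0 < 1 / v$3" "1 / v$3 < 1" using e(3) False by auto
      moreover have "x \<noteq> y" using ys e by auto
      ultimately have "s \<in> open_segment x y" unfolding in_segment by blast
      then show False using y e(1) frontier_open_disjoint[OF V]
        by (auto simp: A_def visibility_def split: if_splits)
    qed
  qed
  have I_disj: "I p \<inter> I p' = {}" if "p \<in> P" "p' \<in> P" "p \<noteq> p'" for p p'
    using uniq[OF that(1,2)] that(3) by (auto simp: I_def)
  have flm: "(\<lambda>y. ennreal (f y)) \<in> borel_measurable lebesgue"
    using fm by (intro measurable_completion) simp
  have "(\<integral>\<^sup>+y. ennreal (G y) \<partial>surface_measure P) = (\<Sum>p\<in>P. \<integral>\<^sup>+y. ennreal (f y) * indicator (I p) y \<partial>lebesgue)"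
    using cone Gm by (subst nn_integral_surface_measure[OF fin patch]) (auto intro!: sum.cong simp: case_prod_beta)
  also have "\<dots> = (\<integral>\<^sup>+y. (\<Sum>p\<in>P. ennreal (f y) * indicator (I p) y) \<partial>lebesgue)"
    using cone flm by (intro nn_integral_sum[symmetric] borel_measurable_times_ennreal borel_measurable_indicator) auto
  finally have S: "(\<integral>\<^sup>+y. ennreal (G y) \<partial>surface_measure P) = (\<integral>\<^sup>+y. (\<Sum>p\<in>P. ennreal (f y) * indicator (I p) y) \<partial>lebesgue)" .
  have "(\<integral>\<^sup>+y. ennreal (f y * visibility V x y) * indicator V y \<partial>lborel) = (\<integral>\<^sup>+y. ennreal (f y) * indicator A y \<partial>lborel)"
    by (intro nn_integral_cong) (auto simp: A_def visibility_def split: split_indicator)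
  also have "\<dots> = (\<integral>\<^sup>+y. ennreal (f y) * indicator A y \<partial>lebesgue)" by (rule nn_integral_completion[symmetric])
  finally have W: "(\<integral>\<^sup>+y. ennreal (f y * visibility V x y) * indicator V y \<partial>lborel) = (\<integral>\<^sup>+y. ennreal (f y) * indicator A y \<partial>lebesgue)" .
  have "(\<integral>\<^sup>+y. ennreal (G y) \<partial>surface_measure P) + (\<integral>\<^sup>+y. ennreal (f y * visibility V x y) * indicator V y \<partial>lborel)
      = (\<integral>\<^sup>+y. (\<Sum>p\<in>P. ennreal (f y) * indicator (I p) y) + ennreal (f y) * indicator A y \<partial>lebesgue)"
    unfolding S W using cone flm A
    by (intro nn_integral_add[symmetric] borel_measurable_sum borel_measurable_times_ennreal borel_measurable_indicator) auto
  also have "\<dots> \<le> (\<integral>\<^sup>+y. ennreal (f y) \<partial>lebesgue)"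
  proof (intro nn_integral_mono)
    fix y
    show "(\<Sum>p\<in>P. ennreal (f y) * indicator (I p) y) + ennreal (f y) * indicator A y \<le> ennreal (f y)"
    proof (cases "\<exists>p\<in>P. y \<in> I p")
      case True
      then obtain p where p: "p \<in> P" "y \<in> I p" by blast
      have "(\<Sum>q\<in>P. ennreal (f y) * indicator (I q) y) = (\<Sum>q\<in>P. if q = p then ennreal (f y) else 0)"
      proof (intro sum.cong refl)
        fix q assume q: "q \<in> P"
        have "y \<notin> I q" if "q \<noteq> p" using I_disj[OF q p(1) that] p(2) by blast
        then show "ennreal (f y) * indicator (I q) y = (if q = p then ennreal (f y) else 0)"
          using p(2) by (cases "q = p") simp_all
      qed
      then show ?thesis using p fin AI[OF p] by simp
    next
      case False
      then have "(\<Sum>p\<in>P. ennreal (f y) * indicator (I p) y) = 0" by (intro sum.neutral) auto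
      then show ?thesis by (auto split: split_indicator)
    qed
  qed
  also have "\<dots> = ennreal Q" unfolding nn_integral_completion by (rule fint)
  finally show ?thesis unfolding G_def f_def .
qed

section \<open>Bounds for the visibility integrals\<close>

text \<open>Boundary points contribute a cosine and interior points do not, so one symmetric kernel
  serves all four operators.\<close>

definition cos_factor :: "(real^3) set \<Rightarrow> real^3 \<Rightarrow> real^3 \<Rightarrow> real" where
  "cos_factor V x y = (if x \<in> V then 1 else max 0 (cos_angle V x y))"

definition geo_kernel :: "(real^3) set \<Rightarrow> real \<Rightarrow> real^3 \<Rightarrow> real^3 \<Rightarrow> real" where
  "geo_kernel V \<beta> x y = exp (- \<beta> * norm (x - y)) / norm (x - y) ^ 2 * visibility V x y * (cos_factor V x y * cos_factor V y x)"

lemma geo_kernel_commute: "geo_kernel V \<beta> x y = geo_kernel V \<beta> y x"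
  by (simp add: geo_kernel_def visibility_commute[of V x y] norm_minus_commute[of x y])

lemma geo_kernel_nonneg: "0 \<le> geo_kernel V \<beta> x y"
  by (simp add: geo_kernel_def cos_factor_def visibility_def)

lemma geo_kernel_measurable:
  assumes V: "open V"
  shows "(\<lambda>(x, y). geo_kernel V \<beta> x y) \<in> borel_measurable (borel \<Otimes>\<^sub>M borel)"
proof -
  have [measurable]: "V \<in> sets borel" using V by simp
  have [measurable]: "(\<lambda>p. visibility V (fst p) (snd p)) \<in> borel_measurable (borel \<Otimes>\<^sub>M borel)"
    using visibility_measurable[OF V] by (simp add: borel_prod)
  have [measurable]: "(\<lambda>p. cos_angle V (fst p) (snd p)) \<in> borel_measurable (borel \<Otimes>\<^sub>M borel)"
    "(\<lambda>p. cos_angle V (snd p) (fst p)) \<in> borel_measurable (borel \<Otimes>\<^sub>M borel)"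
    unfolding cos_angle_def by measurable
  show ?thesis
    unfolding geo_kernel_def cos_factor_def case_prod_beta by measurable
qed

text \<open>The integrand is positive on a nonempty open set. Only the half space of positive third
  coordinate is used, so that the cosine weight is covered as well.\<close>

lemma tail_integral_pos:
  fixes c :: "real^3 \<Rightarrow> real"
  assumes [measurable]: "c \<in> borel_measurable borel" and \<beta>: "0 < \<beta>" and D: "0 \<le> D"
    and pos: "\<And>z. z $ 3 > 0 \<Longrightarrow> 0 < c z"
  shows "0 < (\<integral>\<^sup>+z. ennreal (decay \<beta> z * indicator {D<..} (norm z) * c z) \<partial>lborel)"
proof (rule ccontr)
  let ?f = "\<lambda>z. ennreal (decay \<beta> z * indicator {D<..} (norm z) * c z)"
  assume "\<not> 0 < nn_integral lborel ?f"
  then have "nn_integral lborel ?f = 0" by simp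
  then have "AE z in lborel. ?f z = 0"
    by (subst (asm) nn_integral_0_iff_AE) measurable
  moreover define U where "U = {z :: real^3. D < norm z} \<inter> {z. 0 < z $ 3}"
  have "?f z \<noteq> 0" if "z \<in> U" for z
  proof -
    have "0 < norm z" "D < norm z" "0 < c z" using that D pos by (auto simp: U_def)
    then show ?thesis using \<beta> by (simp add: ennreal_eq_0_iff not_le)
  qed
  ultimately have "AE z in lborel. z \<notin> U" by (auto elim!: eventually_mono)
  moreover have U: "open U"
    unfolding U_def by (intro open_Int open_Collect_less continuous_intros)
  ultimately have "U \<in> null_sets lborel"
    by (subst AE_iff_null_sets) auto
  then have "negligible U"
    by (simp add: negligible_iff_null_sets null_sets_completionI)
  moreover have "(D + 1) *\<^sub>R axis 3 1 \<in> U" using D by (simp add: U_def)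
  ultimately show False using open_not_negligible[OF U] by blast
qed

text \<open>All of \<open>V\<close> lies within distance \<open>D\<close> of \<open>x\<close>, so
  the volume integral and the tail beyond \<open>D\<close> come from disjoint parts of
  space.\<close>

lemma volume_tail_bound:
  fixes c :: "real^3 \<Rightarrow> real" and x :: "real^3"
  assumes c [measurable]: "c \<in> borel_measurable borel" and c0: "\<And>z. 0 \<le> c z" and \<beta>: "0 < \<beta>"
    and V: "V \<in> sets borel" and D: "\<And>y. y \<in> V \<Longrightarrow> norm (y - x) \<le> D" and vis: "visibility V x \<in> borel_measurable borel"
  shows "(\<integral>\<^sup>+y. ennreal (decay \<beta> (y - x) * c (y - x) * visibility V x y) * indicator V y \<partial>lborel)
     + (\<integral>\<^sup>+z. ennreal (decay \<beta> z * indicator {D<..} (norm z) * c z) \<partial>lborel)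
     \<le> (\<integral>\<^sup>+z. ennreal (decay \<beta> z * c z) \<partial>lborel)"
proof -
  define f where "f z = decay \<beta> z * c z" for z :: "real^3"
  have fm [measurable]: "f \<in> borel_measurable borel" unfolding f_def by measurable
  have f0: "0 \<le> f z" for z using c0 \<beta> by (simp add: f_def)
  note V[measurable] vis[measurable]
  have t: "(\<integral>\<^sup>+y. ennreal (f (y - x) * indicator {D<..} (norm (y - x))) \<partial>lborel) = (\<integral>\<^sup>+z. ennreal (f z * indicator {D<..} (norm z)) \<partial>lborel)"
    by (rule nn_integral_translate) measurable
  have t': "(\<integral>\<^sup>+y. ennreal (f (y - x)) \<partial>lborel) = (\<integral>\<^sup>+z. ennreal (f z) \<partial>lborel)"
    by (rule nn_integral_translate) measurable
  have "(\<integral>\<^sup>+y. ennreal (f (y - x) * visibility V x y) * indicator V y \<partial>lborel) + (\<integral>\<^sup>+y. ennreal (f (y - x) * indicator {D<..} (norm (y - x))) \<partial>lborel)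
     = (\<integral>\<^sup>+y. ennreal (f (y - x) * visibility V x y) * indicator V y + ennreal (f (y - x) * indicator {D<..} (norm (y - x))) \<partial>lborel)"
    by (intro nn_integral_add[symmetric]) measurable
  also have "\<dots> \<le> (\<integral>\<^sup>+y. ennreal (f (y - x)) \<partial>lborel)"
  proof (intro nn_integral_mono)
    fix y
    show "ennreal (f (y - x) * visibility V x y) * indicator V y + ennreal (f (y - x) * indicator {D<..} (norm (y - x))) \<le> ennreal (f (y - x))"
      using D[of y] by (cases "y \<in> V") (auto simp: visibility_def split: split_indicator)
  qed
  finally show ?thesis unfolding t t' unfolding f_def by (simp add: ac_simps)
qed

lemma half_cos_scale: "0 < t \<Longrightarrow> half_cos m (t *\<^sub>R z) = half_cos m z"
  by (cases "m \<bullet> z \<ge> 0") (simp_all add: half_cos_def max_def zero_le_mult_iff mult_nonneg_nonpos)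

text \<open>\<open>Q\<close> bounds the energy of the whole ray bundle and \<open>R\<close> its
  volume part. Naming the integrals as reals \<open>s\<close> and \<open>v\<close> leaves real
  arithmetic for the estimates that follow.\<close>

abbreviation geo_bound :: "(real^3) set \<Rightarrow> patch set \<Rightarrow> real \<Rightarrow> real^3 \<Rightarrow> real \<Rightarrow> real \<Rightarrow> bool" where
  "geo_bound V P \<beta> x Q R \<equiv> \<exists>s v. (\<integral>\<^sup>+y. ennreal (geo_kernel V \<beta> x y) \<partial>surface_measure P) = ennreal s
    \<and> (\<integral>\<^sup>+y. ennreal (geo_kernel V \<beta> x y) \<partial>volume_measure V) = ennreal v
    \<and> 0 \<le> s \<and> 0 \<le> v \<and> s + \<beta> * v \<le> Q \<and> \<beta> * v \<le> R"

text \<open>One argument for both kinds of points: \<open>c\<close> is 1 for \<open>x\<close> in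
  \<open>V\<close> and \<open>half_cos\<close> for \<open>x\<close> on the boundary. The bound
  \<open>Q\<close> comes from the shadow, the bound \<open>Q - \<tau>\<close> from the tail.\<close>

lemma geo_kernel_bounds_aux:
  fixes V :: "(real^3) set" and c :: "real^3 \<Rightarrow> real" and \<beta> Q \<tau> D :: real
  assumes V: "open V" and ps: "piecewise_smooth_boundary V P"
    and c: "c \<in> borel_measurable borel" "\<And>z. 0 \<le> c z" "\<And>t z. 0 < t \<Longrightarrow> c (t *\<^sub>R z) = c z"
    and cf: "\<And>y. y \<in> V \<union> smooth_boundary_points V \<Longrightarrow> cos_factor V x y = c (y - x)"
    and \<beta>: "0 < \<beta>" and D: "\<And>y. y \<in> V \<Longrightarrow> norm (y - x) \<le> D"
    and Q: "(\<integral>\<^sup>+z. ennreal (decay \<beta> z * c z) \<partial>lborel) = ennreal Q" "0 \<le> Q"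
    and \<tau>: "ennreal \<tau> \<le> (\<integral>\<^sup>+z. ennreal (decay \<beta> z * indicator {D<..} (norm z) * c z) \<partial>lborel)" "0 \<le> \<tau>"
  shows "geo_bound V P \<beta> x Q (Q - \<tau>)"
proof -
  let ?tail = "\<integral>\<^sup>+z. ennreal (decay \<beta> z * indicator {D<..} (norm z) * c z) \<partial>lborel"
  have Vb: "V \<in> sets borel" using V by simp
  have vis: "visibility V x \<in> borel_measurable borel"
    by (rule visibility_section[OF V])
  let ?S = "\<integral>\<^sup>+y. ennreal (geo_kernel V \<beta> x y) \<partial>surface_measure P"
  let ?W = "\<integral>\<^sup>+y. ennreal (geo_kernel V \<beta> x y) \<partial>volume_measure V"
  let ?S' = "\<integral>\<^sup>+y. ennreal (exp (- \<beta> * norm (y - x)) * c (y - x) * (max 0 (cos_angle V y x) / norm (y - x) ^ 2) * visibility V x y) \<partial>surface_measure P"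
  let ?W' = "\<integral>\<^sup>+y. ennreal (decay \<beta> (y - x) * c (y - x) * visibility V x y) * indicator V y \<partial>lborel"
  have sm_AE: "AE y in surface_measure P. y \<in> smooth_boundary_points V"
    by (rule AE_surface_smooth[OF piecewise_smoothD(1,3,4)[OF ps]])
  have S: "?S = ?S'"
  proof (rule nn_integral_cong_AE)
    show "AE y in surface_measure P. ennreal (geo_kernel V \<beta> x y)
      = ennreal (exp (- \<beta> * norm (y - x)) * c (y - x) * (max 0 (cos_angle V y x) / norm (y - x) ^ 2) * visibility V x y)"
      using sm_AE
    proof eventually_elim
      case (elim y)
      then have "y \<notin> V" using smooth_boundary_subset[of V] frontier_open_disjoint[OF V] by blast
      then show ?case using cf[of y] elim
        by (simp add: geo_kernel_def cos_factor_def[of V y x] norm_minus_commute[of x y] ac_simps)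
    qed
  qed
  have W: "ennreal \<beta> * ?W = ?W'"
  proof -
    have gm: "geo_kernel V \<beta> x \<in> borel_measurable borel"
      using measurable_compose_Pair1[OF _ geo_kernel_measurable[OF V], of x \<beta>] by simp
    have "?W = (\<integral>\<^sup>+y. ennreal (geo_kernel V \<beta> x y) * indicator V y \<partial>lborel)"
      using Vb by (intro nn_integral_restrict_space) simp
    also have "ennreal \<beta> * \<dots> = (\<integral>\<^sup>+y. ennreal \<beta> * (ennreal (geo_kernel V \<beta> x y) * indicator V y) \<partial>lborel)"
      using gm Vb by (intro nn_integral_cmult[symmetric] borel_measurable_times_ennreal borel_measurable_indicator) auto
    also have "\<dots> = ?W'"
    proof (intro nn_integral_cong)
      fix y
      show "ennreal \<beta> * (ennreal (geo_kernel V \<beta> x y) * indicator V y)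
        = ennreal (decay \<beta> (y - x) * c (y - x) * visibility V x y) * indicator V y"
      proof (cases "y \<in> V")
        case True
        have "\<beta> * geo_kernel V \<beta> x y = decay \<beta> (y - x) * c (y - x) * visibility V x y"
          using True cf[of y] by (simp add: geo_kernel_def cos_factor_def[of V y x] norm_minus_commute[of x y])
        then show ?thesis using True \<beta> by (simp add: ennreal_mult'[symmetric])
      qed simp
    qed
    finally show ?thesis .
  qed
  have 1: "?S + ennreal \<beta> * ?W \<le> ennreal Q"
    unfolding S W by (rule shadow_bound[OF V ps c \<beta> Q(1)])
  have 2: "ennreal \<beta> * ?W + ennreal \<tau> \<le> ennreal Q"
  proof -
    have "ennreal \<beta> * ?W + ennreal \<tau> \<le> ?W' + (?tail)"
      unfolding W by (intro add_left_mono \<tau>)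
    also have "\<dots> \<le> ennreal Q"
      unfolding Q(1)[symmetric] by (rule volume_tail_bound[OF c(1,2) \<beta> Vb D vis])
    finally show ?thesis .
  qed
  have "?S \<le> ennreal Q" "ennreal \<beta> * ?W \<le> ennreal Q"
    using 1 by (auto intro: order_trans[rotated])
  then obtain s where s: "?S = ennreal s" "0 \<le> s"
    by (cases ?S) (auto simp: top_unique)
  have "?W \<noteq> top" using \<open>ennreal \<beta> * ?W \<le> ennreal Q\<close> \<beta> by (auto simp: ennreal_mult_top top_unique)
  then obtain v where v: "?W = ennreal v" "0 \<le> v"
    by (cases ?W) auto
  have "s + \<beta> * v \<le> Q"
    using 1 s(2) v(2) \<beta> Q(2) unfolding s(1) v(1)
    by (simp add: ennreal_mult[symmetric] ennreal_plus[symmetric] del: ennreal_plus)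
  moreover have "\<beta> * v + \<tau> \<le> Q"
    using 2 v(2) \<beta> Q(2) \<tau>(2) unfolding v(1)
    by (simp add: ennreal_mult[symmetric] ennreal_plus[symmetric] del: ennreal_plus)
  ultimately show ?thesis using s v by (intro exI[of _ s] exI[of _ v]) auto
qed

text \<open>\<open>\<delta>\<close> is uniform in \<open>x\<close>: the radius of the tail depends
  only on a bound for \<open>V\<close>, and rotation invariance makes the cosine-weighted tail
  independent of the normal.\<close>

lemma geo_kernel_bounds:
  fixes V :: "(real^3) set" and \<beta> :: real
  assumes V: "open V" and bV: "bounded V" and ps: "piecewise_smooth_boundary V P" and \<beta>: "0 < \<beta>"
  shows "\<exists>\<delta>. 0 < \<delta> \<and> \<delta> \<le> 1 \<and> (\<forall>x\<in>V \<union> smooth_boundary_points V. geo_bound V P \<beta> x (if x \<in> V then 4 * pi else pi) ((1 - \<delta>) * (if x \<in> V then 4 * pi else pi)))"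
proof -
  obtain r where r: "\<forall>x\<in>closure V. norm x \<le> r"
    using bounded_closure[OF bV] unfolding bounded_iff by blast
  define D where "D = r + r"
  have D: "norm (y - x) \<le> D" if "x \<in> closure V" "y \<in> closure V" for x y
  proof -
    have "norm y \<le> r" "norm x \<le> r" using r that by auto
    then show ?thesis using norm_triangle_ineq4[of y x] unfolding D_def by linarith
  qed
  define D' where "D' = max 0 D"
  define e where "e = axis (3::3) (1::real)"
  define T where "T c = (\<integral>\<^sup>+z. ennreal (decay \<beta> z * indicator {D'<..} (norm z) * c z) \<partial>lborel)" for c :: "real^3 \<Rightarrow> real"
  have T1: "0 < T (\<lambda>_. 1)"
    unfolding T_def by (rule tail_integral_pos) (simp_all add: \<beta> D'_def)
  have T2: "0 < T (half_cos e)"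
    unfolding T_def
  proof (rule tail_integral_pos)
    show "0 < half_cos e z" if "0 < z $ 3" for z
    proof -
      have "z \<noteq> 0" using that by auto
      then show ?thesis using that by (simp add: half_cos_def e_def inner_axis')
    qed
  qed (simp_all add: \<beta> D'_def half_cos_measurable)
  have Trot: "T (half_cos m) = T (half_cos e)" if "norm m = 1" for m
  proof -
    have "(\<lambda>r. \<beta> * exp (- \<beta> * r) / r ^ 2 * indicator {D'<..} r) \<in> borel_measurable borel"
      by (intro borel_measurable_times exp_profile_measurable borel_measurable_indicator) auto
    from nn_integral_half_cos_rotate[OF that this] show ?thesis unfolding T_def e_def .
  qed
  obtain \<tau> where \<tau>: "0 < \<tau>" "\<tau> \<le> pi" "ennreal \<tau> \<le> T (\<lambda>_. 1)" "ennreal \<tau> \<le> T (half_cos e)"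
  proof -
    define m where "m = min (ennreal pi) (min (T (\<lambda>_. 1)) (T (half_cos e)))"
    have m: "m \<le> ennreal pi" "m \<le> T (\<lambda>_. 1)" "m \<le> T (half_cos e)"
      unfolding m_def by (simp_all only: min.cobounded1 min.coboundedI2 min.cobounded2 min.coboundedI1 order_refl)
    have "0 < m" unfolding m_def min_less_iff_conj using T1 T2 pi_gt_zero by simp
    moreover have "m \<noteq> top" using m(1) by (rule neq_top_trans[OF ennreal_neq_top])
    ultimately obtain t where t: "m = ennreal t" "0 < t"
      by (cases m) auto
    have "ennreal t \<le> ennreal pi" "ennreal t \<le> T (\<lambda>_. 1)" "ennreal t \<le> T (half_cos e)"
      using m unfolding t(1) .
    then show ?thesis by (intro that[of t]) (use t(2) in simp_all)
  qed
  \<comment> \<open>The loss relative to the larger total \<open>4 * pi\<close>; it is also valid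
    relative to \<open>pi\<close>, where the loss \<open>\<tau>\<close> is four times
    \<open>\<delta> * pi\<close>. The cap \<open>\<tau> \<le> pi\<close> gives
    \<open>\<delta> \<le> 1\<close>.\<close>
  define \<delta> where "\<delta> = \<tau> / (4 * pi)"
  have \<delta>: "0 < \<delta>" "\<delta> \<le> 1" using \<tau>(1,2) by (simp_all add: \<delta>_def)
  have "geo_bound V P \<beta> x (if x \<in> V then 4 * pi else pi) ((1 - \<delta>) * (if x \<in> V then 4 * pi else pi))" if x: "x \<in> V \<union> smooth_boundary_points V" for x
  proof -
    have xc: "x \<in> closure V"
      using x closure_subset smooth_boundary_subset[of V] by (auto simp: frontier_def)
    have Dx: "norm (y - x) \<le> D'" if "y \<in> V" for y
    proof -
      have "y \<in> closure V" using that closure_subset[of V] by blast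
      then show ?thesis using D[OF xc, of y] by (simp add: D'_def)
    qed
    show ?thesis
    proof (cases "x \<in> V")
      case True
      have "geo_bound V P \<beta> x (4 * pi) (4 * pi - \<tau>)"
      proof (rule geo_kernel_bounds_aux[OF V ps _ _ _ _ \<beta> Dx, where c = "\<lambda>_. 1"])
        show "(\<integral>\<^sup>+z. ennreal (decay \<beta> z * 1) \<partial>(lborel :: (real^3) measure)) = ennreal (4 * pi)"
          using nn_integral_exp_inverse_square[OF \<beta>] by simp
        show "ennreal \<tau> \<le> (\<integral>\<^sup>+z. ennreal (decay \<beta> z * indicator {D'<..} (norm z) * 1) \<partial>(lborel :: (real^3) measure))"
          using \<tau>(3) unfolding T_def .
      qed (use True \<tau> in \<open>auto simp: cos_factor_def\<close>)
      moreover have "4 * pi - \<tau> = (1 - \<delta>) * (4 * pi)" by (simp add: \<delta>_def field_simps)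
      ultimately show ?thesis using True by simp
    next
      case False
      then have xs: "x \<in> smooth_boundary_points V" using x by simp
      define m where "m = - outward_normal V x"
      have m: "norm m = 1" using norm_outward_normal[OF xs] by (simp add: m_def)
      have cf: "cos_factor V x y = half_cos m (y - x)" for y
      proof -
        have "m \<bullet> (y - x) = (x - y) \<bullet> outward_normal V x"
          by (simp add: m_def inner_commute inner_diff_left inner_diff_right)
        then have "half_cos m (y - x) = max 0 ((x - y) \<bullet> outward_normal V x) / norm (x - y)"
          unfolding half_cos_def norm_minus_commute[of y x] by simp
        also have "\<dots> = max 0 (((x - y) \<bullet> outward_normal V x) / norm (x - y))"
          by (simp add: max_def zero_le_divide_iff)
        finally show ?thesis using False by (simp add: cos_factor_def cos_angle_def)
      qed
      have "geo_bound V P \<beta> x pi (pi - \<tau>)"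
      proof (rule geo_kernel_bounds_aux[OF V ps half_cos_measurable half_cos_nonneg half_cos_scale cf \<beta> Dx nn_integral_exp_half_cos[OF \<beta> m]])
        show "ennreal \<tau> \<le> (\<integral>\<^sup>+z. ennreal (decay \<beta> z * indicator {D'<..} (norm z) * half_cos m z) \<partial>lborel)"
          using \<tau>(4) Trot[OF m] unfolding T_def by simp
      qed (use \<tau> in auto)
      moreover have "pi - \<tau> \<le> (1 - \<delta>) * pi" using \<tau>(1) by (simp add: \<delta>_def field_simps)
      ultimately show ?thesis using False by (auto intro: order_trans)
    qed
  qed
  then show ?thesis using \<delta> by blast
qed

section \<open>The measure on the boundary and the domain together\<close>

text \<open>Boundary and open domain are disjoint subsets of the same space, so this measure on the
  whole space represents their disjoint union without a sum type.\<close>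

definition total_measure :: "'a::topological_space set \<Rightarrow> 'a measure \<Rightarrow> 'a set \<Rightarrow> 'a measure \<Rightarrow> 'a measure" where
  "total_measure A M B N = measure_of UNIV (sets borel) (\<lambda>X. emeasure M (X \<inter> A) + emeasure N (X \<inter> B))"

locale glued_measures =
  fixes A B :: "'a::topological_space set" and M N :: "'a measure"
  assumes A: "A \<in> sets borel" and B: "B \<in> sets borel" and disjoint: "A \<inter> B = {}"
    and sets_M: "sets M = sets (restrict_space borel A)" and sets_N: "sets N = sets (restrict_space borel B)"
    and fin_M: "finite_measure M" and fin_N: "finite_measure N"
begin

abbreviation "T \<equiv> total_measure A M B N"

lemma space_M: "space M = A" and space_N: "space N = B"
  using sets_eq_imp_space_eq[OF sets_M] sets_eq_imp_space_eq[OF sets_N] by (simp_all add: space_restrict_space)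

lemma sets_T: "sets T = sets borel" and space_T: "space T = UNIV"
proof -
  have s: "sigma_sets UNIV (sets borel) = sets (borel :: 'a measure)"
    using sets.sigma_sets_eq[of "borel :: 'a measure"] by simp
  show "sets T = sets borel" unfolding total_measure_def by (simp add: s)
  show "space T = UNIV" unfolding total_measure_def by simp
qed

lemma Int_sets: "X \<in> sets borel \<Longrightarrow> X \<inter> A \<in> sets M" "X \<in> sets borel \<Longrightarrow> X \<inter> B \<in> sets N"
  using A B by (auto simp: sets_M sets_N sets_restrict_space_iff)

lemma emeasure_T:
  assumes "X \<in> sets borel"
  shows "emeasure T X = emeasure M (X \<inter> A) + emeasure N (X \<inter> B)"
  unfolding total_measure_def
proof (rule emeasure_measure_of_sigma)
  show "sigma_algebra UNIV (sets (borel :: 'a measure))"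
    using sets.sigma_algebra_axioms[of "borel :: 'a measure"] by simp
  show "positive (sets borel) (\<lambda>X. emeasure M (X \<inter> A) + emeasure N (X \<inter> B))"
    by (simp add: positive_def)
  show "countably_additive (sets borel) (\<lambda>X. emeasure M (X \<inter> A) + emeasure N (X \<inter> B))"
  proof (rule countably_additiveI)
    fix F :: "nat \<Rightarrow> 'a set"
    assume F: "range F \<subseteq> sets borel" "disjoint_family F" "(\<Union>i. F i) \<in> sets borel"
    have "(\<Sum>i. emeasure M (F i \<inter> A)) = emeasure M (\<Union>i. F i \<inter> A)"
      using F Int_sets by (intro suminf_emeasure) (auto simp: disjoint_family_on_def)
    moreover have "(\<Sum>i. emeasure N (F i \<inter> B)) = emeasure N (\<Union>i. F i \<inter> B)"
      using F Int_sets by (intro suminf_emeasure) (auto simp: disjoint_family_on_def)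
    ultimately show "(\<Sum>i. emeasure M (F i \<inter> A) + emeasure N (F i \<inter> B))
        = emeasure M ((\<Union>i. F i) \<inter> A) + emeasure N ((\<Union>i. F i) \<inter> B)"
      by (subst suminf_add[symmetric]) (auto simp: Int_UN_distrib2)
  qed
qed fact

lemma measurable_T: "borel_measurable T = borel_measurable borel"
  by (rule measurable_cong_sets[OF sets_T refl])

lemma measurable_M: "f \<in> borel_measurable borel \<Longrightarrow> f \<in> borel_measurable M"
  and measurable_N: "f \<in> borel_measurable borel \<Longrightarrow> f \<in> borel_measurable N"
  unfolding measurable_cong_sets[OF sets_M refl] measurable_cong_sets[OF sets_N refl]
  by (rule measurable_restrict_space1; simp)+

lemma nn_integral_T:
  assumes f: "f \<in> borel_measurable borel"
  shows "nn_integral T f = nn_integral M f + nn_integral N f"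
proof -
  have id: "(\<lambda>x. x) \<in> measurable M borel" "(\<lambda>x. x) \<in> measurable N borel"
    by (rule measurable_M measurable_N, simp)+
  let ?N = "\<lambda>b. if b then distr M borel (\<lambda>x. x) else distr N borel (\<lambda>x. x)"
  have "nn_integral T f = (\<Sum>b\<in>{True, False}. \<integral>\<^sup>+x. f x \<partial>?N b)"
  proof (rule nn_integral_sum_measures)
    fix X assume "X \<in> sets T"
    then have X: "X \<in> sets borel" by (simp add: sets_T)
    show "emeasure T X = (\<Sum>b\<in>{True, False}. emeasure (?N b) X)"
      using X id by (simp add: emeasure_T emeasure_distr space_M space_N)
  qed (use f in \<open>auto simp: sets_T measurable_T\<close>)
  also have "\<dots> = nn_integral M f + nn_integral N f"
    using nn_integral_distr[OF id(1), of f] nn_integral_distr[OF id(2), of f] f by simp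
  finally show ?thesis .
qed

text \<open>\<open>A\<close> and \<open>B\<close> are disjoint, so a null set of one measure is not
  charged by the other, and the complement of their union is null for \<open>T\<close>.\<close>

lemma AE_T: "(AE x in T. R x) \<longleftrightarrow> (AE x in M. R x) \<and> (AE x in N. R x)"
proof
  assume "AE x in T. R x"
  then obtain X where X: "X \<in> null_sets T" "{x \<in> space T. \<not> R x} \<subseteq> X" by (auto simp: eventually_ae_filter)
  then have Xb: "X \<in> sets borel" "emeasure M (X \<inter> A) + emeasure N (X \<inter> B) = 0"
    using emeasure_T by (auto simp: null_sets_def sets_T)
  then have "X \<inter> A \<in> null_sets M" "X \<inter> B \<in> null_sets N"
    using Int_sets by (auto simp: null_sets_def)
  moreover have "{x \<in> space M. \<not> R x} \<subseteq> X \<inter> A" "{x \<in> space N. \<not> R x} \<subseteq> X \<inter> B"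
    using X(2) by (auto simp: space_T space_M space_N)
  ultimately show "(AE x in M. R x) \<and> (AE x in N. R x)"
    by (intro conjI) (rule AE_I'; assumption)+
next
  assume "(AE x in M. R x) \<and> (AE x in N. R x)"
  then obtain X Y where X: "X \<in> null_sets M" "{x \<in> space M. \<not> R x} \<subseteq> X"
    and Y: "Y \<in> null_sets N" "{x \<in> space N. \<not> R x} \<subseteq> Y" by (auto simp: eventually_ae_filter)
  have Xb: "X \<in> sets borel" "X \<subseteq> A" and Yb: "Y \<in> sets borel" "Y \<subseteq> B"
    using X(1) Y(1) A B by (auto simp: null_sets_def sets_M sets_N sets_restrict_space_iff)
  have "X \<inter> A = X" "X \<inter> B = {}" "Y \<inter> A = {}" "Y \<inter> B = Y" using Xb Yb disjoint by auto
  then have XY: "X \<in> null_sets T" "Y \<in> null_sets T"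
    using X(1) Y(1) Xb Yb emeasure_T by (auto simp: null_sets_def sets_T)
  have O: "- (A \<union> B) \<in> null_sets T"
  proof -
    have "- (A \<union> B) \<in> sets borel" using A B by (metis borel_comp sets.Un)
    moreover have "- (A \<union> B) \<inter> A = {}" "- (A \<union> B) \<inter> B = {}" by auto
    ultimately show ?thesis using emeasure_T[of "- (A \<union> B)"] by (auto simp: null_sets_def sets_T)
  qed
  have "X \<union> Y \<union> - (A \<union> B) \<in> null_sets T" using XY O by (intro null_sets.Un)
  moreover have "{x \<in> space T. \<not> R x} \<subseteq> X \<union> Y \<union> - (A \<union> B)"
    using X(2) Y(2) by (auto simp: space_M space_N)
  ultimately show "AE x in T. R x" by (rule AE_I')
qed

lemma finite_T: "finite_measure T"
proof (rule finite_measureI)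
  have "emeasure M A \<noteq> top" "emeasure N B \<noteq> top"
    using finite_measure.emeasure_finite[OF fin_M] finite_measure.emeasure_finite[OF fin_N] by auto
  then show "emeasure T (space T) \<noteq> \<infinity>"
    using emeasure_T[of UNIV] by (simp add: space_T)
qed

lemma integrable_T:
  fixes f :: "'a \<Rightarrow> real"
  assumes f: "f \<in> borel_measurable borel"
  shows "integrable T f \<longleftrightarrow> integrable M f \<and> integrable N f"
proof -
  have "(\<integral>\<^sup>+x. ennreal (norm (f x)) \<partial>T) = (\<integral>\<^sup>+x. ennreal (norm (f x)) \<partial>M) + (\<integral>\<^sup>+x. ennreal (norm (f x)) \<partial>N)"
    using f by (intro nn_integral_T) measurable
  then show ?thesis
    using f measurable_M[OF f] measurable_N[OF f] by (simp add: integrable_iff_bounded measurable_T)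
qed

lemma integral_T:
  fixes f :: "'a \<Rightarrow> real"
  assumes f: "f \<in> borel_measurable borel" and int: "integrable T f"
  shows "(\<integral>x. f x \<partial>T) = (\<integral>x. f x \<partial>M) + (\<integral>x. f x \<partial>N)"
proof -
  have int': "integrable M f" "integrable N f" using integrable_T[OF f] int by auto
  have 1: "(\<integral>\<^sup>+x. ennreal (f x) \<partial>T) = (\<integral>\<^sup>+x. ennreal (f x) \<partial>M) + (\<integral>\<^sup>+x. ennreal (f x) \<partial>N)"
    using f by (intro nn_integral_T) measurable
  have 2: "(\<integral>\<^sup>+x. ennreal (- f x) \<partial>T) = (\<integral>\<^sup>+x. ennreal (- f x) \<partial>M) + (\<integral>\<^sup>+x. ennreal (- f x) \<partial>N)"
    using f by (intro nn_integral_T) measurable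
  have fin: "(\<integral>\<^sup>+x. ennreal (f x) \<partial>M) < \<infinity>" "(\<integral>\<^sup>+x. ennreal (f x) \<partial>N) < \<infinity>"
    "(\<integral>\<^sup>+x. ennreal (- f x) \<partial>M) < \<infinity>" "(\<integral>\<^sup>+x. ennreal (- f x) \<partial>N) < \<infinity>"
    using int' by (simp_all add: real_integrable_def less_top[symmetric])
  show ?thesis
    using fin unfolding real_lebesgue_integral_def[OF int] real_lebesgue_integral_def[OF int'(1)]
      real_lebesgue_integral_def[OF int'(2)] 1 2
    by (simp add: enn2real_plus)
qed

lemma Lp_space_T:
  assumes f: "f \<in> borel_measurable borel"
  shows "f \<in> Lp_space T p \<longleftrightarrow> f \<in> Lp_space M p \<and> f \<in> Lp_space N p"
proof (cases "p = \<infinity>")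
  case True
  have "(\<exists>C. AE x in T. \<bar>f x\<bar> \<le> C) \<longleftrightarrow> (\<exists>C. AE x in M. \<bar>f x\<bar> \<le> C) \<and> (\<exists>C. AE x in N. \<bar>f x\<bar> \<le> C)"
  proof
    assume "(\<exists>C. AE x in M. \<bar>f x\<bar> \<le> C) \<and> (\<exists>C. AE x in N. \<bar>f x\<bar> \<le> C)"
    then obtain C D where C: "AE x in M. \<bar>f x\<bar> \<le> C" "AE x in N. \<bar>f x\<bar> \<le> D" by blast
    have "AE x in M. \<bar>f x\<bar> \<le> max C D" using C(1) by eventually_elim auto
    moreover have "AE x in N. \<bar>f x\<bar> \<le> max C D" using C(2) by eventually_elim auto
    ultimately show "\<exists>C. AE x in T. \<bar>f x\<bar> \<le> C" unfolding AE_T by blast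
  qed (auto simp: AE_T)
  then show ?thesis
    using f measurable_M[OF f] measurable_N[OF f] True by (simp add: Lp_space_def measurable_T)
next
  case False
  have "(\<lambda>x. \<bar>f x\<bar> powr enn2real p) \<in> borel_measurable borel" using f by measurable
  from integrable_T[OF this] show ?thesis
    using f measurable_M[OF f] measurable_N[OF f] False by (simp add: Lp_space_def measurable_T)
qed

definition glue :: "('a \<Rightarrow> real) \<Rightarrow> ('a \<Rightarrow> real) \<Rightarrow> 'a \<Rightarrow> real" where
  "glue q G x = indicator A x * q x + indicator B x * G x"

lemma glue_A: "x \<in> A \<Longrightarrow> glue q G x = q x" and glue_B: "x \<in> B \<Longrightarrow> glue q G x = G x"
  using disjoint by (auto simp: glue_def indicator_def)

lemma glue_measurable:
  assumes "q \<in> borel_measurable M" "G \<in> borel_measurable N"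
  shows "glue q G \<in> borel_measurable borel"
proof -
  have "(\<lambda>x. indicator A x *\<^sub>R q x) \<in> borel_measurable borel"
    using assms(1) A unfolding measurable_cong_sets[OF sets_M refl] by (simp add: borel_measurable_restrict_space_iff)
  moreover have "(\<lambda>x. indicator B x *\<^sub>R G x) \<in> borel_measurable borel"
    using assms(2) B unfolding measurable_cong_sets[OF sets_N refl] by (simp add: borel_measurable_restrict_space_iff)
  ultimately show ?thesis unfolding glue_def[abs_def] by simp
qed

lemma glue_Lp:
  assumes "q \<in> Lp_space M p" "G \<in> Lp_space N p"
  shows "glue q G \<in> Lp_space T p"
proof -
  have "glue q G \<in> borel_measurable borel" using assms by (intro glue_measurable) (auto simp: Lp_space_def)
  moreover have "glue q G \<in> Lp_space M p"
    using assms(1) Lp_space_cong[of M "glue q G" q] by (simp add: space_M glue_A)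
  moreover have "glue q G \<in> Lp_space N p"
    using assms(2) Lp_space_cong[of N "glue q G" G] by (simp add: space_N glue_B)
  ultimately show ?thesis by (simp add: Lp_space_T)
qed

end

section \<open>The radiative system\<close>

locale radiative_setting =
  fixes V :: "(real^3) set" and P :: "patch set" and \<sigma>\<^sub>s \<beta> \<epsilon> :: real
  assumes V_open: "open V" and V_bounded: "bounded V" and ps: "piecewise_smooth_boundary V P"
    and \<beta>: "0 < \<beta>" and \<sigma>s: "0 \<le> \<sigma>\<^sub>s" "\<sigma>\<^sub>s \<le> \<beta>" and \<epsilon>: "0 < \<epsilon>" "\<epsilon> \<le> 1"
begin

abbreviation "dS \<equiv> surface_measure P"
abbreviation "dV \<equiv> volume_measure V"
abbreviation "geo \<equiv> geo_kernel V \<beta>"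

lemmas P_facts = piecewise_smoothD[OF ps]

lemma AE_smooth: "AE x in dS. x \<in> smooth_boundary_points V"
  by (rule AE_surface_smooth[OF P_facts(1)]) (fact P_facts(3), fact P_facts(4))

sublocale glued_measures "frontier V" V dS "dV"
proof (rule glued_measures.intro)
  show "frontier V \<in> sets borel" "V \<in> sets borel" using V_open by (simp_all add: frontier_closed)
  show "frontier V \<inter> V = {}" by (rule frontier_open_disjoint[OF V_open])
  show "sets dS = sets (restrict_space borel (frontier V))"
    unfolding P_facts(2) by (rule sets_surface_measure)
  show "sets dV = sets (restrict_space borel V)"
    by (rule restrict_space_sets_cong[OF refl sets_lborel])
  show "finite_measure dS"
    by (rule finite_surface_measure[OF P_facts(1)]) (fact P_facts(3))
  show "finite_measure dV"
  proof (rule finite_measureI)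
    have "emeasure lborel V < \<infinity>" by (rule emeasure_bounded_finite[OF V_bounded])
    then show "emeasure dV (space dV) \<noteq> \<infinity>"
      using V_open by (simp add: space_restrict_space emeasure_restrict_space)
  qed
qed

text \<open>The constants of all four operators factor into a part depending on the side of
  \<open>x\<close> and a part depending on the side of \<open>y\<close>; for \<open>K1\<close>,
  \<open>(1 - \<epsilon>) / pi\<close> is \<open>\<epsilon>\<close> times
  \<open>(1 - \<epsilon>) / (\<epsilon> * pi)\<close>.\<close>

definition kernel :: "real^3 \<Rightarrow> real^3 \<Rightarrow> real" where
  "kernel x y = (if x \<in> V then 1 else \<epsilon>) * (if y \<in> V then \<sigma>\<^sub>s / (4 * pi) else (1 - \<epsilon>) / (\<epsilon> * pi)) * geo x y"

lemma geo_section: "geo_kernel V \<beta> x \<in> borel_measurable borel"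
  using measurable_compose_Pair1[OF _ geo_kernel_measurable[OF V_open], of x \<beta>] by simp

lemma geo_section': "(\<lambda>x. geo x y) \<in> borel_measurable borel"
  unfolding geo_kernel_commute[of V \<beta> _ y] by (rule geo_section)

lemma V_borel [measurable]: "V \<in> sets borel"
  using V_open by simp

lemma kernel_measurable: "(\<lambda>(x, y). kernel x y) \<in> borel_measurable (borel \<Otimes>\<^sub>M borel)"
  using geo_kernel_measurable[OF V_open, of \<beta>] unfolding kernel_def case_prod_beta by measurable

lemma kernel_section': "(\<lambda>x. kernel x y) \<in> borel_measurable borel"
proof -
  note geo_section'[measurable]
  show ?thesis unfolding kernel_def by measurable
qed

lemma kernel_nonneg: "0 \<le> kernel x y"
  using \<epsilon> \<sigma>s geo_kernel_nonneg[of V \<beta> x y] by (simp add: kernel_def)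

lemma AE_frontier: "AE x in dS. x \<in> frontier V"
  by (rule AE_I2) (simp add: space_M)

lemma AE_V_vol: "AE x in dV. x \<in> V"
  by (rule AE_I2) (simp add: space_N)

lemma AE_S: "AE x in dS. x \<in> smooth_boundary_points V \<and> x \<notin> V"
  using AE_smooth by eventually_elim (use smooth_boundary_subset[of V] frontier_open_disjoint[OF V_open] in blast)

lemma AE_T_regular: "AE x in T. x \<in> V \<union> smooth_boundary_points V"
  unfolding AE_T using AE_smooth AE_V_vol by (auto elim: eventually_mono)

lemma nn_integral_split:
  assumes f: "f \<in> borel_measurable borel"
    and s: "\<And>x. x \<in> frontier V \<Longrightarrow> f x = ennreal a * g x" and v: "\<And>x. x \<in> V \<Longrightarrow> f x = ennreal b * g x"
    and g: "g \<in> borel_measurable borel"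
  shows "nn_integral T f = ennreal a * nn_integral dS g + ennreal b * nn_integral dV g"
proof -
  have "nn_integral dS f = (\<integral>\<^sup>+x. ennreal a * g x \<partial>dS)"
    using s by (intro nn_integral_cong) (simp add: space_M)
  moreover have "nn_integral dV f = (\<integral>\<^sup>+x. ennreal b * g x \<partial>dV)"
    using v by (intro nn_integral_cong) (simp add: space_N)
  ultimately show ?thesis
    using nn_integral_T[OF f] nn_integral_cmult[OF measurable_M[OF g]] nn_integral_cmult[OF measurable_N[OF g]] by simp
qed

lemma frontier_not_in: "x \<in> frontier V \<Longrightarrow> x \<notin> V"
  using frontier_open_disjoint[OF V_open] by blast

text \<open>\<open>\<epsilon> / 4\<close> cancels \<open>1 / \<epsilon>\<close> in the source factor
  of the boundary. It also equals the target factor \<open>\<epsilon>\<close> times the total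
  \<open>pi\<close>, relative to \<open>4 * pi\<close>, so the row integrals reproduce the
  weight.\<close>

definition row_weight :: "real^3 \<Rightarrow> real" where
  "row_weight x = (if x \<in> V then 1 else \<epsilon> / 4)"

text \<open>In \<open>V\<close>, \<open>\<beta>\<close> turns the volume integral into its share of
  the ray bundle. On the boundary the value must be below 1, so that rays arriving there lose
  energy, yet large enough that \<open>1 - \<epsilon>\<close> is a proper fraction of it;
  \<open>1 - \<epsilon> / 2\<close> meets both.\<close>

definition col_weight :: "real^3 \<Rightarrow> real" where
  "col_weight x = (if x \<in> V then \<epsilon> * \<beta> else 1 - \<epsilon> / 2)"

lemma contractive: "\<exists>\<theta> lo hi. contractive_kernel T kernel row_weight col_weight \<theta> lo hi"
proof -
  obtain \<delta> where \<delta>: "0 < \<delta>" "\<delta> \<le> 1" and bounds: "\<And>x. x \<in> V \<union> smooth_boundary_points V \<Longrightarrow> geo_bound V P \<beta> x (if x \<in> V then 4 * pi else pi) ((1 - \<delta>) * (if x \<in> V then 4 * pi else pi))"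
    using geo_kernel_bounds[OF V_open V_bounded ps \<beta>] by blast
  \<comment> \<open>The columns produce this value; the rows give the smaller
    \<open>1 - \<epsilon> * \<delta>\<close>.\<close>
  define \<theta> where "\<theta> = 1 - \<epsilon> * \<delta> / 2"
  let ?h = row_weight and ?w = col_weight
  have ed: "0 < \<epsilon> * \<delta>" "\<epsilon> * \<delta> \<le> 1" "\<epsilon> * \<delta> \<le> \<epsilon>"
    using \<epsilon> \<delta> by (auto simp: mult_le_one mult_left_le)
  have hm: "?h \<in> borel_measurable borel" and wm: "?w \<in> borel_measurable borel"
    unfolding row_weight_def col_weight_def by measurable
  have "contractive_kernel T kernel ?h ?w \<theta> (min (\<epsilon> / 4) (\<epsilon> * \<beta>)) (max 1 (\<epsilon> * \<beta>))"
  proof (intro contractive_kernel.intro contractive_kernel_axioms.intro finite_T)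
    show "(\<lambda>(x, y). kernel x y) \<in> borel_measurable (T \<Otimes>\<^sub>M T)"
      unfolding measurable_cong_sets[OF sets_pair_measure_cong[OF sets_T sets_T] refl] by (rule kernel_measurable)
    show "?h \<in> borel_measurable T" "?w \<in> borel_measurable T" unfolding measurable_T by fact+
    show "0 < min (\<epsilon> / 4) (\<epsilon> * \<beta>)" using \<epsilon> \<beta> by simp
    show "0 \<le> kernel x y" for x y by (rule kernel_nonneg)
    show "min (\<epsilon> / 4) (\<epsilon> * \<beta>) \<le> ?h x" "?h x \<le> max 1 (\<epsilon> * \<beta>)"
      "min (\<epsilon> / 4) (\<epsilon> * \<beta>) \<le> ?w x" "?w x \<le> max 1 (\<epsilon> * \<beta>)" for x
      using \<epsilon> \<beta> by (auto simp: row_weight_def col_weight_def)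
    show "0 < \<theta>" "\<theta> < 1" using ed by (auto simp: \<theta>_def)
    show "AE x in T. (\<integral>\<^sup>+y. ennreal (kernel x y * ?h y) \<partial>T) \<le> ennreal (\<theta> * ?h x)"
      using AE_T_regular
    proof eventually_elim
      case (elim x)
      define Q where "Q = (if x \<in> V then 4 * pi else pi)"
      define \<rho> where "\<rho> = (if x \<in> V then 1 else \<epsilon>)"
      have \<rho>: "0 \<le> \<rho>" using \<epsilon> by (simp add: \<rho>_def)
      obtain s v where sv: "(\<integral>\<^sup>+y. ennreal (geo x y) \<partial>dS) = ennreal s"
        "(\<integral>\<^sup>+y. ennreal (geo x y) \<partial>dV) = ennreal v"
        "0 \<le> s" "0 \<le> v" "s + \<beta> * v \<le> Q" "\<beta> * v \<le> (1 - \<delta>) * Q"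
        using bounds[OF elim] unfolding Q_def by blast
      have "(\<integral>\<^sup>+y. ennreal (kernel x y * ?h y) \<partial>T)
        = ennreal (\<rho> * (1 - \<epsilon>) / (4 * pi)) * ennreal s + ennreal (\<rho> * \<sigma>\<^sub>s / (4 * pi)) * ennreal v"
        unfolding sv(1,2)[symmetric]
      proof (rule nn_integral_split)
        have "(\<lambda>y. kernel x y * ?h y) \<in> borel_measurable borel"
          using measurable_compose_Pair1[OF _ kernel_measurable, of x] hm by simp
        then show "(\<lambda>y. ennreal (kernel x y * ?h y)) \<in> borel_measurable borel" by measurable
        show "(\<lambda>y. ennreal (geo x y)) \<in> borel_measurable borel" using geo_section by measurable
        show "ennreal (kernel x y * ?h y) = ennreal (\<rho> * (1 - \<epsilon>) / (4 * pi)) * ennreal (geo x y)" if "y \<in> frontier V" for y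
          using frontier_not_in[OF that] \<epsilon> \<rho> by (subst ennreal_mult''[symmetric, OF geo_kernel_nonneg]) (simp add: kernel_def row_weight_def \<rho>_def mult.commute[of pi])
        show "ennreal (kernel x y * ?h y) = ennreal (\<rho> * \<sigma>\<^sub>s / (4 * pi)) * ennreal (geo x y)" if "y \<in> V" for y
          using that \<sigma>s \<rho> by (subst ennreal_mult''[symmetric, OF geo_kernel_nonneg]) (simp add: kernel_def row_weight_def \<rho>_def mult.commute[of pi])
      qed
      also have "\<dots> = ennreal (\<rho> / (4 * pi) * ((1 - \<epsilon>) * s + \<sigma>\<^sub>s * v))"
        using sv(3,4) \<epsilon> \<sigma>s \<rho> by (simp add: ennreal_mult[symmetric] ennreal_plus[symmetric] add_divide_distrib[symmetric] distrib_left mult.assoc del: ennreal_plus)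
      also have "\<dots> \<le> ennreal (\<theta> * ?h x)"
      proof (rule ennreal_leI)
        \<comment> \<open>The gain comes from \<open>(1 - \<epsilon>) * s\<close> alone: replacing
          \<open>s\<close> by \<open>Q - \<beta> * v\<close> leaves
          \<open>(1 - \<epsilon>) * Q + \<epsilon> * (\<beta> * v)\<close>, and
          \<open>\<beta> * v\<close> is at most \<open>(1 - \<delta>) * Q\<close>.\<close>
        have "\<sigma>\<^sub>s * v \<le> \<beta> * v" using \<sigma>s sv(4) by (intro mult_right_mono)
        moreover have "(1 - \<epsilon>) * s \<le> (1 - \<epsilon>) * (Q - \<beta> * v)" using \<epsilon> sv(5) by (intro mult_left_mono) auto
        moreover have "\<epsilon> * (\<beta> * v) \<le> \<epsilon> * ((1 - \<delta>) * Q)" using \<epsilon> sv(6) by (intro mult_left_mono) auto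
        ultimately have "(1 - \<epsilon>) * s + \<sigma>\<^sub>s * v \<le> (1 - \<epsilon> * \<delta>) * Q" by (simp add: algebra_simps)
        also have "\<dots> \<le> \<theta> * Q" using ed \<delta> \<epsilon> by (intro mult_right_mono) (auto simp: \<theta>_def Q_def)
        finally have "\<rho> / (4 * pi) * ((1 - \<epsilon>) * s + \<sigma>\<^sub>s * v) \<le> \<rho> / (4 * pi) * (\<theta> * Q)"
          using \<rho> by (intro mult_left_mono) auto
        also have "\<dots> = \<theta> * ?h x" by (simp add: \<rho>_def Q_def row_weight_def)
        finally show "\<rho> / (4 * pi) * ((1 - \<epsilon>) * s + \<sigma>\<^sub>s * v) \<le> \<theta> * ?h x" .
      qed
      finally show ?case .
    qed
    show "AE y in T. (\<integral>\<^sup>+x. ennreal (?w x * kernel x y) \<partial>T) \<le> ennreal (\<theta> * ?w y)"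
      using AE_T_regular
    proof eventually_elim
      case (elim y)
      define Q where "Q = (if y \<in> V then 4 * pi else pi)"
      define \<kappa> where "\<kappa> = (if y \<in> V then \<sigma>\<^sub>s / (4 * pi) else (1 - \<epsilon>) / (\<epsilon> * pi))"
      have \<kappa>: "0 \<le> \<kappa>" using \<epsilon> \<sigma>s by (simp add: \<kappa>_def)
      have sym: "geo x y = geo y x" for x by (rule geo_kernel_commute)
      have kn: "kernel x y = (if x \<in> V then 1 else \<epsilon>) * (\<kappa> * geo y x)" for x
        by (simp only: kernel_def \<kappa>_def sym mult.assoc)
      obtain s v where sv: "(\<integral>\<^sup>+x. ennreal (geo y x) \<partial>dS) = ennreal s"
        "(\<integral>\<^sup>+x. ennreal (geo y x) \<partial>dV) = ennreal v"
        "0 \<le> s" "0 \<le> v" "s + \<beta> * v \<le> Q" "\<beta> * v \<le> (1 - \<delta>) * Q"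
        using bounds[OF elim] unfolding Q_def by blast
      have "(\<integral>\<^sup>+x. ennreal (?w x * kernel x y) \<partial>T)
        = ennreal (\<epsilon> * \<kappa> * (1 - \<epsilon> / 2)) * ennreal s + ennreal (\<epsilon> * \<kappa> * \<beta>) * ennreal v"
        unfolding sv(1,2)[symmetric]
      proof (rule nn_integral_split)
        have "(\<lambda>x. ?w x * kernel x y) \<in> borel_measurable borel"
          by (intro borel_measurable_times wm kernel_section')
        then show "(\<lambda>x. ennreal (?w x * kernel x y)) \<in> borel_measurable borel" by measurable
        show "(\<lambda>x. ennreal (geo y x)) \<in> borel_measurable borel" using geo_section by measurable
        show "ennreal (?w x * kernel x y) = ennreal (\<epsilon> * \<kappa> * (1 - \<epsilon> / 2)) * ennreal (geo y x)" if "x \<in> frontier V" for x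
          using frontier_not_in[OF that] by (subst ennreal_mult''[symmetric, OF geo_kernel_nonneg]) (simp add: kn col_weight_def ac_simps)
        show "ennreal (?w x * kernel x y) = ennreal (\<epsilon> * \<kappa> * \<beta>) * ennreal (geo y x)" if "x \<in> V" for x
          using that by (subst ennreal_mult''[symmetric, OF geo_kernel_nonneg]) (simp add: kn col_weight_def ac_simps)
      qed
      also have "\<dots> = ennreal (\<epsilon> * \<kappa> * ((1 - \<epsilon> / 2) * s + \<beta> * v))"
        using sv(3,4) \<epsilon> \<beta> \<kappa> by (simp add: ennreal_mult[symmetric] ennreal_plus[symmetric] distrib_left mult.assoc del: ennreal_plus)
      also have "\<dots> \<le> ennreal (\<theta> * ?w y)"
      proof (rule ennreal_leI)
        have a: "(1 - \<epsilon> / 2) * s \<le> (1 - \<epsilon> / 2) * (Q - \<beta> * v)" using \<epsilon> sv(5) by (intro mult_left_mono) auto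
        have b: "\<epsilon> / 2 * (\<beta> * v) \<le> \<epsilon> / 2 * ((1 - \<delta>) * Q)" using \<epsilon> sv(6) by (intro mult_left_mono) auto
        have c: "(1 - \<epsilon> / 2) * s + \<beta> * v \<le> \<theta> * Q"
        proof -
          have "(1 - \<epsilon> / 2) * s + \<beta> * v \<le> (1 - \<epsilon> / 2) * (Q - \<beta> * v) + \<beta> * v" using a by simp
          also have "\<dots> = (1 - \<epsilon> / 2) * Q + \<epsilon> / 2 * (\<beta> * v)" by (simp add: field_simps)
          also have "\<dots> \<le> (1 - \<epsilon> / 2) * Q + \<epsilon> / 2 * ((1 - \<delta>) * Q)" using b by simp
          also have "\<dots> = \<theta> * Q" by (simp add: \<theta>_def field_simps)
          finally show ?thesis .
        qed
        show "\<epsilon> * \<kappa> * ((1 - \<epsilon> / 2) * s + \<beta> * v) \<le> \<theta> * ?w y"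
        proof (cases "y \<in> V")
          case True
          have "\<epsilon> * \<kappa> * ((1 - \<epsilon> / 2) * s + \<beta> * v) \<le> \<epsilon> * \<kappa> * (\<theta> * Q)"
            using c \<epsilon> \<kappa> by (intro mult_left_mono) auto
          also have "\<dots> = \<epsilon> * (\<theta> * \<sigma>\<^sub>s)" using True by (simp add: \<kappa>_def Q_def)
          also have "\<dots> \<le> \<epsilon> * (\<theta> * \<beta>)" using \<epsilon> \<sigma>s ed by (intro mult_left_mono) (auto simp: \<theta>_def)
          finally show ?thesis using True by (simp add: col_weight_def ac_simps)
        next
          case False
          have "(1 - \<epsilon> / 2) * s \<le> 1 * s" using sv(3) \<epsilon> by (intro mult_right_mono) auto
          then have "(1 - \<epsilon> / 2) * s + \<beta> * v \<le> pi" using sv(5) False by (simp add: Q_def)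
          then have "\<epsilon> * \<kappa> * ((1 - \<epsilon> / 2) * s + \<beta> * v) \<le> \<epsilon> * \<kappa> * pi"
            using \<epsilon> \<kappa> by (intro mult_left_mono) auto
          also have "\<dots> = 1 - \<epsilon>" using False \<epsilon> by (simp add: \<kappa>_def)
          \<comment> \<open>One factor is the weight at \<open>y\<close>; the other is at most
            \<open>\<theta>\<close> because \<open>\<delta> \<le> 1\<close>.\<close>
          also have "\<dots> \<le> (1 - \<epsilon> / 2) * (1 - \<epsilon> / 2)"
          proof -
            have "(1 - \<epsilon> / 2) * (1 - \<epsilon> / 2) = 1 - \<epsilon> + \<epsilon> * \<epsilon> / 4" by (simp add: field_simps)
            then show ?thesis by simp
          qed
          also have "\<dots> \<le> \<theta> * (1 - \<epsilon> / 2)" using ed \<epsilon> by (intro mult_right_mono) (auto simp: \<theta>_def)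
          finally show ?thesis using False by (simp add: col_weight_def)
        qed
      qed
      finally show ?case .
    qed
  qed
  then show ?thesis by blast
qed

section \<open>From the kernel to the four operators\<close>

lemma kernel_section: "kernel x \<in> borel_measurable borel"
  using measurable_compose_Pair1[OF _ kernel_measurable, of x] by simp

abbreviation KT :: "(real^3 \<Rightarrow> real) \<Rightarrow> real^3 \<Rightarrow> real" where
  "KT u x \<equiv> \<integral>y. kernel x y * u y \<partial>T"

lemma cos_angle_section: "cos_angle V x \<in> borel_measurable borel" "(\<lambda>y. cos_angle V y x) \<in> borel_measurable borel"
  unfolding cos_angle_def by measurable

lemma max_cos_visible:
  assumes "x \<in> smooth_boundary_points V"
  shows "max 0 (cos_angle V x y) * visibility V x y = cos_angle V x y * visibility V x y"
  using cos_angle_visible_nonneg[OF assms, of y] by (auto simp: visibility_def)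

text \<open>Integrability allows the Bochner integral over the union to be split into its two parts.
  The cut-off cosines agree with the true ones at almost every boundary point, by
  visibility.\<close>

lemma kernel_integral_volume:
  assumes u: "u \<in> borel_measurable borel" and int: "integrable T (\<lambda>y. kernel x y * u y)" and x: "x \<in> V"
  shows "KT u x = K4 V dS \<beta> \<epsilon> u x + K3 V \<beta> \<sigma>\<^sub>s u x"
proof -
  let ?g = "\<lambda>y. (exp (- \<beta> * norm (x - y)) * (cos_angle V y x / norm (x - y)^2) * visibility V x y * u y)"
  let ?f = "\<lambda>y. kernel x y * u y"
  note [measurable] = u kernel_section visibility_section[OF V_open] cos_angle_section
  have fm: "?f \<in> borel_measurable borel" by measurable
  have gm: "(\<lambda>y. (1 - \<epsilon>) / (\<epsilon> * pi) * ?g y) \<in> borel_measurable borel"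
    by measurable
  have "(\<integral>y. ?f y \<partial>dS) = (\<integral>y. (1 - \<epsilon>) / (\<epsilon> * pi) *
      ?g y \<partial>dS)"
  proof (rule integral_cong_AE[OF measurable_M[OF fm] measurable_M[OF gm]])
    show "AE y in dS. ?f y = (1 - \<epsilon>) / (\<epsilon> * pi) *
      ?g y"
      using AE_S
    proof eventually_elim
      case (elim y)
      have "max 0 (cos_angle V y x) * visibility V x y = cos_angle V y x * visibility V x y"
        using max_cos_visible[of y x] elim unfolding visibility_commute[of V x y] by blast
      then have "geo x y = exp (- \<beta> * norm (x - y)) * (cos_angle V y x / norm (x - y)^2) * visibility V x y"
        using x elim by (simp add: geo_kernel_def cos_factor_def mult.assoc mult.commute[of "visibility V x y"])
      then show ?case using x elim by (simp add: kernel_def)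
    qed
  qed
  then have S: "(\<integral>y. ?f y \<partial>dS) = K4 V dS \<beta> \<epsilon> u x" unfolding K4_def integral_mult_right_zero .
  have "(\<integral>y. ?f y \<partial>dV) = (\<integral>y. \<sigma>\<^sub>s / (4 * pi) *
      (exp (- \<beta> * norm (x - y)) * (1 / norm (x - y)^2) * visibility V x y * u y) \<partial>dV)"
    using x by (intro Bochner_Integration.integral_cong) (simp_all add: space_N kernel_def geo_kernel_def cos_factor_def)
  then have W: "(\<integral>y. ?f y \<partial>dV) = K3 V \<beta> \<sigma>\<^sub>s u x" unfolding K3_def integral_mult_right_zero .
  show ?thesis using integral_T[OF fm int] S W by simp
qed

text \<open>As for points of \<open>V\<close>, but the cosine at \<open>x\<close> has to be freed of
  its cut-off too, which uses that \<open>x\<close> itself has a normal.\<close>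

lemma kernel_integral_surface:
  assumes u: "u \<in> borel_measurable borel" and int: "integrable T (\<lambda>y. kernel x y * u y)"
    and x: "x \<in> smooth_boundary_points V"
  shows "KT u x = K1 V dS \<beta> \<epsilon> u x + K2 V \<beta> \<epsilon> \<sigma>\<^sub>s u x"
proof -
  let ?e = "\<lambda>y. (exp (- \<beta> * norm (x - y)) * (cos_angle V x y / norm (x - y)^2) * visibility V x y * u y)"
  let ?g = "\<lambda>y. (exp (- \<beta> * norm (x - y)) * (cos_angle V x y * cos_angle V y x / norm (x - y)^2) * visibility V x y * u y)"
  let ?f = "\<lambda>y. kernel x y * u y"
  have xV: "x \<notin> V" using x smooth_boundary_subset[of V] frontier_not_in by blast
  note [measurable] = u kernel_section visibility_section[OF V_open] cos_angle_section
  have fm: "?f \<in> borel_measurable borel" by measurable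
  have gm: "(\<lambda>y. (1 - \<epsilon>) / pi * ?g y) \<in> borel_measurable borel"
    by measurable
  have "(\<integral>y. ?f y \<partial>dS) = (\<integral>y. (1 - \<epsilon>) / pi *
      ?g y \<partial>dS)"
  proof (rule integral_cong_AE[OF measurable_M[OF fm] measurable_M[OF gm]])
    show "AE y in dS. ?f y = (1 - \<epsilon>) / pi *
      ?g y"
      using AE_S
    proof eventually_elim
      case (elim y)
      have 1: "max 0 (cos_angle V y x) * visibility V x y = cos_angle V y x * visibility V x y"
        using max_cos_visible[of y x] elim unfolding visibility_commute[of V x y] by blast
      have 2: "visibility V x y * (max 0 (cos_angle V x y) * max 0 (cos_angle V y x)) = visibility V x y * (cos_angle V x y * cos_angle V y x)"
        using 1 max_cos_visible[OF x, of y] by (simp add: visibility_def split: if_splits)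
      have "geo x y = exp (- \<beta> * norm (x - y)) / norm (x - y)^2 * (visibility V x y * (max 0 (cos_angle V x y) * max 0 (cos_angle V y x)))"
        using xV elim by (simp add: geo_kernel_def cos_factor_def)
      then have "geo x y = exp (- \<beta> * norm (x - y)) * (cos_angle V x y * cos_angle V y x / norm (x - y)^2) * visibility V x y"
        unfolding 2 by simp
      then show ?case using xV elim \<epsilon> by (simp add: kernel_def)
    qed
  qed
  then have S: "(\<integral>y. ?f y \<partial>dS) = K1 V dS \<beta> \<epsilon> u x" unfolding K1_def integral_mult_right_zero .
  have "(\<integral>y. ?f y \<partial>dV) = (\<integral>y. \<epsilon> * \<sigma>\<^sub>s / (4 * pi) *
      ?e y \<partial>dV)"
  proof (intro Bochner_Integration.integral_cong refl)
    fix y assume "y \<in> space dV"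
    then have y: "y \<in> V" by (simp add: space_N)
    have "geo x y = exp (- \<beta> * norm (x - y)) / norm (x - y)^2 * (max 0 (cos_angle V x y) * visibility V x y)"
      using xV y by (simp add: geo_kernel_def cos_factor_def)
    then have "geo x y = exp (- \<beta> * norm (x - y)) * (cos_angle V x y / norm (x - y)^2) * visibility V x y"
      unfolding max_cos_visible[OF x] by simp
    then show "?f y = \<epsilon> * \<sigma>\<^sub>s / (4 * pi) *
      ?e y"
      using xV y by (simp add: kernel_def)
  qed
  then have W: "(\<integral>y. ?f y \<partial>dV) = K2 V \<beta> \<epsilon> \<sigma>\<^sub>s u x" unfolding K2_def integral_mult_right_zero .
  show ?thesis using integral_T[OF fm int] S W by simp
qed

lemma K_cong:
  assumes "\<And>y. y \<in> frontier V \<Longrightarrow> q y = q' y" "\<And>y. y \<in> V \<Longrightarrow> G y = G' y"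
  shows "K1 V dS \<beta> \<epsilon> q x = K1 V dS \<beta> \<epsilon> q' x" "K4 V dS \<beta> \<epsilon> q x = K4 V dS \<beta> \<epsilon> q' x"
    "K2 V \<beta> \<epsilon> \<sigma>\<^sub>s G x = K2 V \<beta> \<epsilon> \<sigma>\<^sub>s G' x" "K3 V \<beta> \<sigma>\<^sub>s G x = K3 V \<beta> \<sigma>\<^sub>s G' x"
  unfolding K1_def K2_def K3_def K4_def using assms
  by (auto intro!: arg_cong2[where f = "(*)"] Bochner_Integration.integral_cong simp: space_M space_N)

text \<open>The equations are equivalent at every regular point where the integrand is integrable,
  hence as statements holding almost everywhere.\<close>

lemma radiative_solution_iff:
  assumes q: "q \<in> Lp_space dS p" and G: "G \<in> Lp_space dV p"
    and int: "AE x in T. integrable T (\<lambda>y. kernel x y * glue q G y)"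
  shows "radiative_solution V dS \<beta> \<epsilon> \<sigma>\<^sub>s p F1 F2 q G \<longleftrightarrow>
    (AE x in T. glue q G x - KT (glue q G) x = glue F1 F2 x)"
proof -
  let ?u = "glue q G"
  have u: "?u \<in> borel_measurable borel" using q G by (intro glue_measurable) (auto simp: Lp_space_def)
  have intM: "AE x in dS. integrable T (\<lambda>y. kernel x y * ?u y)"
    and intN: "AE x in dV. integrable T (\<lambda>y. kernel x y * ?u y)"
    using int unfolding AE_T by auto
  have "AE x in dS. (?u x - KT ?u x = glue F1 F2 x) \<longleftrightarrow>
      ((q x - K1 V dS \<beta> \<epsilon> q x) - K2 V \<beta> \<epsilon> \<sigma>\<^sub>s G x = F1 x)"
    using intM AE_smooth AE_frontier
  proof eventually_elim
    case (elim x)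
    have "K1 V dS \<beta> \<epsilon> ?u x = K1 V dS \<beta> \<epsilon> q x" by (rule K_cong(1)[OF glue_A glue_B])
    moreover have "K2 V \<beta> \<epsilon> \<sigma>\<^sub>s ?u x = K2 V \<beta> \<epsilon> \<sigma>\<^sub>s G x" by (rule K_cong(3)[OF glue_A glue_B])
    ultimately show ?case using kernel_integral_surface[OF u elim(1,2)] elim(3) by (simp add: glue_A diff_diff_eq)
  qed
  then have 1: "(AE x in dS. ?u x - KT ?u x = glue F1 F2 x) \<longleftrightarrow>
      (AE x in dS. (q x - K1 V dS \<beta> \<epsilon> q x) - K2 V \<beta> \<epsilon> \<sigma>\<^sub>s G x = F1 x)"
    by (rule eventually_subst)
  have "AE x in dV. (?u x - KT ?u x = glue F1 F2 x) \<longleftrightarrow>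
      (- K4 V dS \<beta> \<epsilon> q x + (G x - K3 V \<beta> \<sigma>\<^sub>s G x) = F2 x)"
    using intN AE_V_vol
  proof eventually_elim
    case (elim x)
    have "K4 V dS \<beta> \<epsilon> ?u x = K4 V dS \<beta> \<epsilon> q x" by (rule K_cong(2)[OF glue_A glue_B])
    moreover have "K3 V \<beta> \<sigma>\<^sub>s ?u x = K3 V \<beta> \<sigma>\<^sub>s G x" by (rule K_cong(4)[OF glue_A glue_B])
    ultimately show ?case using kernel_integral_volume[OF u elim(1,2)] elim(2) by (simp add: glue_B algebra_simps)
  qed
  then have 2: "(AE x in dV. ?u x - KT ?u x = glue F1 F2 x) \<longleftrightarrow>
      (AE x in dV. - K4 V dS \<beta> \<epsilon> q x + (G x - K3 V \<beta> \<sigma>\<^sub>s G x) = F2 x)"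
    by (rule eventually_subst)
  show ?thesis unfolding radiative_solution_def AE_T 1 2 using q G by simp
qed

theorem unique_radiative_solution:
  assumes F1: "F1 \<in> Lp_space dS p" and F2: "F2 \<in> Lp_space dV p" and p: "1 \<le> p"
  shows "\<exists>q G. radiative_solution V dS \<beta> \<epsilon> \<sigma>\<^sub>s p F1 F2 q G \<and>
    (\<forall>q' G'. radiative_solution V dS \<beta> \<epsilon> \<sigma>\<^sub>s p F1 F2 q' G' \<longrightarrow>
      (AE x in dS. q' x = q x) \<and> (AE x in dV. G' x = G x))"
proof -
  obtain \<theta> lo hi where "contractive_kernel T kernel row_weight col_weight \<theta> lo hi"
    using contractive by blast
  then interpret ck: contractive_kernel T kernel row_weight col_weight \<theta> lo hi .
  obtain u where u: "u \<in> Lp_space T p" "AE x in T. u x - KT u x = glue F1 F2 x"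
    and uniq: "\<And>v. v \<in> Lp_space T p \<Longrightarrow> AE x in T. v x - KT v x = glue F1 F2 x \<Longrightarrow> AE x in T. v x = u x"
    using ck.unique_solution[OF glue_Lp[OF F1 F2] p] by blast
  have ub: "u \<in> borel_measurable borel" using u(1) by (simp add: Lp_space_def measurable_T)
  have uL: "u \<in> Lp_space dS p" "u \<in> Lp_space dV p"
    using u(1) Lp_space_T[OF ub] by auto
  \<comment> \<open>One function \<open>u\<close> serves as both components of the solution.
    \<open>glue u u\<close> may differ from it only off the boundary and the domain, which is a null
    set for \<open>T\<close>.\<close>
  have gu: "AE x in T. glue u u x = u x"
    unfolding AE_T by (auto intro!: AE_I2 simp: space_M space_N glue_A glue_B)
  have solu: "AE x in T. glue u u x - KT (glue u u) x = glue F1 F2 x"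
  proof -
    have gm: "glue u u \<in> borel_measurable borel" using uL by (intro glue_measurable) (auto simp: Lp_space_def)
    have eq: "KT (glue u u) x = KT u x" for x
    proof (rule integral_cong_AE)
      show "(\<lambda>y. kernel x y * glue u u y) \<in> borel_measurable T" "(\<lambda>y. kernel x y * u y) \<in> borel_measurable T"
        unfolding measurable_T using kernel_section gm ub by (auto intro!: borel_measurable_times)
      show "AE y in T. kernel x y * glue u u y = kernel x y * u y"
        using gu by eventually_elim simp
    qed
    show ?thesis using u(2) gu by eventually_elim (simp add: eq)
  qed
  have "radiative_solution V dS \<beta> \<epsilon> \<sigma>\<^sub>s p F1 F2 u u"
    using radiative_solution_iff[OF uL ck.kernel_integrable[OF glue_Lp[OF uL] p]] solu by blast
  moreover have "(AE x in dS. q' x = u x) \<and> (AE x in dV. G' x = u x)"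
    if sol: "radiative_solution V dS \<beta> \<epsilon> \<sigma>\<^sub>s p F1 F2 q' G'" for q' G'
  proof -
    have L: "q' \<in> Lp_space dS p" "G' \<in> Lp_space dV p"
      using sol by (auto simp: radiative_solution_def)
    have "AE x in T. glue q' G' x = u x"
      using uniq[OF glue_Lp[OF L]] radiative_solution_iff[OF L ck.kernel_integrable[OF glue_Lp[OF L] p]] sol by blast
    then have a: "AE x in dS. glue q' G' x = u x" and b: "AE x in dV. glue q' G' x = u x"
      unfolding AE_T by auto
    have "AE x in dS. q' x = u x"
      using a AE_frontier by eventually_elim (simp add: glue_A)
    moreover have "AE x in dV. G' x = u x"
      using b AE_V_vol by eventually_elim (simp add: glue_B)
    ultimately show ?thesis by blast
  qed
  ultimately show ?thesis by blast
qed

end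

theorem theorem1:
  fixes V :: "(real^3) set" and P :: "patch set" and dS :: "(real^3) measure"
    and \<sigma>\<^sub>a \<sigma>\<^sub>s \<beta> \<epsilon> \<epsilon>\<^sub>0 \<sigma> :: real and T :: "real^3 \<Rightarrow> real" and p :: ennreal
  assumes "open V" and "connected V" and "V \<noteq> {}" and "bounded V"
    and "piecewise_smooth_boundary V P" and "dS = surface_measure P"
    and "0 \<le> \<sigma>\<^sub>a" and "0 \<le> \<sigma>\<^sub>s" and "\<beta> = \<sigma>\<^sub>a + \<sigma>\<^sub>s" and "0 < \<beta>"
    and "0 < \<sigma>"
    and "1 \<le> p"
    and "f1 V dS \<beta> \<epsilon> \<sigma>\<^sub>a \<sigma> T \<in> Lp_space dS p"
    and "f2 V dS \<beta> \<sigma>\<^sub>a \<sigma> T \<in> Lp_space (volume_measure V) p"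
    and "0 < \<epsilon>\<^sub>0" and "\<epsilon>\<^sub>0 < 1" and "\<epsilon>\<^sub>0 \<le> \<epsilon>" and "\<epsilon> \<le> 1"
    and "\<sigma>\<^sub>s / (\<beta> + \<sigma>\<^sub>s) < \<epsilon>\<^sub>0"
  shows "\<exists>q G.
      radiative_solution V dS \<beta> \<epsilon> \<sigma>\<^sub>s p (f1 V dS \<beta> \<epsilon> \<sigma>\<^sub>a \<sigma> T) (f2 V dS \<beta> \<sigma>\<^sub>a \<sigma> T) q G \<and>
      (\<forall>q' G'. radiative_solution V dS \<beta> \<epsilon> \<sigma>\<^sub>s p (f1 V dS \<beta> \<epsilon> \<sigma>\<^sub>a \<sigma> T) (f2 V dS \<beta> \<sigma>\<^sub>a \<sigma> T) q' G' \<longrightarrow>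
         (AE x in dS. q' x = q x) \<and> (AE x in volume_measure V. G' x = G x))"
proof -
  have "\<sigma>\<^sub>s \<le> \<beta>" "0 < \<epsilon>" using assms by simp_all
  then interpret radiative_setting V P \<sigma>\<^sub>s \<beta> \<epsilon>
    using assms by unfold_locales auto
  show ?thesis
    using unique_radiative_solution assms by blast
qed

end
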